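(* Fix an integer $g$. For any two cores $N,N'$ of signed genus $g$, there is a finite sequence $N=N_0,N_1,\dots,N_k=N'$ of cores of signed genus $g$ such that for each $i$ there is a homomorphism $N_i\to N_{i+1}$ or a homomorphism $N_{i+1}\to N_i$. That is, the poset $(\mathcal M_c(g),\le)$ of (isomorphism classes of) cores of signed genus $g$, ordered by $N\le N'$ iff there is a homomorphism $N\to N'$, is connected.
   Context: Maps. A map $M$ is a tuple $(C,\alpha_0,\alpha_1,\alpha_2)$, where $C$ is a finite set (of crosses) and $\alpha_0,\alpha_1,\alpha_2$ are fixed-point-free involutions of $C$ with $\alpha_0\alpha_2=\alpha_2\alpha_0$, together with a finite number (possibly zero) of isolated vertices. Vertex permutation $\tau=\alpha_1\alpha_2$, face permutation $\phi=\alpha_1\alpha_0$. Vertices: orbits of $\langle\alpha_1,\alpha_2\rangle$ on $C$ plus isolated vertices; edges: orbits of $\langle\alpha_0,\alpha_2\rangle$; faces: orbits of $\langle\alpha_0,\alpha_1\rangle$ plus one face per isolated vertex; connected components: orbits of $\langle\alpha_0,\alpha_1,\alpha_2\rangle$ plus one per isolated vertex. A cross is incident with the vertex/face containing it; two crosses are coincident with a face if they lie in the same cycle of $\phi$; the degree of a face is the number of crosses in one of its $\phi$-cycles. $\mathbf v,\mathbf e,\mathbf f,\mathbf k$ count vertices, edges, faces, components. For connected $M$ with an edge, $\mathbf o(M)$ is the number of orbits of $\langle\alpha_0\alpha_2,\alpha_1\alpha_2\rangle$ on $C$; an edgeless connected map has $\mathbf o=2$; in general $\mathbf o$ is the minimum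 over components. $\boldsymbol\chi=\mathbf v-\mathbf e+\mathbf f$, $\mathbf{eg}=2\mathbf k-\boldsymbol\chi$, $\mathbf g=\mathbf{eg}/\mathbf o$, signed genus $\mathbf{sg}=(2\mathbf o-3)\mathbf g$. Isomorphism: same number of isolated vertices and a bijection of crosses commuting with each $\alpha_i$. Deletion and submaps: $M\backslash e$ removes the four crosses of edge $e$, restricts $\alpha_0,\alpha_2$, and chooses $\alpha_1$ so that the new vertex permutation cycles are those of $\tau$ with the crosses of $e$ removed (a vertex all of whose crosses lie in $e$ becomes isolated). Deleting a vertex deletes its incident edges then removes it. A submap is obtained by deleting some edges then some vertices; proper if different from $M$. Vertex gluing: for distinct crosses $a,b$ let $M^{(a\,b)}=(C,\alpha_0,(a\;b)\alpha_1(a\;b),\alpha_2)$. If $a,b$ are incident with distinct vertices and either are coincident with a common face or lie in different components, passing to $M^{(a\,b)}$ is a vertex gluing; deleting an isolated vertex when gluing it to another vertex is also a vertex gluing. Duplicate edges: two distinct edges incident with a common face of degree two; gluing them replaces $M$ by (a map isomorphic to) $M\backslash f$ for one of them $f$. Homomorphisms and cores: for $\mathbf{sg}(M)=\mathbf{sg}(M')$, a homomorphism $M\to M'$ exists if $M'$ has a submap isomorphic to a map obtained from $M$ by a finite sequence of vertex gluings and duplicate edge gluings. A map $M$ is a core if there is no homomorphism from $M$ to a proper submap of $M$. *)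

theory Defs
  imports Complex_Main "HOL-Combinatorics.Permutations" "HOL-Library.Infinite_Typeclass"
begin

text \<open>Isolated vertices carry no crosses and no structure, so only their number is recorded.\<close>

record 'a cmap =
  crosses :: "'a set"
  alpha0 :: "'a \<Rightarrow> 'a"
  alpha1 :: "'a \<Rightarrow> 'a"
  alpha2 :: "'a \<Rightarrow> 'a"
  isolated :: nat

definition fpf_involution_on :: "'a set \<Rightarrow> ('a \<Rightarrow> 'a) \<Rightarrow> bool" where
  "fpf_involution_on C f \<longleftrightarrow> f permutes C \<and> (\<forall>c\<in>C. f (f c) = c \<and> f c \<noteq> c)"

text \<open>The last condition says that every edge consists of exactly four crosses.
  Since \<^const>\<open>permutes\<close> makes the involutions the identity outside the set of crosses,
  equality of records is equality of maps.\<close>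

definition is_map :: "'a cmap \<Rightarrow> bool" where
  "is_map M \<longleftrightarrow>
     finite (crosses M) \<and>
     fpf_involution_on (crosses M) (alpha0 M) \<and>
     fpf_involution_on (crosses M) (alpha1 M) \<and>
     fpf_involution_on (crosses M) (alpha2 M) \<and>
     alpha0 M \<circ> alpha2 M = alpha2 M \<circ> alpha0 M \<and>
     (\<forall>c\<in>crosses M. alpha0 M c \<noteq> alpha2 M c)"

text \<open>For permutations of a finite set the inverses of the generators are positive powers of them,
  so this is the orbit under the group generated by \<open>F\<close>.\<close>

definition gen_orbit :: "('a \<Rightarrow> 'a) set \<Rightarrow> 'a \<Rightarrow> 'a set" where
  "gen_orbit F c = {(x, y). \<exists>f\<in>F. y = f x}\<^sup>* `` {c}"

definition orbits_on :: "('a \<Rightarrow> 'a) set \<Rightarrow> 'a set \<Rightarrow> 'a set set" where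
  "orbits_on F C = gen_orbit F ` C"

definition vertex_perm :: "'a cmap \<Rightarrow> 'a \<Rightarrow> 'a" where
  "vertex_perm M = alpha1 M \<circ> alpha2 M"

definition face_perm :: "'a cmap \<Rightarrow> 'a \<Rightarrow> 'a" where
  "face_perm M = alpha1 M \<circ> alpha0 M"

text \<open>\<open>vertices\<close>, \<open>faces\<close> and \<open>components\<close> are only those containing a cross; those belonging to
  isolated vertices enter through the counts.\<close>

definition vertices :: "'a cmap \<Rightarrow> 'a set set" where
  "vertices M = orbits_on {alpha1 M, alpha2 M} (crosses M)"

definition edges :: "'a cmap \<Rightarrow> 'a set set" where
  "edges M = orbits_on {alpha0 M, alpha2 M} (crosses M)"

definition faces :: "'a cmap \<Rightarrow> 'a set set" where
  "faces M = orbits_on {alpha0 M, alpha1 M} (crosses M)"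

definition components :: "'a cmap \<Rightarrow> 'a set set" where
  "components M = orbits_on {alpha0 M, alpha1 M, alpha2 M} (crosses M)"

definition num_vertices :: "'a cmap \<Rightarrow> nat" where
  "num_vertices M = card (vertices M) + isolated M"

definition num_edges :: "'a cmap \<Rightarrow> nat" where
  "num_edges M = card (edges M)"

definition num_faces :: "'a cmap \<Rightarrow> nat" where
  "num_faces M = card (faces M) + isolated M"

definition num_components :: "'a cmap \<Rightarrow> nat" where
  "num_components M = card (components M) + isolated M"

text \<open>On the empty map this is a minimum over the empty set, but the value is immaterial: the Euler
  genus of the empty map is 0, hence so is its signed genus.\<close>

definition orient :: "'a cmap \<Rightarrow> nat" where
  "orient M = Min
     ((\<lambda>K. card (orbits_on {alpha0 M \<circ> alpha2 M, alpha1 M \<circ> alpha2 M} K)) ` components M \<union>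
      (if isolated M > 0 then {2} else {}))"

definition euler_char :: "'a cmap \<Rightarrow> int" where
  "euler_char M = int (num_vertices M) - int (num_edges M) + int (num_faces M)"

definition euler_genus :: "'a cmap \<Rightarrow> int" where
  "euler_genus M = 2 * int (num_components M) - euler_char M"

definition genus :: "'a cmap \<Rightarrow> rat" where
  "genus M = of_int (euler_genus M) / of_nat (orient M)"

definition signed_genus :: "'a cmap \<Rightarrow> rat" where
  "signed_genus M = (2 * of_nat (orient M) - 3) * genus M"

definition map_iso :: "'a cmap \<Rightarrow> 'b cmap \<Rightarrow> bool" where
  "map_iso M N \<longleftrightarrow> isolated M = isolated N \<and>
     (\<exists>h. bij_betw h (crosses M) (crosses N) \<and>
          (\<forall>c\<in>crosses M. h (alpha0 M c) = alpha0 N (h c) \<and>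
                         h (alpha1 M c) = alpha1 N (h c) \<and>
                         h (alpha2 M c) = alpha2 N (h c)))"

text \<open>The cycles of \<open>first_return f D\<close> on the complement of \<open>D\<close> are those of \<open>f\<close> with the elements
  of \<open>D\<close> removed.\<close>

definition first_return :: "('a \<Rightarrow> 'a) \<Rightarrow> 'a set \<Rightarrow> 'a \<Rightarrow> 'a" where
  "first_return f D c = (f ^^ (LEAST n. n > 0 \<and> (f ^^ n) c \<notin> D)) c"

text \<open>Simultaneous deletion of a set \<open>F\<close> of edges; \<open>M \ e\<close> is the case \<open>F = {e}\<close>. The new
  \<open>alpha1\<close> is determined by the requirement that \<open>alpha1 \<circ> alpha2\<close> be the vertex permutation
  with the deleted crosses removed from its cycles.\<close>

definition del_edges :: "'a cmap \<Rightarrow> 'a set set \<Rightarrow> 'a cmap" where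
  "del_edges M F =
     (let D = \<Union>F; C' = crosses M - D in
      \<lparr>crosses = C',
       alpha0 = (\<lambda>c. if c \<in> C' then alpha0 M c else c),
       alpha1 = (\<lambda>c. if c \<in> C' then first_return (vertex_perm M) D (alpha2 M c) else c),
       alpha2 = (\<lambda>c. if c \<in> C' then alpha2 M c else c),
       isolated = isolated M + card {V \<in> vertices M. V \<subseteq> D}\<rparr>)"

definition remove_isolated :: "'a cmap \<Rightarrow> 'a cmap" where
  "remove_isolated M = M\<lparr>isolated := isolated M - 1\<rparr>"

text \<open>Once its incident edges are deleted, a vertex \<open>V\<close> has become isolated.\<close>

inductive vertex_deletion :: "'a cmap \<Rightarrow> 'a cmap \<Rightarrow> bool" where
  "V \<in> vertices M \<Longrightarrow>
     vertex_deletion M (remove_isolated (del_edges M {e \<in> edges M. e \<inter> V \<noteq> {}}))"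
| "isolated M > 0 \<Longrightarrow> vertex_deletion M (remove_isolated M)"

definition submap :: "'a cmap \<Rightarrow> 'a cmap \<Rightarrow> bool" where
  "submap N M \<longleftrightarrow> (\<exists>F \<subseteq> edges M. vertex_deletion\<^sup>*\<^sup>* (del_edges M F) N)"

definition proper_submap :: "'a cmap \<Rightarrow> 'a cmap \<Rightarrow> bool" where
  "proper_submap N M \<longleftrightarrow> submap N M \<and> N \<noteq> M"

definition swap_crosses :: "'a cmap \<Rightarrow> 'a \<Rightarrow> 'a \<Rightarrow> 'a cmap" where
  "swap_crosses M a b =
     M\<lparr>alpha1 := transpose a b \<circ> alpha1 M \<circ> transpose a b\<rparr>"

definition incident_vertex :: "'a cmap \<Rightarrow> 'a \<Rightarrow> 'a set" where
  "incident_vertex M c = gen_orbit {alpha1 M, alpha2 M} c"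

definition component_of :: "'a cmap \<Rightarrow> 'a \<Rightarrow> 'a set" where
  "component_of M c = gen_orbit {alpha0 M, alpha1 M, alpha2 M} c"

definition coincident :: "'a cmap \<Rightarrow> 'a \<Rightarrow> 'a \<Rightarrow> bool" where
  "coincident M a b \<longleftrightarrow> b \<in> gen_orbit {face_perm M} a"

inductive vertex_gluing :: "'a cmap \<Rightarrow> 'a cmap \<Rightarrow> bool" where
  "\<lbrakk>a \<in> crosses M; b \<in> crosses M; a \<noteq> b;
    incident_vertex M a \<noteq> incident_vertex M b;
    coincident M a b \<or> component_of M a \<noteq> component_of M b\<rbrakk>
   \<Longrightarrow> vertex_gluing M (swap_crosses M a b)"
| "\<lbrakk>isolated M > 0; num_vertices M \<ge> 2\<rbrakk> \<Longrightarrow> vertex_gluing M (remove_isolated M)"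

text \<open>A face is the union of two cycles of the face permutation, of equal length.\<close>

definition face_degree :: "'a cmap \<Rightarrow> 'a set \<Rightarrow> nat" where
  "face_degree M A = card (gen_orbit {face_perm M} (SOME c. c \<in> A))"

definition duplicate_edges :: "'a cmap \<Rightarrow> 'a set \<Rightarrow> 'a set \<Rightarrow> bool" where
  "duplicate_edges M e f \<longleftrightarrow> e \<in> edges M \<and> f \<in> edges M \<and> e \<noteq> f \<and>
     (\<exists>A\<in>faces M. face_degree M A = 2 \<and> e \<inter> A \<noteq> {} \<and> f \<inter> A \<noteq> {})"

inductive duplicate_gluing :: "'a cmap \<Rightarrow> 'a cmap \<Rightarrow> bool" where
  "\<lbrakk>duplicate_edges M e f; is_map N; map_iso (del_edges M {f}) N\<rbrakk> \<Longrightarrow> duplicate_gluing M N"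

definition gluing :: "'a cmap \<Rightarrow> 'a cmap \<Rightarrow> bool" where
  "gluing M N \<longleftrightarrow> vertex_gluing M N \<or> duplicate_gluing M N"

definition hom_exists :: "'a cmap \<Rightarrow> 'b cmap \<Rightarrow> bool" where
  "hom_exists M M' \<longleftrightarrow> is_map M \<and> is_map M' \<and> signed_genus M = signed_genus M' \<and>
     (\<exists>P Q. gluing\<^sup>*\<^sup>* M P \<and> submap Q M' \<and> map_iso P Q)"

definition is_core :: "'a cmap \<Rightarrow> bool" where
  "is_core M \<longleftrightarrow> is_map M \<and> \<not> (\<exists>N. proper_submap N M \<and> hom_exists M N)"

definition cores :: "int \<Rightarrow> 'a cmap set" where
  "cores g = {M. is_core M \<and> signed_genus M = of_int g}"

definition core_classes :: "int \<Rightarrow> 'a cmap set set" where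
  "core_classes g = cores g // {(M, N). M \<in> cores g \<and> N \<in> cores g \<and> map_iso M N}"

definition class_le :: "'a cmap set \<Rightarrow> 'a cmap set \<Rightarrow> bool" where
  "class_le X Y \<longleftrightarrow> (\<exists>N\<in>X. \<exists>N'\<in>Y. hom_exists N N')"

text \<open>Connectedness of an ordered set means connectedness of its comparability graph.\<close>

definition order_connected :: "'b set \<Rightarrow> ('b \<Rightarrow> 'b \<Rightarrow> bool) \<Rightarrow> bool" where
  "order_connected A le \<longleftrightarrow>
     (\<forall>x\<in>A. \<forall>y\<in>A. (x, y) \<in> {(u, v). u \<in> A \<and> v \<in> A \<and> (le u v \<or> le v u)}\<^sup>*)"

end

theory Submission
  imports Defs "HOL-Combinatorics.Cycles" "HOL-Library.Countable"
begin

text \<open>If \<open>g = 0\<close>, the empty map is a core below every core. Otherwise glue vertices of a core until one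
  vertex remains, and glue duplicate edges until none is left. On such a map no gluing is possible,
  and a map on which no gluing is possible and which has no isolated vertex is a core. Deleting an
  edge between two distinct faces preserves the signed genus and yields a submap, so every core is
  linked to a map with one vertex and one face, which is again a core.

  A map with one vertex is a chord diagram whose chords may be twisted. Sliding one end of a chord
  along a neighbouring chord amounts to adding an edge that cuts off a triangle and deleting another
  edge of that triangle. If the diagram has one face, the intermediate map has two faces, of degree 3
  and of odd degree; so it has no face of degree two and is a core, and slides stay within the
  comparability graph of the cores. As in the classification of surfaces, slides bring a diagram with
  one face into a normal form determined by the signed genus.\<close>

section \<open>Orbits\<close>

text \<open>Gluings lead up in the order and deletions lead down, but every map visited on the way
  must itself be a core. This is why slides are only applied to words with one face: a slide
  involves two edges, so with \<open>n \<ge> 2\<close> edges the intermediate map has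
  \<open>n + 1\<close> edges, and its face other than the triangle has degree
  \<open>2 * (n + 1) - 3 \<ge> 3\<close>. Genus zero stands apart because there a map with one
  vertex and one face has no edge left. For positive Euler genus and one face, the Euler genus is
  the number of edges. Hence the sign of \<open>g\<close> tells projective planes from handles and
  its absolute value fixes their number, provided that the two kinds never occur together; so
  handles next to a projective plane are traded for projective planes. A slide passes through a map
  with one more edge, so crosses must not run out: all half-edges are placed into the infinite type
  by one injection that is fixed beforehand.\<close>

lemma gen_orbit_refl [simp, intro]: "c \<in> gen_orbit F c"
  by (simp add: gen_orbit_def)

lemma gen_orbit_step: "x \<in> gen_orbit F c \<Longrightarrow> f \<in> F \<Longrightarrow> f x \<in> gen_orbit F c"
  by (auto simp: gen_orbit_def intro: rtrancl_into_rtrancl)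

lemma gen_orbit_least:
  assumes "c \<in> S" and "\<And>x f. x \<in> S \<Longrightarrow> f \<in> F \<Longrightarrow> f x \<in> S"
  shows "gen_orbit F c \<subseteq> S"
proof
  fix x assume "x \<in> gen_orbit F c"
  then have "(c, x) \<in> {(x, y). \<exists>f\<in>F. y = f x}\<^sup>*" by (simp add: gen_orbit_def)
  then show "x \<in> S" by (induction rule: rtrancl_induct) (use assms in auto)
qed

lemma gen_orbit_funpow: "f \<in> F \<Longrightarrow> (f ^^ n) c \<in> gen_orbit F c"
  by (induction n) (auto intro: gen_orbit_step)

lemma gen_orbit_mono_on:
  assumes "c \<in> C" and "\<And>f x. f \<in> F \<Longrightarrow> x \<in> C \<Longrightarrow> f x \<in> C \<and> f x \<in> gen_orbit G x"
  shows "gen_orbit F c \<subseteq> gen_orbit G c"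
proof -
  have "gen_orbit F c \<subseteq> gen_orbit G c \<inter> C"
  proof (rule gen_orbit_least)
    show "c \<in> gen_orbit G c \<inter> C" using assms by simp
    fix x f assume x: "x \<in> gen_orbit G c \<inter> C" and f: "f \<in> F"
    have "gen_orbit G x \<subseteq> gen_orbit G c"
      by (rule gen_orbit_least) (use x in \<open>auto intro: gen_orbit_step\<close>)
    then show "f x \<in> gen_orbit G c \<inter> C" using assms(2)[OF f] x by blast
  qed
  then show ?thesis by blast
qed

text \<open>Reversibility makes the orbits on \<open>C\<close> the classes of an equivalence relation.\<close>

definition reversible_on :: "('a \<Rightarrow> 'a) set \<Rightarrow> 'a set \<Rightarrow> bool" where
  "reversible_on F C \<longleftrightarrow> (\<forall>f\<in>F. \<forall>x\<in>C. f x \<in> C \<and> x \<in> gen_orbit F (f x))"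

lemma reversible_on_involutions:
  assumes "\<And>f x. f \<in> F \<Longrightarrow> x \<in> C \<Longrightarrow> f x \<in> C \<and> f (f x) = x"
  shows "reversible_on F C"
  unfolding reversible_on_def
proof (intro ballI conjI)
  fix f x assume "f \<in> F" "x \<in> C"
  then show "f x \<in> C" "x \<in> gen_orbit F (f x)"
    using assms gen_orbit_step[OF gen_orbit_refl, of f F "f x"] by force+
qed

lemma reversible_on_permutations:
  assumes "finite C" and perm: "\<And>f. f \<in> F \<Longrightarrow> f permutes C"
  shows "reversible_on F C"
  unfolding reversible_on_def
proof (intro ballI conjI)
  fix f x assume f: "f \<in> F" and x: "x \<in> C"
  show "f x \<in> C" using perm[OF f] x by (simp add: permutes_in_image)
  have "range (\<lambda>n. (f ^^ n) x) \<subseteq> C"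
    using permutes_in_image[OF permutes_funpow[OF perm[OF f]]] x by auto
  then have "finite {y. \<exists>n. y = (f ^^ n) x}"
    using finite_subset[OF _ \<open>finite C\<close>] by (simp add: full_SetCompr_eq)
  then obtain n where n: "n > 0" "(f ^^ n) x = x"
    using funpow_inj_finite permutes_inj[OF perm[OF f]] by metis
  then have "(f ^^ (n - 1)) (f x) = x"
    by (metis Suc_diff_1 funpow_Suc_right o_apply)
  then show "x \<in> gen_orbit F (f x)" using gen_orbit_funpow[OF f] by metis
qed

lemma gen_orbit_in:
  assumes "reversible_on F C" "c \<in> C"
  shows "gen_orbit F c \<subseteq> C"
  by (rule gen_orbit_least) (use assms in \<open>auto simp: reversible_on_def\<close>)

lemma gen_orbit_trans: "x \<in> gen_orbit F c \<Longrightarrow> gen_orbit F x \<subseteq> gen_orbit F c"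
  by (rule gen_orbit_least) (auto intro: gen_orbit_step)

lemma gen_orbit_eq:
  assumes rev: "reversible_on F C" and c: "c \<in> C" and x: "x \<in> gen_orbit F c"
  shows "gen_orbit F x = gen_orbit F c"
proof
  show "gen_orbit F x \<subseteq> gen_orbit F c" by (rule gen_orbit_trans[OF x])
  have "gen_orbit F c \<subseteq> {y \<in> C. c \<in> gen_orbit F y}"
  proof (rule gen_orbit_least)
    show "c \<in> {y \<in> C. c \<in> gen_orbit F y}" using c by simp
    fix y f assume y: "y \<in> {y \<in> C. c \<in> gen_orbit F y}" and f: "f \<in> F"
    then have "f y \<in> C" "y \<in> gen_orbit F (f y)" using rev by (auto simp: reversible_on_def)
    then show "f y \<in> {y \<in> C. c \<in> gen_orbit F y}" using y gen_orbit_trans[of y F "f y"] by blast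
  qed
  then have "c \<in> gen_orbit F x" using x by blast
  then show "gen_orbit F c \<subseteq> gen_orbit F x" by (rule gen_orbit_trans)
qed

lemma gen_orbit_step_eq:
  assumes "reversible_on F C" "c \<in> C" "f \<in> F"
  shows "gen_orbit F (f c) = gen_orbit F c"
  using gen_orbit_eq[OF assms(1,2)] gen_orbit_step[OF gen_orbit_refl assms(3)] by blast

lemma gen_orbit_disjoint:
  assumes "reversible_on F C" "c \<in> C" "d \<in> C" "gen_orbit F c \<noteq> gen_orbit F d"
  shows "gen_orbit F c \<inter> gen_orbit F d = {}"
  using gen_orbit_eq[OF assms(1,2)] gen_orbit_eq[OF assms(1,3)] assms(4) by blast

text \<open>Hypothesis \<open>conj\<close> compares, point by point, the sets of all images under
  the generators. No bijection between \<open>F\<close> and \<open>G\<close> has to be named, and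
  generators need to correspond only on \<open>C\<close>.\<close>

lemma gen_orbit_image:
  assumes c: "c \<in> C" and F: "\<And>f x. f \<in> F \<Longrightarrow> x \<in> C \<Longrightarrow> f x \<in> C"
    and conj: "\<And>x. x \<in> C \<Longrightarrow> (\<lambda>g. g (h x)) ` G = (\<lambda>f. h (f x)) ` F"
  shows "gen_orbit G (h c) = h ` gen_orbit F c"
proof
  have "gen_orbit G (h c) \<subseteq> h ` (gen_orbit F c \<inter> C)"
  proof (rule gen_orbit_least)
    fix y g assume "y \<in> h ` (gen_orbit F c \<inter> C)" and g: "g \<in> G"
    then obtain x where x: "x \<in> gen_orbit F c" "x \<in> C" "y = h x" by blast
    have "g (h x) \<in> (\<lambda>f. h (f x)) ` F"
      unfolding conj[OF x(2), symmetric] using g by (rule imageI)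
    then obtain f where f: "f \<in> F" "g y = h (f x)" using x(3) by auto
    then have "f x \<in> gen_orbit F c \<inter> C"
      using x F[OF f(1) x(2)] gen_orbit_step[OF x(1) f(1)] by simp
    then show "g y \<in> h ` (gen_orbit F c \<inter> C)" using f(2) by simp
  qed (use c in auto)
  then show "gen_orbit G (h c) \<subseteq> h ` gen_orbit F c" by blast
  have "gen_orbit F c \<subseteq> {x \<in> C. h x \<in> gen_orbit G (h c)}"
  proof (rule gen_orbit_least)
    fix x f assume x: "x \<in> {x \<in> C. h x \<in> gen_orbit G (h c)}" and f: "f \<in> F"
    have xC: "x \<in> C" using x by simp
    have "h (f x) \<in> (\<lambda>g. g (h x)) ` G" unfolding conj[OF xC] using f by (rule imageI)
    then obtain g where "g \<in> G" "h (f x) = g (h x)" by auto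
    then show "f x \<in> {x \<in> C. h x \<in> gen_orbit G (h c)}"
      using x F[OF f xC] gen_orbit_step[of "h x" G "h c" g] by simp
  qed (use c in auto)
  then show "h ` gen_orbit F c \<subseteq> gen_orbit G (h c)" by blast
qed

lemma orbits_on_image:
  assumes F: "reversible_on F C"
    and conj: "\<And>x. x \<in> C \<Longrightarrow> (\<lambda>g. g (h x)) ` G = (\<lambda>f. h (f x)) ` F"
  shows "orbits_on G (h ` C) = image h ` orbits_on F C"
proof -
  have "gen_orbit G (h c) = h ` gen_orbit F c" if "c \<in> C" for c
    by (rule gen_orbit_image[OF that _ conj]) (use F in \<open>auto simp: reversible_on_def\<close>)
  then show ?thesis by (simp add: orbits_on_def image_image cong: image_cong)
qed

lemma card_orbits_on_image:
  assumes F: "reversible_on F C" and inj: "inj_on h C"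
    and conj: "\<And>x. x \<in> C \<Longrightarrow> (\<lambda>g. g (h x)) ` G = (\<lambda>f. h (f x)) ` F"
  shows "card (orbits_on G (h ` C)) = card (orbits_on F C)"
proof -
  have "orbits_on F C \<subseteq> Pow C" using gen_orbit_in[OF F] by (auto simp: orbits_on_def)
  then have "inj_on (image h) (orbits_on F C)"
    by (meson inj inj_on_image_Pow inj_on_subset)
  then show ?thesis using orbits_on_image[OF F conj] by (simp add: card_image)
qed

lemma even_card_fpf_involution:
  assumes "finite A" and "\<And>x. x \<in> A \<Longrightarrow> f x \<in> A \<and> f (f x) = x \<and> f x \<noteq> x"
  shows "even (card A)"
  using assms
proof (induction A rule: finite_psubset_induct)
  case (psubset A)
  show ?case
  proof (cases "A = {}")
    case False
    then obtain x where x: "x \<in> A" by blast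
    let ?B = "A - {x, f x}"
    have fx: "f x \<in> A" "f x \<noteq> x" "f (f x) = x" using psubset.prems x by auto
    have "f y \<in> ?B \<and> f (f y) = y \<and> f y \<noteq> y" if "y \<in> ?B" for y
      using that psubset.prems fx by (metis Diff_iff insert_iff singletonD)
    then have "even (card ?B)" using psubset.IH[of ?B] x by blast
    moreover have "card A = card ?B + card {x, f x}"
      using psubset.hyps x fx by (metis add.commute card_Diff_subset card_mono empty_subsetI finite.emptyI
          finite.insertI insert_subset le_add_diff_inverse)
    ultimately show ?thesis using fx by simp
  qed simp
qed

text \<open>The parity argument: cutting the \<open>\<alpha>\<close>-edge at \<open>a\<close> cannot separate \<open>a\<close> from \<open>\<alpha> a\<close>, because a
  piece containing only one of them would be perfectly matched by \<open>\<beta>\<close>, and perfectly matched by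
  \<open>\<alpha>\<close> except for one element.\<close>

lemma merge_orbits:
  fixes G :: "('a \<Rightarrow> 'a) set" and \<alpha> \<alpha>' :: "'a \<Rightarrow> 'a"
  assumes fin: "finite C"
    and G: "\<And>f x. f \<in> G \<Longrightarrow> x \<in> C \<Longrightarrow> f x \<in> C \<and> f (f x) = x"
    and \<alpha>: "\<And>x. x \<in> C \<Longrightarrow> \<alpha> x \<in> C \<and> \<alpha> (\<alpha> x) = x \<and> \<alpha> x \<noteq> x"
    and \<beta>: "\<beta> \<in> G" "\<And>x. x \<in> C \<Longrightarrow> \<beta> x \<noteq> x"
    and \<alpha>': "\<And>x. x \<in> C \<Longrightarrow> \<alpha>' x = transpose a b (\<alpha> (transpose a b x))"
    and ab: "a \<in> C" "b \<in> C" "gen_orbit (insert \<alpha> G) a \<noteq> gen_orbit (insert \<alpha> G) b"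
  shows "orbits_on (insert \<alpha>' G) C =
           insert (gen_orbit (insert \<alpha> G) a \<union> gen_orbit (insert \<alpha> G) b)
             (orbits_on (insert \<alpha> G) C - {gen_orbit (insert \<alpha> G) a, gen_orbit (insert \<alpha> G) b})"
    and "gen_orbit (insert \<alpha>' G) a = gen_orbit (insert \<alpha> G) a \<union> gen_orbit (insert \<alpha> G) b"
    and "Suc (card (orbits_on (insert \<alpha>' G) C)) = card (orbits_on (insert \<alpha> G) C)"
proof -
  let ?F = "insert \<alpha> G" and ?F' = "insert \<alpha>' G"
  let ?O = "gen_orbit ?F" and ?O' = "gen_orbit ?F'"
  have revF: "reversible_on ?F C" using G \<alpha> by (intro reversible_on_involutions) auto
  have \<alpha>'C: "\<alpha>' x \<in> C \<and> \<alpha>' (\<alpha>' x) = x" if "x \<in> C" for x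
  proof -
    have "transpose a b x \<in> C" using that ab by (simp add: transpose_def)
    then have "\<alpha> (transpose a b x) \<in> C" using \<alpha> by blast
    then have "\<alpha>' x \<in> C" using that ab \<alpha>' by (simp add: transpose_def)
    then show ?thesis using that \<alpha>' \<alpha> \<open>transpose a b x \<in> C\<close> by simp
  qed
  have revF': "reversible_on ?F' C" using G \<alpha>'C by (intro reversible_on_involutions) auto
  have dis: "?O a \<inter> ?O b = {}" using gen_orbit_disjoint[OF revF ab(1,2,3)] .
  have aO: "\<alpha> a \<in> ?O a" "\<alpha> b \<in> ?O b" by (auto intro: gen_orbit_step)
  have refls: "a \<in> ?O a" "b \<in> ?O b" by auto
  have neq: "a \<noteq> b" "\<alpha> a \<noteq> b" "\<alpha> b \<noteq> a" "\<alpha> a \<noteq> \<alpha> b"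
    using dis aO refls by (metis disjoint_iff)+
  have neq': "\<alpha> a \<noteq> a" "\<alpha> b \<noteq> b" using \<alpha> ab by auto
  have \<alpha>C: "\<alpha> a \<in> C" "\<alpha> b \<in> C" using \<alpha> ab by auto
  \<comment> \<open>The two \<alpha>-edges at \<open>a\<close> and \<open>b\<close> are rewired:
    \<open>a\<close> is now matched with \<open>\<alpha> b\<close>, and \<open>b\<close> with
    \<open>\<alpha> a\<close>.\<close>
  have \<alpha>'_vals: "\<alpha>' a = \<alpha> b" "\<alpha>' b = \<alpha> a" "\<alpha>' (\<alpha> a) = b" "\<alpha>' (\<alpha> b) = a"
    using \<alpha>' ab \<alpha>C neq neq' \<alpha> by (auto simp: transpose_def)
  have \<alpha>'_other: "\<alpha>' x = \<alpha> x" if "x \<in> C" "x \<notin> {a, b, \<alpha> a, \<alpha> b}" for x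
  proof -
    have "\<alpha> x \<notin> {a, b}" using that \<alpha> ab by (metis insertCI insertE singletonD)
    then show ?thesis using that \<alpha>' by (auto simp: transpose_def)
  qed
  \<comment> \<open>\<open>\<alpha>''\<close> is \<open>\<alpha>\<close> with the edge at
    \<open>a\<close> cut, so \<open>?B\<close> is what \<open>a\<close> reaches without using that
    edge. This piece meets no rewired edge other than the cut one, and hence also lies in the new
    orbit of \<open>a\<close>.\<close>
  define \<alpha>'' where "\<alpha>'' x = (if x \<in> {a, \<alpha> a} then x else \<alpha> x)" for x
  let ?B = "gen_orbit (insert \<alpha>'' G) a"
  have revB: "reversible_on (insert \<alpha>'' G) C"
  proof (rule reversible_on_involutions)
    fix f x assume "f \<in> insert \<alpha>'' G" "x \<in> C"
    moreover have "\<alpha>'' x \<in> C \<and> \<alpha>'' (\<alpha>'' x) = x"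
    proof -
      have "\<alpha> x \<notin> {a, \<alpha> a}" if "x \<notin> {a, \<alpha> a}" using that \<alpha> ab \<open>x \<in> C\<close> by (metis insertE insertI1 insertCI singletonD)
      then show ?thesis using \<alpha> \<open>x \<in> C\<close> by (auto simp: \<alpha>''_def)
    qed
    ultimately show "f x \<in> C \<and> f (f x) = x" using G by auto
  qed
  have BC: "?B \<subseteq> C" using gen_orbit_in[OF revB ab(1)] .
  then have finB: "finite ?B" using fin finite_subset by blast
  have BO': "?B \<subseteq> ?O' a \<inter> ?O a"
  proof (rule gen_orbit_least)
    fix x f assume x: "x \<in> ?O' a \<inter> ?O a" and f: "f \<in> insert \<alpha>'' G"
    have xC: "x \<in> C" using x gen_orbit_in[OF revF ab(1)] by blast
    show "f x \<in> ?O' a \<inter> ?O a"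
    proof (cases "f \<in> G")
      case True
      then show ?thesis using x gen_orbit_step[of x _ _ f] by blast
    next
      case False
      then have f: "f = \<alpha>''" using f by blast
      show ?thesis
      proof (cases "x \<in> {a, \<alpha> a}")
        case True
        then have "f x = x" by (simp add: f \<alpha>''_def)
        then show ?thesis using x by simp
      next
        case False
        have "x \<notin> {b, \<alpha> b}" using x dis aO(2) by blast
        then have "\<alpha>' x = \<alpha> x" using \<alpha>'_other[OF xC] False by blast
        moreover have "f x = \<alpha> x" using False by (simp add: f \<alpha>''_def)
        ultimately show ?thesis using x gen_orbit_step[of x ?F' a \<alpha>'] gen_orbit_step[of x ?F a \<alpha>] by simp
      qed
    qed
  qed auto
  have "\<alpha> a \<in> ?B"
  proof (rule ccontr)
    assume no: "\<alpha> a \<notin> ?B"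
    have "even (card ?B)"
    proof (rule even_card_fpf_involution[OF finB, of \<beta>])
      fix x assume x: "x \<in> ?B"
      then have "x \<in> C" using BC by blast
      then show "\<beta> x \<in> ?B \<and> \<beta> (\<beta> x) = x \<and> \<beta> x \<noteq> x"
        using \<beta> G gen_orbit_step[OF x, of \<beta>] by simp
    qed
    moreover have "even (card (?B - {a}))"
    proof (rule even_card_fpf_involution[of _ \<alpha>])
      fix x assume x: "x \<in> ?B - {a}"
      then have "x \<noteq> \<alpha> a" using no by blast
      then have "\<alpha>'' x = \<alpha> x" using x by (simp add: \<alpha>''_def)
      then have "\<alpha> x \<in> ?B" using x gen_orbit_step[of x "insert \<alpha>'' G" a \<alpha>''] by simp
      moreover have xC: "x \<in> C" using x BC by blast
      moreover have "\<alpha> x \<noteq> a" using \<open>x \<noteq> \<alpha> a\<close> \<alpha>[OF xC] by auto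
      ultimately show "\<alpha> x \<in> ?B - {a} \<and> \<alpha> (\<alpha> x) = x \<and> \<alpha> x \<noteq> x" using \<alpha>[OF xC] by simp
    qed (use finB in auto)
    moreover have "card ?B = Suc (card (?B - {a}))"
      by (rule card.remove[OF finB gen_orbit_refl])
    ultimately show False by (metis even_Suc)
  qed
  then have m1: "\<alpha> a \<in> ?O' a" using BO' by blast
  have m2: "\<alpha> b \<in> ?O' a" using gen_orbit_step[OF gen_orbit_refl, of \<alpha>' ?F' a] \<alpha>'_vals by simp
  have m3: "b \<in> ?O' a" using gen_orbit_step[OF m1, of \<alpha>'] \<alpha>'_vals by simp
  have closed: "?O' a \<subseteq> C" using gen_orbit_in[OF revF' ab(1)] .
  have step: "f x \<in> ?O' a" if "x \<in> ?O' a" "f \<in> ?F" for f x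
  proof (cases "f \<in> G")
    case True
    then show ?thesis using that gen_orbit_step[of x _ _ f] by blast
  next
    case False
    then have f: "f = \<alpha>" using that by blast
    have xC: "x \<in> C" using that closed by blast
    show ?thesis
    proof (cases "x \<in> {a, b, \<alpha> a, \<alpha> b}")
      case True
      then show ?thesis using m1 m2 m3 f \<alpha>[OF ab(1)] \<alpha>[OF ab(2)] by auto
    next
      case False
      then have "\<alpha>' x = \<alpha> x" using \<alpha>'_other xC by blast
      then show ?thesis using gen_orbit_step[OF that(1), of \<alpha>'] f by simp
    qed
  qed
  have sub: "?O c \<subseteq> ?O' a" if "c \<in> ?O' a" for c
  proof (rule gen_orbit_least[OF that])
    fix x f assume "x \<in> ?O' a" "f \<in> ?F"
    then show "f x \<in> ?O' a" by (rule step)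
  qed
  have sup: "?O' a \<subseteq> ?O a \<union> ?O b"
  proof (rule gen_orbit_least)
    fix x f assume x: "x \<in> ?O a \<union> ?O b" and f: "f \<in> ?F'"
    have xC: "x \<in> C" using x gen_orbit_in[OF revF] ab by blast
    show "f x \<in> ?O a \<union> ?O b"
    proof (cases "f \<in> G")
      case True
      then show ?thesis using x gen_orbit_step[of x _ _ f] by blast
    next
      case False
      then have f: "f = \<alpha>'" using f by blast
      show ?thesis
      proof (cases "x \<in> {a, b, \<alpha> a, \<alpha> b}")
        case True
        then show ?thesis using aO \<alpha>'_vals f by auto
      next
        case False
        then have "\<alpha>' x = \<alpha> x" using \<alpha>'_other xC by blast
        then show ?thesis using x f gen_orbit_step[of x ?F _ \<alpha>] by auto
      qed
    qed
  qed auto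
  show merged: "?O' a = ?O a \<union> ?O b" using sub[OF gen_orbit_refl] sub[OF m3] sup by blast
  have other: "?O' x = ?O x" if "x \<in> C" "x \<notin> ?O a \<union> ?O b" for x
  proof -
    have no: "y \<notin> ?O a \<union> ?O b" if "y \<in> ?O x" for y
    proof
      assume "y \<in> ?O a \<union> ?O b"
      then have "?O y = ?O a \<or> ?O y = ?O b"
        using gen_orbit_eq[OF revF ab(1), of y] gen_orbit_eq[OF revF ab(2), of y] by blast
      then have "x \<in> ?O a \<union> ?O b"
        using gen_orbit_eq[OF revF \<open>x \<in> C\<close> that] gen_orbit_refl[of x ?F] by auto
      then show False using \<open>x \<notin> ?O a \<union> ?O b\<close> by blast
    qed
    have eq: "\<alpha>' y = \<alpha> y" if "y \<in> ?O x" for y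
    proof (rule \<alpha>'_other)
      show "y \<in> C" using that gen_orbit_in[OF revF \<open>x \<in> C\<close>] by blast
      show "y \<notin> {a, b, \<alpha> a, \<alpha> b}" using no[OF that] aO by auto
    qed
    have 1: "?O' x \<subseteq> ?O x"
    proof (rule gen_orbit_least)
      fix y f assume y: "y \<in> ?O x" and "f \<in> ?F'"
      then show "f y \<in> ?O x"
        using eq[OF y] gen_orbit_step[OF y, of f] gen_orbit_step[OF y, of \<alpha>] by auto
    qed simp
    have 2: "?O x \<subseteq> ?O' x \<inter> ?O x"
    proof (rule gen_orbit_least)
      fix y f assume y: "y \<in> ?O' x \<inter> ?O x" and f: "f \<in> ?F"
      then have "f y \<in> ?O x" using gen_orbit_step[of y ?F x f] by blast
      moreover have "f y \<in> ?O' x"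
        using f y eq[of y] gen_orbit_step[of y ?F' x \<alpha>'] gen_orbit_step[of y ?F' x f] by auto
      ultimately show "f y \<in> ?O' x \<inter> ?O x" by blast
    qed simp
    show ?thesis using 1 2 by blast
  qed
  have inside: "?O' x = ?O a \<union> ?O b" if "x \<in> ?O a \<union> ?O b" for x
    using gen_orbit_eq[OF revF' ab(1), of x] that merged by simp
  have inside0: "?O x = ?O a \<or> ?O x = ?O b" if "x \<in> ?O a \<union> ?O b" for x
    using gen_orbit_eq[OF revF ab(1), of x] gen_orbit_eq[OF revF ab(2), of x] that by blast
  have notin: "?O x \<noteq> ?O a \<and> ?O x \<noteq> ?O b" if "x \<notin> ?O a \<union> ?O b" for x
    using that gen_orbit_refl[of x ?F] by blast
  show eq: "orbits_on ?F' C = insert (?O a \<union> ?O b) (orbits_on ?F C - {?O a, ?O b})"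
  proof
    show "orbits_on ?F' C \<subseteq> insert (?O a \<union> ?O b) (orbits_on ?F C - {?O a, ?O b})"
    proof
      fix K assume "K \<in> orbits_on ?F' C"
      then obtain x where x: "x \<in> C" "K = ?O' x" by (auto simp: orbits_on_def)
      show "K \<in> insert (?O a \<union> ?O b) (orbits_on ?F C - {?O a, ?O b})"
        using x inside[of x] other[of x] notin[of x]
        by (cases "x \<in> ?O a \<union> ?O b") (auto simp: orbits_on_def)
    qed
    show "insert (?O a \<union> ?O b) (orbits_on ?F C - {?O a, ?O b}) \<subseteq> orbits_on ?F' C"
    proof
      fix K assume K: "K \<in> insert (?O a \<union> ?O b) (orbits_on ?F C - {?O a, ?O b})"
      show "K \<in> orbits_on ?F' C"
      proof (cases "K = ?O a \<union> ?O b")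
        case True
        then show ?thesis using merged ab by (auto simp: orbits_on_def)
      next
        case False
        then obtain x where x: "x \<in> C" "K = ?O x" "?O x \<noteq> ?O a" "?O x \<noteq> ?O b"
          using K by (auto simp: orbits_on_def)
        then have "K = ?O' x" using inside0[of x] other[of x] by blast
        then show ?thesis using x by (auto simp: orbits_on_def)
      qed
    qed
  qed
  have finO: "finite (orbits_on ?F C)" using fin by (simp add: orbits_on_def)
  have "?O a \<union> ?O b \<notin> orbits_on ?F C"
  proof
    assume "?O a \<union> ?O b \<in> orbits_on ?F C"
    then obtain x where "x \<in> C" "?O x = ?O a \<union> ?O b" by (auto simp: orbits_on_def)
    then show False using inside0[of x] gen_orbit_refl[of x ?F] dis refls by auto
  qed
  moreover have "{?O a, ?O b} \<subseteq> orbits_on ?F C" using ab by (auto simp: orbits_on_def)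
  moreover from this have "card {?O a, ?O b} \<le> card (orbits_on ?F C)"
    using finO card_mono by blast
  ultimately show "Suc (card (orbits_on ?F' C)) = card (orbits_on ?F C)"
    unfolding eq using finO ab(3) by (simp add: card_Diff_subset)
qed

section \<open>Maps and orientability\<close>

lemma is_map_involution:
  assumes "is_map M" "f \<in> {alpha0 M, alpha1 M, alpha2 M}" "x \<in> crosses M"
  shows "f x \<in> crosses M" "f (f x) = x" "f x \<noteq> x"
  using assms by (auto simp: is_map_def fpf_involution_on_def permutes_in_image)

lemma is_map_alpha:
  assumes "is_map M" "x \<in> crosses M"
  shows "alpha0 M x \<in> crosses M" "alpha1 M x \<in> crosses M" "alpha2 M x \<in> crosses M"
    "alpha0 M (alpha0 M x) = x" "alpha1 M (alpha1 M x) = x" "alpha2 M (alpha2 M x) = x"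
    "alpha0 M x \<noteq> x" "alpha1 M x \<noteq> x" "alpha2 M x \<noteq> x"
  using is_map_involution[OF assms(1) _ assms(2)] by auto

lemma is_map_permutes:
  assumes "is_map M" "f \<in> {alpha0 M, alpha1 M, alpha2 M}"
  shows "f permutes crosses M"
  using assms by (auto simp: is_map_def fpf_involution_on_def)

lemma is_map_commute: "is_map M \<Longrightarrow> alpha0 M (alpha2 M x) = alpha2 M (alpha0 M x)"
  by (auto simp: is_map_def fun_eq_iff)

lemma is_map_finite: "is_map M \<Longrightarrow> finite (crosses M)"
  by (simp add: is_map_def)

lemma is_map_reversible:
  assumes "is_map M" "F \<subseteq> {alpha0 M, alpha1 M, alpha2 M}"
  shows "reversible_on F (crosses M)"
proof (rule reversible_on_involutions)
  fix f x assume "f \<in> F" "x \<in> crosses M"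
  then have "f \<in> {alpha0 M, alpha1 M, alpha2 M}" using assms(2) by blast
  then show "f x \<in> crosses M \<and> f (f x) = x" using is_map_involution assms(1) \<open>x \<in> crosses M\<close> by metis
qed

lemma edge_eq:
  assumes M: "is_map M" and c: "c \<in> crosses M"
  shows "gen_orbit {alpha0 M, alpha2 M} c = {c, alpha0 M c, alpha2 M c, alpha0 M (alpha2 M c)}"
proof
  note a = is_map_alpha[OF M]
  show "gen_orbit {alpha0 M, alpha2 M} c \<subseteq> {c, alpha0 M c, alpha2 M c, alpha0 M (alpha2 M c)}"
  proof (rule gen_orbit_least)
    fix x f assume "x \<in> {c, alpha0 M c, alpha2 M c, alpha0 M (alpha2 M c)}" "f \<in> {alpha0 M, alpha2 M}"
    then show "f x \<in> {c, alpha0 M c, alpha2 M c, alpha0 M (alpha2 M c)}"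
      using a[OF c] a(4)[OF a(3)[OF c]] a(6)[OF a(1)[OF c]] by (auto simp: is_map_commute[OF M])
  qed simp
  have "alpha2 M c \<in> gen_orbit {alpha0 M, alpha2 M} c"
    using gen_orbit_step[OF gen_orbit_refl, of "alpha2 M" "{alpha0 M, alpha2 M}"] by simp
  moreover have "alpha0 M c \<in> gen_orbit {alpha0 M, alpha2 M} c"
    using gen_orbit_step[OF gen_orbit_refl, of "alpha0 M" "{alpha0 M, alpha2 M}"] by simp
  ultimately show "{c, alpha0 M c, alpha2 M c, alpha0 M (alpha2 M c)} \<subseteq> gen_orbit {alpha0 M, alpha2 M} c"
    using gen_orbit_step[of "alpha2 M c" "{alpha0 M, alpha2 M}" c "alpha0 M"] by simp
qed

lemma card_edge:
  assumes M: "is_map M" and e: "e \<in> edges M"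
  shows "card e = 4"
proof -
  note a = is_map_alpha[OF M]
  obtain c where c: "c \<in> crosses M" "e = gen_orbit {alpha0 M, alpha2 M} c"
    using e by (auto simp: edges_def orbits_on_def)
  have "alpha0 M c \<noteq> alpha2 M c" using M c by (simp add: is_map_def)
  moreover have "alpha0 M (alpha2 M c) \<noteq> c" using calculation a[OF c(1)] a(4)[OF a(3)[OF c(1)]] by metis
  moreover have "alpha0 M (alpha2 M c) \<noteq> alpha0 M c" using a[OF c(1)] a(4)[OF a(3)[OF c(1)]] by metis
  moreover have "alpha0 M (alpha2 M c) \<noteq> alpha2 M c" using a(7)[OF a(3)[OF c(1)]] .
  ultimately show ?thesis
    using a[OF c(1)] unfolding c(2) edge_eq[OF M c(1)] by (auto simp: card_insert_if)
qed

lemma card_crosses_eq: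
  assumes M: "is_map M"
  shows "card (crosses M) = 4 * num_edges M"
proof -
  have rev: "reversible_on {alpha0 M, alpha2 M} (crosses M)" using is_map_reversible[OF M] by simp
  have "4 * card (edges M) = card (\<Union>(edges M))"
  proof (rule card_partition)
    show "finite (edges M)" using is_map_finite[OF M] by (simp add: edges_def orbits_on_def)
    have "\<Union>(edges M) \<subseteq> crosses M" using gen_orbit_in[OF rev] by (auto simp: edges_def orbits_on_def)
    then show "finite (\<Union>(edges M))" using is_map_finite[OF M] by (rule finite_subset)
    fix e f assume "e \<in> edges M" "f \<in> edges M" "e \<noteq> f"
    then show "e \<inter> f = {}" using gen_orbit_disjoint[OF rev] by (auto simp: edges_def orbits_on_def)
  qed (use card_edge[OF M] in auto)
  moreover have "\<Union>(edges M) = crosses M"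
    using gen_orbit_in[OF rev] by (auto simp: edges_def orbits_on_def)
  ultimately show ?thesis by (simp add: num_edges_def)
qed

section \<open>Two-colourings of the crosses and orientability\<close>

lemma card_flip:
  assumes "finite A" and "\<And>x. x \<in> A \<Longrightarrow> f x \<in> A \<and> f (f x) = x" and flip: "\<And>x. x \<in> A \<Longrightarrow> s (f x) \<noteq> (s x :: bool)"
  shows "card {x \<in> A. s x} = card {x \<in> A. \<not> s x}"
proof (rule bij_betw_same_card[of f])
  show "bij_betw f {x \<in> A. s x} {x \<in> A. \<not> s x}"
  proof (rule bij_betw_byWitness[where f' = f])
    show "f ` {x \<in> A. s x} \<subseteq> {x \<in> A. \<not> s x}" using assms(2) flip by blast
    show "f ` {x \<in> A. \<not> s x} \<subseteq> {x \<in> A. s x}" using assms(2) flip by blast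
  qed (use assms(2) in simp_all)
qed

text \<open>By \<open>\<beta>\<close> both colours occur equally often on \<open>V\<close>, and by
  \<open>\<alpha>\<close> they do so on \<open>V - {a, \<alpha> a}\<close>. The two elements left
  over must therefore differ in colour. Thus a colouring that is known at all
  \<open>\<alpha>\<close>-edges but one is correct at the last one too.\<close>

lemma flip_across_cut:
  fixes s :: "'a \<Rightarrow> bool"
  assumes fin: "finite V" and a: "a \<in> V"
    and \<alpha>: "\<And>x. x \<in> V \<Longrightarrow> \<alpha> x \<in> V \<and> \<alpha> (\<alpha> x) = x"
    and \<beta>: "\<And>x. x \<in> V \<Longrightarrow> \<beta> x \<in> V \<and> \<beta> (\<beta> x) = x"
    and \<beta>_flip: "\<And>x. x \<in> V \<Longrightarrow> s (\<beta> x) \<noteq> s x"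
    and \<alpha>_flip: "\<And>x. x \<in> V \<Longrightarrow> x \<noteq> a \<Longrightarrow> x \<noteq> \<alpha> a \<Longrightarrow> s (\<alpha> x) \<noteq> s x"
  shows "s a \<noteq> s (\<alpha> a)"
proof
  assume eq: "s a = s (\<alpha> a)"
  let ?W = "V - {a, \<alpha> a}"
  have "card {x \<in> ?W. s x} = card {x \<in> ?W. \<not> s x}"
  proof (rule card_flip[of _ \<alpha>])
    fix x assume x: "x \<in> ?W"
    then have "\<alpha> x \<noteq> a" "\<alpha> x \<noteq> \<alpha> a" using \<alpha>[of x] \<alpha>[OF a] by auto
    then show "\<alpha> x \<in> ?W \<and> \<alpha> (\<alpha> x) = x" using \<alpha>[of x] x by simp
    show "s (\<alpha> x) \<noteq> s x" using \<alpha>_flip[of x] x by simp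
  qed (use fin in simp)
  moreover have "card {x \<in> V. s x} = card {x \<in> V. \<not> s x}" by (rule card_flip[of _ \<beta>]) (use fin \<beta> \<beta>_flip in auto)
  moreover have "\<alpha> a \<in> V" using \<alpha>[OF a] by simp
  ultimately have eqs: "card {x \<in> ?W. s x} = card {x \<in> ?W. \<not> s x}" "card {x \<in> V. s x} = card {x \<in> V. \<not> s x}"
    "\<alpha> a \<in> V" by simp_all
  have less: "card {x \<in> ?W. t x} < card {x \<in> V. t x}" if "t a" for t
    by (rule psubset_card_mono) (use fin a that in auto)
  show False
  proof (cases "s a")
    case True
    then have "{x \<in> ?W. \<not> s x} = {x \<in> V. \<not> s x}" using eq by auto
    then show False using less[of s] True eqs by simp
  next
    case False
    then have "{x \<in> ?W. s x} = {x \<in> V. s x}" using eq by auto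
    then show False using less[of "\<lambda>x. \<not> s x"] False eqs by simp
  qed
qed

definition colouring_on :: "'a cmap \<Rightarrow> 'a set \<Rightarrow> ('a \<Rightarrow> bool) \<Rightarrow> bool" where
  "colouring_on M K s \<longleftrightarrow>
     (\<forall>c\<in>K. s (alpha0 M c) \<noteq> s c \<and> s (alpha1 M c) \<noteq> s c \<and> s (alpha2 M c) \<noteq> s c)"

definition orientable :: "'a cmap \<Rightarrow> bool" where
  "orientable M \<longleftrightarrow> (\<exists>s. colouring_on M (crosses M) s)"

text \<open>The generators are products of two involutions, so an orbit collects crosses at even
  distance, and the orbits of \<open>c\<close> and \<open>alpha2 M c\<close> together cover the
  component. If they coincide, an even walk joins two crosses that a colouring would have to
  separate; if they are disjoint, they are the colour classes.\<close>

lemma card_even_orbits_component: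
  assumes M: "is_map M" and c: "c \<in> crosses M"
  defines "K \<equiv> component_of M c"
  shows "card (orbits_on {alpha0 M \<circ> alpha2 M, alpha1 M \<circ> alpha2 M} K) =
    (if \<exists>s. colouring_on M K s then 2 else 1)" (is "card (orbits_on ?E K) = (if ?col then 2 else 1)")
proof -
  note a = is_map_alpha[OF M]
  let ?A = "{alpha0 M, alpha1 M, alpha2 M}"
  let ?O = "gen_orbit ?E"
  have rev: "reversible_on ?A (crosses M)" using is_map_reversible[OF M] by simp
  have revE: "reversible_on ?E (crosses M)"
    using is_map_permutes[OF M] by (intro reversible_on_permutations is_map_finite[OF M])
      (auto intro!: permutes_compose)
  have KC: "K \<subseteq> crosses M" using gen_orbit_in[OF rev c] by (simp add: K_def component_of_def)
  have cK: "c \<in> K" by (simp add: K_def component_of_def)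
  have Kcl: "f x \<in> K" if "x \<in> K" "f \<in> ?A" for f x
    using gen_orbit_step[of x ?A c f] that by (simp add: K_def component_of_def)
  \<comment> \<open>Conjugation by \<open>alpha2\<close> fixes \<open>alpha0 \<circ> alpha2\<close>
    and inverts \<open>alpha1 \<circ> alpha2\<close>, so \<open>alpha2\<close> maps orbits to
    orbits.\<close>
  have two: "alpha2 M x \<in> ?O (alpha2 M y)" if "x \<in> ?O y" "y \<in> crosses M" for x y
  proof -
    have "?O y \<subseteq> {x \<in> crosses M. alpha2 M x \<in> ?O (alpha2 M y)}"
    proof (rule gen_orbit_least)
      fix x f assume x: "x \<in> {x \<in> crosses M. alpha2 M x \<in> ?O (alpha2 M y)}" and f: "f \<in> ?E"
      then have xC: "x \<in> crosses M" "alpha2 M x \<in> ?O (alpha2 M y)" by auto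
      from f consider "f = alpha0 M \<circ> alpha2 M" | "f = alpha1 M \<circ> alpha2 M" by blast
      then show "f x \<in> {x \<in> crosses M. alpha2 M x \<in> ?O (alpha2 M y)}"
      proof cases
        case 1
        have "alpha2 M (f x) = (alpha0 M \<circ> alpha2 M) (alpha2 M x)"
          using 1 by (simp add: is_map_commute[OF M])
        then have "alpha2 M (f x) \<in> ?O (alpha2 M y)"
          using gen_orbit_step[OF xC(2), of "alpha0 M \<circ> alpha2 M"] by simp
        then show ?thesis using a xC 1 by simp
      next
        case 2
        have fC: "f x \<in> crosses M" using 2 a xC by simp
        have "(alpha1 M \<circ> alpha2 M) (alpha2 M (f x)) = alpha2 M x" using 2 a xC by simp
        then have "?O (alpha2 M x) = ?O (alpha2 M (f x))"
          using gen_orbit_step_eq[OF revE a(3)[OF fC], of "alpha1 M \<circ> alpha2 M"] by simp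
        moreover have "?O (alpha2 M x) = ?O (alpha2 M y)"
          using gen_orbit_eq[OF revE a(3)[OF that(2)] xC(2)] .
        ultimately show ?thesis using fC by auto
      qed
    qed (use that in simp)
    then show ?thesis using that(1) by blast
  qed
  have cross: "f x \<in> ?O (alpha2 M x)" if "x \<in> crosses M" "f \<in> ?A" for f x
  proof -
    have "alpha0 M x \<in> ?O (alpha2 M x)"
      using gen_orbit_step[OF gen_orbit_refl, of "alpha0 M \<circ> alpha2 M" ?E "alpha2 M x"] a that by simp
    moreover have "alpha1 M x \<in> ?O (alpha2 M x)"
      using gen_orbit_step[OF gen_orbit_refl, of "alpha1 M \<circ> alpha2 M" ?E "alpha2 M x"] a that by simp
    ultimately show ?thesis using that by auto
  qed
  have OC: "?O c \<subseteq> crosses M" "?O (alpha2 M c) \<subseteq> crosses M"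
    using gen_orbit_in[OF revE] c a by auto
  have sw: "f x \<in> ?O (alpha2 M c)" if "x \<in> ?O c" "f \<in> ?A" for f x
    using gen_orbit_trans[OF two[OF that(1) c]] cross[OF _ that(2), of x] that OC by blast
  have sw': "f x \<in> ?O c" if "x \<in> ?O (alpha2 M c)" "f \<in> ?A" for f x
  proof -
    have "alpha2 M x \<in> ?O c" using two[OF that(1)] a[OF c] by simp
    then show ?thesis
      using gen_orbit_trans[of "alpha2 M x" ?E c] cross[OF _ that(2), of x] that OC by blast
  qed
  have Ksub: "K \<subseteq> ?O c \<union> ?O (alpha2 M c)"
    unfolding K_def component_of_def
  proof (rule gen_orbit_least)
    fix x f assume x: "x \<in> ?O c \<union> ?O (alpha2 M c)" and f: "f \<in> ?A"
    show "f x \<in> ?O c \<union> ?O (alpha2 M c)" using sw[OF _ f, of x] sw'[OF _ f, of x] x by blast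
  qed simp
  have a2K: "alpha2 M c \<in> K" using Kcl[OF cK] by simp
  have orbs: "orbits_on ?E K = {?O c, ?O (alpha2 M c)}"
  proof
    show "orbits_on ?E K \<subseteq> {?O c, ?O (alpha2 M c)}"
    proof
      fix X assume "X \<in> orbits_on ?E K"
      then obtain x where x: "x \<in> K" "X = ?O x" by (auto simp: orbits_on_def)
      then have "x \<in> ?O c \<or> x \<in> ?O (alpha2 M c)" using Ksub by blast
      then show "X \<in> {?O c, ?O (alpha2 M c)}"
        using gen_orbit_eq[OF revE c, of x] gen_orbit_eq[OF revE a(3)[OF c], of x] x by auto
    qed
    show "{?O c, ?O (alpha2 M c)} \<subseteq> orbits_on ?E K"
      using cK a2K by (auto simp: orbits_on_def)
  qed
  show ?thesis
  proof (cases "?O c = ?O (alpha2 M c)")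
    case True
    have "\<not> ?col"
    proof
      assume ?col
      then obtain s where s: "\<And>x. x \<in> K \<Longrightarrow> s (alpha0 M x) \<noteq> (s x :: bool) \<and> s (alpha1 M x) \<noteq> s x \<and> s (alpha2 M x) \<noteq> s x"
        unfolding colouring_on_def by blast
      have "?O c \<subseteq> {x \<in> K. s x = s c}"
      proof (rule gen_orbit_least)
        fix x f assume x: "x \<in> {x \<in> K. s x = s c}" and f: "f \<in> ?E"
        have K2: "alpha2 M x \<in> K" using x Kcl[of x] by simp
        then have "f x \<in> K" using f Kcl[OF K2, of "alpha0 M"] Kcl[OF K2, of "alpha1 M"] by auto
        moreover have "s (f x) = s x"
        proof -
          have "s (alpha2 M x) \<noteq> s x" using s[of x] x by simp
          then show ?thesis using f s[OF K2] by auto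
        qed
        ultimately show "f x \<in> {x \<in> K. s x = s c}" using x by simp
      qed (use cK in simp)
      then have "s (alpha2 M c) = s c" using True by auto
      then show False using s[OF cK] by simp
    qed
    then show ?thesis using orbs True by simp
  next
    case False
    then have dis: "?O c \<inter> ?O (alpha2 M c) = {}" using gen_orbit_disjoint[OF revE c] a c by simp
    have "\<forall>x\<in>K. (alpha0 M x \<in> ?O c) \<noteq> (x \<in> ?O c) \<and> (alpha1 M x \<in> ?O c) \<noteq> (x \<in> ?O c) \<and>
       (alpha2 M x \<in> ?O c) \<noteq> (x \<in> ?O c)"
    proof
      fix x assume "x \<in> K"
      have "(f x \<in> ?O c) \<noteq> (x \<in> ?O c)" if f: "f \<in> ?A" for f
        using Ksub \<open>x \<in> K\<close> sw[OF _ f, of x] sw'[OF _ f, of x] dis by blast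
      then show "(alpha0 M x \<in> ?O c) \<noteq> (x \<in> ?O c) \<and> (alpha1 M x \<in> ?O c) \<noteq> (x \<in> ?O c) \<and>
       (alpha2 M x \<in> ?O c) \<noteq> (x \<in> ?O c)" by simp
    qed
    then have ?col unfolding colouring_on_def by (intro exI[of _ "\<lambda>x. x \<in> ?O c"])
    then show ?thesis using orbs False by simp
  qed
qed

text \<open>A component contributes 2 or 1 according to whether it has a colouring, and isolated
  vertices contribute 2, so the minimum is 1 exactly when some component has no colouring.
  Colourings of the components combine because components are disjoint. \<open>ne\<close> keeps the
  minimum from ranging over the empty set.\<close>

lemma orient_eq:
  assumes M: "is_map M" and ne: "crosses M \<noteq> {}"
  shows "orient M = (if orientable M then 2 else 1)"
proof -
  let ?A = "{alpha0 M, alpha1 M, alpha2 M}"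
  let ?E = "{alpha0 M \<circ> alpha2 M, alpha1 M \<circ> alpha2 M}"
  let ?col = "\<lambda>K. \<exists>s. colouring_on M K s"
  define R where "R = (\<lambda>K. card (orbits_on ?E K)) ` components M \<union> (if isolated M > 0 then {2} else {})"
  have orient: "orient M = Min R" by (simp add: orient_def R_def)
  have rev: "reversible_on ?A (crosses M)" using is_map_reversible[OF M] by simp
  have comps: "components M = component_of M ` crosses M"
    by (simp add: components_def orbits_on_def component_of_def)
  have val: "card (orbits_on ?E K) = (if ?col K then 2 else 1)" if K: "K \<in> components M" for K
  proof -
    obtain c where c: "c \<in> crosses M" "K = component_of M c" using K unfolding comps by auto
    show ?thesis unfolding c(2) by (rule card_even_orbits_component[OF M c(1)])
  qed
  have fin: "finite R" using is_map_finite[OF M] by (simp add: comps R_def)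
  have neS: "R \<noteq> {}" using ne by (simp add: comps R_def)
  show ?thesis
  proof (cases "orientable M")
    case True
    then obtain s where s: "colouring_on M (crosses M) s" by (auto simp: orientable_def)
    have "?col K" if "K \<in> components M" for K
    proof -
      have "K \<subseteq> crosses M" using that gen_orbit_in[OF rev] by (auto simp: comps component_of_def)
      then show ?thesis using s unfolding colouring_on_def by (metis subsetD)
    qed
    then have "R \<subseteq> {2}" using val by (auto simp: R_def)
    then have "R = {2}" using neS by (metis subset_singletonD)
    then show ?thesis using True by (simp add: orient)
  next
    case False
    have "\<exists>K\<in>components M. \<not> ?col K"
    proof (rule ccontr)
      assume "\<not> (\<exists>K\<in>components M. \<not> ?col K)"
      then have "\<forall>K\<in>components M. ?col K" by blast
      then obtain S where S: "\<And>K. K \<in> components M \<Longrightarrow> colouring_on M K (S K)" by metis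
      have "colouring_on M (crosses M) (\<lambda>x. S (component_of M x) x)"
        unfolding colouring_on_def
      proof
        fix c assume c: "c \<in> crosses M"
        have "component_of M (f c) = component_of M c" if "f \<in> ?A" for f
          using gen_orbit_step_eq[OF rev c that] by (simp add: component_of_def)
        moreover have "c \<in> component_of M c" by (simp add: component_of_def)
        ultimately show "S (component_of M (alpha0 M c)) (alpha0 M c) \<noteq> S (component_of M c) c \<and>
          S (component_of M (alpha1 M c)) (alpha1 M c) \<noteq> S (component_of M c) c \<and>
          S (component_of M (alpha2 M c)) (alpha2 M c) \<noteq> S (component_of M c) c"
          using S[of "component_of M c"] c by (simp add: comps colouring_on_def)
      qed
      then show False using False by (auto simp: orientable_def)
    qed
    then obtain K where K: "K \<in> components M" "\<not> ?col K" by blast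
    then have "1 = card (orbits_on ?E K)" using val[OF K(1)] by simp
    then have "1 \<in> R" using K(1) unfolding R_def by blast
    moreover have "1 \<le> y" if y: "y \<in> R" for y
    proof (cases "y \<in> (\<lambda>K. card (orbits_on ?E K)) ` components M")
      case True
      then obtain K where "K \<in> components M" "y = card (orbits_on ?E K)" by blast
      then show ?thesis using val[of K] by simp
    next
      case False
      then show ?thesis using y by (simp add: R_def split: if_splits)
    qed
    ultimately have "Min R = 1" using Min_eqI[OF fin] by metis
    then show ?thesis using False by (simp add: orient)
  qed
qed

text \<open>The factor \<open>2 * o - 3\<close> is 1 for \<open>o = 2\<close> and -1 for
  \<open>o = 1\<close>, and only in the first case is the Euler genus halved.\<close>

lemma signed_genus_eq:
  assumes "is_map M" "crosses M \<noteq> {}"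
  shows "signed_genus M = (if orientable M then of_int (euler_genus M) / 2 else - of_int (euler_genus M))"
  using orient_eq[OF assms] by (simp add: signed_genus_def genus_def)

text \<open>Vertices, faces and components are then all counted by \<open>isolated M\<close>, so the
  Euler genus is 0, whatever \<open>orient\<close> yields on the empty map.\<close>

lemma signed_genus_no_crosses:
  assumes "crosses M = {}"
  shows "signed_genus M = 0"
  using assms
  by (simp add: signed_genus_def genus_def euler_genus_def euler_char_def num_vertices_def
      num_edges_def num_faces_def num_components_def vertices_def edges_def faces_def components_def orbits_on_def)

section \<open>Vertex gluing\<close>

locale vertex_swap =
  fixes M :: "'a cmap" and a b :: 'a
  assumes M: "is_map M" and a: "a \<in> crosses M" and b: "b \<in> crosses M"
    and vertices_neq: "incident_vertex M a \<noteq> incident_vertex M b"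
begin

definition "N = swap_crosses M a b"

lemma N_simps [simp]: "crosses N = crosses M" "alpha0 N = alpha0 M" "alpha2 N = alpha2 M"
  "isolated N = isolated M" "alpha1 N x = transpose a b (alpha1 M (transpose a b x))"
  by (simp_all add: N_def swap_crosses_def)

lemma swap_in: "x \<in> crosses M \<Longrightarrow> transpose a b x \<in> crosses M"
  using a b by (simp add: transpose_def)

lemma N_map: "is_map N"
proof -
  have perm: "alpha1 N permutes crosses M"
  proof -
    have "alpha1 N = transpose a b \<circ> (alpha1 M \<circ> transpose a b)" by (simp add: fun_eq_iff)
    moreover have "transpose a b permutes crosses M" using a b by (rule permutes_swap_id)
    ultimately show ?thesis using is_map_permutes[OF M, of "alpha1 M"] permutes_compose by (metis insertCI)
  qed
  have "alpha1 N (alpha1 N c) = c \<and> alpha1 N c \<noteq> c" if "c \<in> crosses M" for c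
  proof -
    note i = is_map_alpha[OF M swap_in[OF that]]
    have "alpha1 N (alpha1 N c) = c" using i by simp
    moreover have "alpha1 N c \<noteq> c"
      using i(8) by (metis N_simps(5) transpose_involutory)
    ultimately show ?thesis by simp
  qed
  then show ?thesis using M perm unfolding is_map_def fpf_involution_on_def by (simp del: N_simps(5))
qed

lemma alpha1_M: "alpha1 M x = transpose a b (alpha1 N (transpose a b x))"
  by simp

text \<open>\<open>G\<close> selects what is merged: \<open>{alpha2 M}\<close> gives vertices,
  \<open>{alpha0 M}\<close> faces, and both together components.\<close>

lemma merge:
  assumes G: "G \<subseteq> {alpha0 M, alpha2 M}" "G \<noteq> {}"
    and neq: "gen_orbit (insert (alpha1 M) G) a \<noteq> gen_orbit (insert (alpha1 M) G) b"
  shows "gen_orbit (insert (alpha1 N) G) a =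
           gen_orbit (insert (alpha1 M) G) a \<union> gen_orbit (insert (alpha1 M) G) b"
    and "Suc (card (orbits_on (insert (alpha1 N) G) (crosses M))) =
           card (orbits_on (insert (alpha1 M) G) (crosses M))"
proof -
  obtain \<beta> where \<beta>: "\<beta> \<in> G" using G by blast
  have G': "f x \<in> crosses M \<and> f (f x) = x \<and> f x \<noteq> x" if "f \<in> G" "x \<in> crosses M" for f x
  proof -
    have "f \<in> {alpha0 M, alpha1 M, alpha2 M}" using that G by blast
    then show ?thesis using is_map_involution[OF M _ that(2)] by blast
  qed
  have al: "alpha1 M x \<in> crosses M \<and> alpha1 M (alpha1 M x) = x \<and> alpha1 M x \<noteq> x" if "x \<in> crosses M" for x
    using is_map_alpha[OF M that] by simp
  note m = merge_orbits[OF is_map_finite[OF M], of G "alpha1 M" \<beta> "alpha1 N" a b]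
  show "gen_orbit (insert (alpha1 N) G) a =
           gen_orbit (insert (alpha1 M) G) a \<union> gen_orbit (insert (alpha1 M) G) b"
    by (rule m(2)) (use G' al \<beta> a b neq in simp_all)
  show "Suc (card (orbits_on (insert (alpha1 N) G) (crosses M))) =
           card (orbits_on (insert (alpha1 M) G) (crosses M))"
    by (rule m(3)) (use G' al \<beta> a b neq in simp_all)
qed

lemma vertices_merge:
  "Suc (num_vertices N) = num_vertices M" "b \<in> gen_orbit {alpha1 N, alpha2 M} a"
proof -
  note neq = vertices_neq[unfolded incident_vertex_def]
  show "Suc (num_vertices N) = num_vertices M"
    using merge(2)[OF _ _ neq] by (simp add: num_vertices_def vertices_def)
  show "b \<in> gen_orbit {alpha1 N, alpha2 M} a"
    using merge(1)[OF _ _ neq] by simp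
qed

lemma num_edges_N: "num_edges N = num_edges M"
  by (simp add: num_edges_def edges_def)

text \<open>Along a vertex the colours alternate, so a colouring of the glued map restricts to one of
  each of the two old vertices.\<close>

lemma colouring_back:
  assumes "colouring_on N (crosses N) s"
  shows "colouring_on M (crosses M) s"
proof -
  let ?V = "gen_orbit {alpha1 M, alpha2 M}"
  have rev: "reversible_on {alpha1 M, alpha2 M} (crosses M)" using is_map_reversible[OF M] by simp
  have neq: "?V a \<noteq> ?V b" using vertices_neq by (simp add: incident_vertex_def)
  have dis: "?V a \<inter> ?V b = {}" by (rule gen_orbit_disjoint[OF rev a b neq])
  have s: "s (alpha0 M c) \<noteq> s c" "s (alpha1 N c) \<noteq> s c" "s (alpha2 M c) \<noteq> s c" if "c \<in> crosses M" for c
    using assms that by (auto simp: colouring_on_def)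
  have cl: "alpha1 M x \<in> ?V c" "alpha2 M x \<in> ?V c" if "x \<in> ?V c" for x c
    using gen_orbit_step[OF that] by auto
  have same: "alpha1 N x = alpha1 M x" if "x \<in> crosses M" "x \<noteq> a" "x \<noteq> b" "x \<noteq> alpha1 M a" "x \<noteq> alpha1 M b" for x
  proof -
    have "alpha1 M x \<noteq> a" "alpha1 M x \<noteq> b" using that is_map_alpha[OF M that(1)] by auto
    then show ?thesis using that by (simp add: transpose_def)
  qed
  \<comment> \<open>Within the old vertex of \<open>c\<close> only the \<open>alpha1\<close>-edge at
    \<open>c\<close> has been rewired, since the other rewired edge belongs to the other vertex. So
    \<open>flip_across_cut\<close> applies with this edge as the cut.\<close>
  have cut: "s c \<noteq> s (alpha1 M c)" if "c \<in> {a, b}" for c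
  proof (rule flip_across_cut[of "?V c" _ _ "alpha2 M"])
    have c: "c \<in> crosses M" using that a b by auto
    have VC: "?V c \<subseteq> crosses M" using gen_orbit_in[OF rev c] .
    then show "finite (?V c)" using is_map_finite[OF M] finite_subset by blast
    show "c \<in> ?V c" by simp
    fix x assume x: "x \<in> ?V c"
    then have xC: "x \<in> crosses M" using VC by blast
    show "alpha1 M x \<in> ?V c \<and> alpha1 M (alpha1 M x) = x" "alpha2 M x \<in> ?V c \<and> alpha2 M (alpha2 M x) = x"
      using cl[OF x] is_map_alpha[OF M xC] by auto
    show "s (alpha2 M x) \<noteq> s x" using s(3)[OF xC] .
    assume "x \<noteq> c" "x \<noteq> alpha1 M c"
    moreover have "x \<notin> {d, alpha1 M d}" if "d \<in> {a, b}" "d \<noteq> c" for d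
    proof -
      have "?V c \<inter> ?V d = {}" using that \<open>c \<in> {a, b}\<close> dis by auto
      moreover have "d \<in> ?V d" "alpha1 M d \<in> ?V d" using cl(1)[of d d] by auto
      ultimately show ?thesis using x by auto
    qed
    ultimately have "x \<noteq> a" "x \<noteq> b" "x \<noteq> alpha1 M a" "x \<noteq> alpha1 M b" using that by auto
    then show "s (alpha1 M x) \<noteq> s x" using same[OF xC] s(2)[OF xC] by metis
  qed
  have "s (alpha1 M c) \<noteq> s c" if c: "c \<in> crosses M" for c
  proof (cases "c \<in> {a, b, alpha1 M a, alpha1 M b}")
    case True
    then show ?thesis using cut[of a] cut[of b] is_map_alpha[OF M a] is_map_alpha[OF M b] by auto
  next
    case False
    then show ?thesis using same[OF c] s(2)[OF c] by auto
  qed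
  then show ?thesis using s by (simp add: colouring_on_def)
qed

lemma colouring_swap:
  assumes s: "colouring_on M (crosses M) s" and "s a = s b"
  shows "colouring_on N (crosses N) s"
proof -
  have sT: "s (transpose a b x) = s x" for x using assms(2) by (simp add: transpose_def)
  have "s (alpha1 N c) \<noteq> s c" if "c \<in> crosses M" for c
    using s swap_in[OF that] sT by (simp add: colouring_on_def)
  then show ?thesis using s unfolding colouring_on_def by (simp del: N_simps(5))
qed

text \<open>Transposing two elements of one orbit never leads out of an orbit. Applied to
  \<open>M\<close> and to \<open>N\<close>, this shows that gluing inside a component keeps the
  components.\<close>

lemma swap_orbit:
  assumes rev: "reversible_on F (crosses M)" and ab: "b \<in> gen_orbit F a" and f: "f \<in> F" and x: "x \<in> crosses M"
  shows "transpose a b (f (transpose a b x)) \<in> gen_orbit F x"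
proof -
  have "gen_orbit F b = gen_orbit F a" by (rule gen_orbit_eq[OF rev a ab])
  then have T: "transpose a b y \<in> gen_orbit F y" for y
    by (auto simp: transpose_def)
  have fC: "f (transpose a b x) \<in> crosses M" using rev f swap_in[OF x] by (simp add: reversible_on_def)
  have "gen_orbit F (transpose a b x) = gen_orbit F x" by (rule gen_orbit_eq[OF rev x T])
  then have "f (transpose a b x) \<in> gen_orbit F x"
    using gen_orbit_step[OF gen_orbit_refl f] by metis
  then show ?thesis using T[of "f (transpose a b x)"] gen_orbit_trans by fast
qed

lemma signed_genus_N:
  assumes "euler_genus N = euler_genus M" and "orientable N = orientable M"
  shows "signed_genus N = signed_genus M"
proof -
  have "crosses M \<noteq> {}" using a by blast
  then show ?thesis using signed_genus_eq[OF M] signed_genus_eq[OF N_map] assms by simp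
qed

text \<open>Vertices, faces and components all drop by one, and these changes cancel in
  \<open>2 * k - (v - e + f)\<close>. For orientability, a colouring is reversed on the component of
  \<open>b\<close> if \<open>a\<close> and \<open>b\<close> disagree.\<close>

lemma signed_genus_components:
  assumes neq: "component_of M a \<noteq> component_of M b"
  shows "signed_genus N = signed_genus M"
proof (rule signed_genus_N)
  let ?A = "{alpha0 M, alpha1 M, alpha2 M}"
  have sets: "?A = insert (alpha1 M) {alpha0 M, alpha2 M}"
    "{alpha0 M, alpha1 N, alpha2 M} = insert (alpha1 N) {alpha0 M, alpha2 M}"
    "{alpha0 M, alpha1 M} = insert (alpha1 M) {alpha0 M}"
    "{alpha0 M, alpha1 N} = insert (alpha1 N) {alpha0 M}" by blast+
  have rev: "reversible_on ?A (crosses M)" using is_map_reversible[OF M] by simp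
  have rev0: "reversible_on {alpha0 M, alpha1 M} (crosses M)" using is_map_reversible[OF M] by simp
  have neqA: "gen_orbit ?A a \<noteq> gen_orbit ?A b" using neq by (simp add: component_of_def)
  have neqF: "gen_orbit {alpha0 M, alpha1 M} a \<noteq> gen_orbit {alpha0 M, alpha1 M} b"
  proof
    assume eq: "gen_orbit {alpha0 M, alpha1 M} a = gen_orbit {alpha0 M, alpha1 M} b"
    have "gen_orbit {alpha0 M, alpha1 M} a \<subseteq> gen_orbit ?A a"
    proof (rule gen_orbit_least)
      fix x f assume "x \<in> gen_orbit ?A a" "f \<in> {alpha0 M, alpha1 M}"
      then show "f x \<in> gen_orbit ?A a" using gen_orbit_step[of x ?A a f] by blast
    qed simp
    then have "b \<in> gen_orbit ?A a" using eq by auto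
    then show False using neqA gen_orbit_eq[OF rev a] by metis
  qed
  have "Suc (num_components N) = num_components M"
    using merge(2)[of "{alpha0 M, alpha2 M}"] neqA
    by (simp add: num_components_def components_def sets)
  moreover have "Suc (num_faces N) = num_faces M"
    using merge(2)[of "{alpha0 M}"] neqF by (simp add: num_faces_def faces_def sets)
  ultimately show "euler_genus N = euler_genus M"
    using vertices_merge(1) num_edges_N by (simp add: euler_genus_def euler_char_def)
  show "orientable N = orientable M"
  proof
    assume "orientable N"
    then show "orientable M" using colouring_back unfolding orientable_def by blast
  next
    assume "orientable M"
    then obtain s where s: "colouring_on M (crosses M) s" by (auto simp: orientable_def)
    define t where "t x = (if x \<in> gen_orbit ?A b then s x \<noteq> (s a \<noteq> s b) else s x)" for x
    have same: "(f x \<in> gen_orbit ?A b) = (x \<in> gen_orbit ?A b)" if "x \<in> crosses M" "f \<in> ?A" for f x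
      using gen_orbit_step[of x ?A b f] gen_orbit_step[of "f x" ?A b f] is_map_involution(2)[OF M that(2,1)] that(2) by auto
    have "a \<notin> gen_orbit ?A b" using neqA gen_orbit_eq[OF rev b] by metis
    then have "t a = t b" by (auto simp: t_def)
    moreover have "colouring_on M (crosses M) t"
      unfolding colouring_on_def
    proof
      fix c assume c: "c \<in> crosses M"
      have "t (f c) \<noteq> t c" if "f \<in> ?A" for f
        using same[OF c that] s c that by (auto simp: t_def colouring_on_def)
      then show "t (alpha0 M c) \<noteq> t c \<and> t (alpha1 M c) \<noteq> t c \<and> t (alpha2 M c) \<noteq> t c" by simp
    qed
    ultimately show "orientable N" using colouring_swap unfolding orientable_def by blast
  qed
qed

text \<open>Gluing the two ends of the edge at \<open>a\<close> turns it into a loop that cuts off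
  the new face \<open>{a, alpha0 M a}\<close>. One vertex is lost, one face is gained, and the
  components stay. The crosses \<open>a\<close> and \<open>b\<close> are two steps apart, so every
  colouring agrees on them.\<close>

lemma signed_genus_edge:
  assumes b_eq: "b = alpha1 M (alpha0 M a)"
  shows "signed_genus N = signed_genus M"
proof (rule signed_genus_N)
  let ?A = "{alpha0 M, alpha1 M, alpha2 M}" and ?A' = "{alpha0 M, alpha1 N, alpha2 M}"
  note i = is_map_alpha[OF M a]
  note i0 = is_map_alpha[OF M i(1)]
  have rev: "reversible_on ?A (crosses M)" using is_map_reversible[OF M] by simp
  have rev': "reversible_on ?A' (crosses M)" using is_map_reversible[OF N_map, of ?A'] by simp
  have ab: "a \<noteq> b" using vertices_neq by auto
  have a0b: "alpha0 M a \<noteq> b" using i0(8) b_eq by simp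
  have b1: "alpha1 M b = alpha0 M a" "alpha1 M (alpha0 M a) = b" using i0 b_eq by simp_all
  have a1: "alpha1 N a = alpha0 M a" "alpha1 N (alpha0 M a) = a"
    using ab a0b i i0 b1 by (auto simp: transpose_def)
  have aorb: "gen_orbit {alpha1 N, alpha0 M} a \<subseteq> {a, alpha0 M a}"
    by (rule gen_orbit_least) (use a1 i in \<open>auto simp del: N_simps(5)\<close>)
  have aorb': "b \<notin> gen_orbit {alpha1 N, alpha0 M} a" using aorb ab a0b by blast
  have neqF: "gen_orbit {alpha1 N, alpha0 M} a \<noteq> gen_orbit {alpha1 N, alpha0 M} b"
    using aorb' by auto
  \<comment> \<open>The merging argument is read backwards: the same transposition leads from
    \<open>N\<close> to \<open>M\<close> and merges the new face with the one it was cut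
    from.\<close>
  have "Suc (card (orbits_on {alpha1 M, alpha0 M} (crosses M))) = card (orbits_on {alpha1 N, alpha0 M} (crosses M))"
  proof (rule merge_orbits(3)[OF is_map_finite[OF M], of _ _ "alpha0 M" _ a b])
    show "f x \<in> crosses M \<and> f (f x) = x" if "f \<in> {alpha0 M}" "x \<in> crosses M" for f x
      using that is_map_alpha[OF M] by simp
    show "alpha1 N x \<in> crosses M \<and> alpha1 N (alpha1 N x) = x \<and> alpha1 N x \<noteq> x" if "x \<in> crosses M" for x
      using is_map_alpha[OF N_map, of x] that by (simp del: N_simps(5))
    show "alpha0 M x \<noteq> x" if "x \<in> crosses M" for x using is_map_alpha[OF M that] by simp
    show "alpha1 M x = transpose a b (alpha1 N (transpose a b x))" for x by (rule alpha1_M)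
  qed (use a b neqF in auto)
  then have faces: "num_faces N = Suc (num_faces M)"
    by (simp add: num_faces_def faces_def insert_commute)
  have "components N = components M"
  proof -
    have b1: "b \<in> gen_orbit ?A a"
      unfolding b_eq
      using gen_orbit_step[OF gen_orbit_step[OF gen_orbit_refl, of "alpha0 M" ?A a], of "alpha1 M"] by simp
    have sub: "gen_orbit {alpha1 N, alpha2 M} a \<subseteq> gen_orbit ?A' a"
    proof (rule gen_orbit_least)
      fix x f assume "x \<in> gen_orbit ?A' a" "f \<in> {alpha1 N, alpha2 M}"
      then show "f x \<in> gen_orbit ?A' a" using gen_orbit_step[of x ?A' a f] by blast
    qed simp
    have b2: "b \<in> gen_orbit ?A' a" using sub vertices_merge(2) by blast
    have "gen_orbit ?A' c = gen_orbit ?A c" if c: "c \<in> crosses M" for c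
    proof
      show "gen_orbit ?A' c \<subseteq> gen_orbit ?A c"
      proof (rule gen_orbit_mono_on[OF c])
        fix f x assume f: "f \<in> ?A'" and x: "x \<in> crosses M"
        have "f x \<in> crosses M" using rev' f x unfolding reversible_on_def by blast
        moreover have "f x \<in> gen_orbit ?A x"
        proof (cases "f = alpha1 N")
          case True
          then show ?thesis using swap_orbit[OF rev b1 _ x, of "alpha1 M"] by simp
        next
          case False
          then show ?thesis using f gen_orbit_step[OF gen_orbit_refl, of f ?A x] by blast
        qed
        ultimately show "f x \<in> crosses M \<and> f x \<in> gen_orbit ?A x" by blast
      qed
      show "gen_orbit ?A c \<subseteq> gen_orbit ?A' c"
      proof (rule gen_orbit_mono_on[OF c])
        fix f x assume f: "f \<in> ?A" and x: "x \<in> crosses M"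
        have "f x \<in> crosses M" using rev f x unfolding reversible_on_def by blast
        moreover have "f x \<in> gen_orbit ?A' x"
        proof (cases "f = alpha1 M")
          case True
          then show ?thesis using swap_orbit[OF rev' b2 _ x, of "alpha1 N"] by simp
        next
          case False
          then show ?thesis using f gen_orbit_step[OF gen_orbit_refl, of f ?A' x] by blast
        qed
        ultimately show "f x \<in> crosses M \<and> f x \<in> gen_orbit ?A' x" by blast
      qed
    qed
    then show ?thesis by (simp add: components_def orbits_on_def cong: image_cong)
  qed
  then have "num_components N = num_components M" by (simp add: num_components_def)
  then show "euler_genus N = euler_genus M"
    using vertices_merge(1) num_edges_N faces by (simp add: euler_genus_def euler_char_def)
  show "orientable N = orientable M"
  proof
    assume "orientable N"
    then show "orientable M" using colouring_back unfolding orientable_def by blast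
  next
    assume "orientable M"
    then obtain s where s: "colouring_on M (crosses M) s" by (auto simp: orientable_def)
    then have "s a = s b" using a i(1) unfolding b_eq colouring_on_def by auto
    then show "orientable N" using colouring_swap s unfolding orientable_def by blast
  qed
qed

end

text \<open>An isolated vertex counts once among vertices, faces and components, so its removal
  leaves \<open>2 * k - (v - e + f)\<close> unchanged. The crosses of \<open>M\<close> supply
  another vertex to which it can be glued.\<close>

lemma remove_isolated_preserves:
  assumes M: "is_map M" and ne: "crosses M \<noteq> {}" and iso: "isolated M > 0"
  shows "is_map (remove_isolated M)" "signed_genus (remove_isolated M) = signed_genus M"
    "Suc (num_vertices (remove_isolated M)) = num_vertices M" "vertex_gluing M (remove_isolated M)"
proof -
  let ?N = "remove_isolated M"
  have fields: "crosses ?N = crosses M" "alpha0 ?N = alpha0 M" "alpha1 ?N = alpha1 M" "alpha2 ?N = alpha2 M"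
    "isolated ?N = isolated M - 1"
    by (simp_all add: remove_isolated_def)
  show N: "is_map ?N" using M by (simp add: is_map_def fields)
  show v: "Suc (num_vertices ?N) = num_vertices M"
    using iso by (simp add: num_vertices_def vertices_def fields)
  have "euler_genus ?N = euler_genus M"
    using iso by (simp add: euler_genus_def euler_char_def num_vertices_def num_edges_def num_faces_def
        num_components_def vertices_def edges_def faces_def components_def fields)
  moreover have "orientable ?N = orientable M" by (simp add: orientable_def colouring_on_def fields)
  ultimately show "signed_genus ?N = signed_genus M"
    using signed_genus_eq[OF M ne] signed_genus_eq[OF N] ne by (simp add: fields)
  have "vertices M \<noteq> {}" "finite (vertices M)"
    using ne is_map_finite[OF M] by (auto simp: vertices_def orbits_on_def)
  then have "card (vertices M) > 0" by (simp add: card_gt_0_iff)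
  then show "vertex_gluing M ?N" using iso by (intro vertex_gluing.intros(2)) (auto simp: num_vertices_def)
qed

text \<open>Without isolated vertices, either some edge joins distinct vertices, which are glued
  along it, or every component has a single vertex, and then any two vertices lie in different
  components. These are the two gluings whose effect on the genus has been computed.\<close>

lemma vertex_gluing_step:
  assumes M: "is_map M" and ne: "crosses M \<noteq> {}" and two: "num_vertices M \<ge> 2"
  shows "\<exists>N. vertex_gluing M N \<and> is_map N \<and> crosses N \<noteq> {} \<and> signed_genus N = signed_genus M \<and>
    Suc (num_vertices N) = num_vertices M"
proof (cases "isolated M > 0")
  case True
  then show ?thesis
    using remove_isolated_preserves[OF M ne True] ne
    by (intro exI[of _ "remove_isolated M"]) (simp add: remove_isolated_def)
next
  case False
  let ?V = "gen_orbit {alpha1 M, alpha2 M}"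
  have rev: "reversible_on {alpha1 M, alpha2 M} (crosses M)" using is_map_reversible[OF M] by simp
  show ?thesis
  proof (cases "\<exists>a\<in>crosses M. ?V a \<noteq> ?V (alpha0 M a)")
    case True
    then obtain a where a: "a \<in> crosses M" "?V a \<noteq> ?V (alpha0 M a)" by blast
    define b where "b = alpha1 M (alpha0 M a)"
    have a0: "alpha0 M a \<in> crosses M" using is_map_alpha[OF M a(1)] by simp
    have bC: "b \<in> crosses M" using is_map_alpha[OF M a0] by (simp add: b_def)
    have Vb: "?V b = ?V (alpha0 M a)"
      unfolding b_def by (rule gen_orbit_step_eq[OF rev a0]) simp
    interpret vertex_swap M a b
      by standard (use M a bC Vb in \<open>simp_all add: incident_vertex_def\<close>)
    have "b = face_perm M a" by (simp add: face_perm_def b_def)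
    then have co: "coincident M a b"
      unfolding coincident_def using gen_orbit_step[OF gen_orbit_refl, of "face_perm M"] by simp
    have "a \<noteq> b" using vertices_neq by auto
    then have "vertex_gluing M N"
      unfolding N_def using a bC vertices_neq co by (intro vertex_gluing.intros(1)) simp_all
    then show ?thesis using N_map signed_genus_edge[OF b_def] vertices_merge(1) a(1) by (intro exI[of _ N]) auto
  next
    case same: False
    have "card (vertices M) \<ge> 2" using two False by (simp add: num_vertices_def)
    then obtain V W where VW: "V \<in> vertices M" "W \<in> vertices M" "V \<noteq> W"
      by (metis card_2_iff' obtain_subset_with_card_n subsetD)
    then obtain a b where ab: "a \<in> crosses M" "b \<in> crosses M" "V = ?V a" "W = ?V b"
      by (auto simp: vertices_def orbits_on_def)
    interpret vertex_swap M a b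
      by standard (use M ab VW in \<open>simp_all add: incident_vertex_def\<close>)
    have "component_of M a \<subseteq> {x \<in> crosses M. ?V x = ?V a}"
      unfolding component_of_def
    proof (rule gen_orbit_least)
      fix x f assume x: "x \<in> {x \<in> crosses M. ?V x = ?V a}" and f: "f \<in> {alpha0 M, alpha1 M, alpha2 M}"
      then have xC: "x \<in> crosses M" by simp
      have "f x \<in> crosses M" using is_map_involution(1)[OF M f xC] .
      moreover have "?V (f x) = ?V x"
        using f same xC gen_orbit_step_eq[OF rev xC, of f] by auto
      ultimately show "f x \<in> {x \<in> crosses M. ?V x = ?V a}" using x by simp
    qed (use ab in simp)
    moreover have "b \<in> component_of M b" by (simp add: component_of_def)
    ultimately have comp: "component_of M a \<noteq> component_of M b" using VW ab by auto
    have "a \<noteq> b" using VW ab by auto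
    then have "vertex_gluing M N"
      unfolding N_def using ab vertices_neq comp by (intro vertex_gluing.intros(1)) simp_all
    then show ?thesis
      using N_map signed_genus_components[OF comp] vertices_merge(1) ab(1) by (intro exI[of _ N]) auto
  qed
qed

lemma glue_to_one_vertex:
  assumes "is_map M" "crosses M \<noteq> {}"
  shows "\<exists>P. gluing\<^sup>*\<^sup>* M P \<and> is_map P \<and> crosses P \<noteq> {} \<and> signed_genus P = signed_genus M \<and>
    isolated P = 0 \<and> card (vertices P) = 1"
  using assms
proof (induction "num_vertices M" arbitrary: M rule: less_induct)
  case less
  show ?case
  proof (cases "num_vertices M \<ge> 2")
    case True
    obtain N where N: "vertex_gluing M N" "is_map N" "crosses N \<noteq> {}" "signed_genus N = signed_genus M"
      "Suc (num_vertices N) = num_vertices M"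
      using vertex_gluing_step[OF less.prems True] by blast
    then obtain P where P: "gluing\<^sup>*\<^sup>* N P" "is_map P" "crosses P \<noteq> {}" "signed_genus P = signed_genus N"
      "isolated P = 0" "card (vertices P) = 1"
      using less.hyps[of N] by auto
    have "gluing M N" using N(1) by (simp add: gluing_def)
    then have "gluing\<^sup>*\<^sup>* M P" using P(1) by (rule converse_rtranclp_into_rtranclp)
    then show ?thesis using P N(4) by auto
  next
    case False
    have "vertices M \<noteq> {}" "finite (vertices M)"
      using less.prems is_map_finite[OF less.prems(1)] by (auto simp: vertices_def orbits_on_def)
    then have "card (vertices M) > 0" by (simp add: card_gt_0_iff)
    then have "isolated M = 0" "card (vertices M) = 1" using False by (auto simp: num_vertices_def)
    then show ?thesis using less.prems by blast
  qed
qed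

section \<open>Submaps and maps without gluings\<close>

lemma del_edges_empty:
  assumes M: "is_map M"
  shows "del_edges M {} = M"
proof -
  have fr: "first_return f {} c = f c" for f :: "'a \<Rightarrow> 'a" and c
  proof -
    have "(LEAST n. n > (0::nat) \<and> (f ^^ n) c \<notin> {}) = 1" by (rule Least_equality) auto
    then show ?thesis by (simp add: first_return_def)
  qed
  have out: "alpha0 M c = c" "alpha1 M c = c" "alpha2 M c = c" if "c \<notin> crosses M" for c
    using M that by (auto simp: is_map_def fpf_involution_on_def permutes_not_in)
  have "{V \<in> vertices M. V \<subseteq> {}} = {}" by (auto simp: vertices_def orbits_on_def)
  moreover have "(\<lambda>c. if c \<in> crosses M then alpha0 M c else c) = alpha0 M"
    "(\<lambda>c. if c \<in> crosses M then alpha2 M c else c) = alpha2 M"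
    using out by (auto simp: fun_eq_iff)
  moreover have "(\<lambda>c. if c \<in> crosses M then first_return (vertex_perm M) {} (alpha2 M c) else c) = alpha1 M"
    using out is_map_alpha[OF M] by (auto simp: fun_eq_iff fr vertex_perm_def)
  ultimately show ?thesis by (simp add: del_edges_def Let_def)
qed

lemma crosses_del_edges [simp]: "crosses (del_edges M F) = crosses M - \<Union>F"
  by (simp add: del_edges_def Let_def)

lemma vertex_deletion_crosses: "vertex_deletion M N \<Longrightarrow> crosses N \<subseteq> crosses M"
  by (induction rule: vertex_deletion.induct) (auto simp: remove_isolated_def)

lemma vertex_deletions_crosses: "vertex_deletion\<^sup>*\<^sup>* M N \<Longrightarrow> crosses N \<subseteq> crosses M"
  by (induction rule: rtranclp_induct) (use vertex_deletion_crosses in blast)+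

lemma submap_crosses: "submap N M \<Longrightarrow> crosses N \<subseteq> crosses M"
  unfolding submap_def using vertex_deletions_crosses by fastforce

text \<open>Deleting an edge, or a vertex that carries crosses, loses crosses, and without isolated
  vertices no other deletion can come first. So no deletion takes place at all.\<close>

lemma submap_same_crosses:
  assumes M: "is_map M" "isolated M = 0" and sub: "submap N M" and eq: "crosses N = crosses M"
  shows "N = M"
proof -
  obtain F where F: "F \<subseteq> edges M" "vertex_deletion\<^sup>*\<^sup>* (del_edges M F) N"
    using sub by (auto simp: submap_def)
  have "crosses M \<subseteq> crosses M - \<Union>F" using vertex_deletions_crosses[OF F(2)] eq by simp
  have "F = {}"
  proof (rule ccontr)
    assume "F \<noteq> {}"
    then obtain e where e: "e \<in> F" by blast
    then obtain c where "c \<in> crosses M" "e = gen_orbit {alpha0 M, alpha2 M} c"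
      using F(1) by (auto simp: edges_def orbits_on_def)
    then have "c \<in> crosses M" "c \<in> \<Union>F" using e by auto
    then show False using \<open>crosses M \<subseteq> crosses M - \<Union>F\<close> by blast
  qed
  then have "vertex_deletion\<^sup>*\<^sup>* M N" using F(2) del_edges_empty[OF M(1)] by simp
  then show ?thesis
  proof (cases rule: converse_rtranclpE)
    case (step y)
    have ys: "crosses M \<subseteq> crosses y" using vertex_deletions_crosses[OF step(2)] eq by simp
    from step(1) show ?thesis
    proof (cases rule: vertex_deletion.cases)
      case (1 V)
      then obtain c where c: "c \<in> crosses M" "V = gen_orbit {alpha1 M, alpha2 M} c"
        by (auto simp: vertices_def orbits_on_def)
      let ?e = "gen_orbit {alpha0 M, alpha2 M} c"
      have "?e \<in> edges M" using c by (simp add: edges_def orbits_on_def)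
      moreover have "c \<in> ?e" "c \<in> V" using c by auto
      ultimately have "c \<in> \<Union>{e \<in> edges M. e \<inter> V \<noteq> {}}" by blast
      then have "c \<notin> crosses y" using 1 by (simp add: remove_isolated_def)
      then show ?thesis using ys c by blast
    next
      case 2
      then show ?thesis using M(2) by simp
    qed
  qed simp
qed

lemma submap_refl: "is_map M \<Longrightarrow> submap M M"
  unfolding submap_def by (rule exI[of _ "{}"]) (simp add: del_edges_empty)

lemma map_iso_refl: "map_iso M M"
  unfolding map_iso_def by (auto intro!: exI[of _ id])

text \<open>The only map obtained from \<open>M\<close> by gluings is \<open>M\<close> itself, so a
  homomorphism to a submap fits all crosses of \<open>M\<close> into that submap, which by
  finiteness is then \<open>M\<close>.\<close>

lemma rigid_is_core:
  assumes M: "is_map M" "isolated M = 0" and rigid: "\<And>N. \<not> gluing M N"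
  shows "is_core M"
  unfolding is_core_def
proof (intro conjI notI)
  show "is_map M" by fact
  assume "\<exists>N. proper_submap N M \<and> hom_exists M N"
  then obtain N P Q where N: "submap N M" "N \<noteq> M" and P: "gluing\<^sup>*\<^sup>* M P" and Q: "submap Q N" "map_iso P Q"
    by (auto simp: proper_submap_def hom_exists_def)
  have "P = M" using P rigid by (metis converse_rtranclpE)
  then obtain h where "bij_betw h (crosses M) (crosses Q)" using Q(2) by (auto simp: map_iso_def)
  then have card: "card (crosses M) = card (crosses Q)" by (rule bij_betw_same_card)
  have sub: "crosses Q \<subseteq> crosses N" "crosses N \<subseteq> crosses M" using submap_crosses Q N by auto
  then have "crosses Q = crosses M"
    using card_seteq[of "crosses M" "crosses Q"] is_map_finite[OF M(1)] card by auto
  then have "crosses N = crosses M" using sub by blast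
  then show False using submap_same_crosses[OF M N(1)] N(2) by blast
qed

section \<open>Faces of degree two and duplicate edges\<close>

lemma face_degree_two_card:
  assumes M: "is_map M" and A: "A \<in> faces M" "face_degree M A = 2"
  shows "card A \<le> 4"
proof -
  obtain c where c: "c \<in> crosses M" "A = gen_orbit {alpha0 M, alpha1 M} c"
    using A(1) by (auto simp: faces_def orbits_on_def)
  have rev: "reversible_on {alpha0 M, alpha1 M} (crosses M)" using is_map_reversible[OF M] by simp
  \<comment> \<open>\<open>d\<close> is the representative that \<open>face_degree\<close> chooses.
    Its cycle has two elements, and these together with their images under \<open>alpha0\<close>
    exhaust the face.\<close>
  define d where "d = (SOME c. c \<in> A)"
  have dA: "d \<in> A" unfolding d_def using c someI[of "\<lambda>x. x \<in> A" c] by simp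
  then have dC: "d \<in> crosses M" using gen_orbit_in[OF rev c(1)] c by blast
  have Ad: "A = gen_orbit {alpha0 M, alpha1 M} d" using gen_orbit_eq[OF rev c(1), of d] dA c(2) by simp
  let ?f = "face_perm M"
  let ?O = "gen_orbit {?f} d"
  have cardO: "card ?O = 2" using A(2) by (simp add: face_degree_def d_def)
  have fC: "?f x \<in> crosses M" if "x \<in> crosses M" for x
    using is_map_alpha[OF M] that by (simp add: face_perm_def)
  have inj: "x = y" if "?f x = ?f y" "x \<in> crosses M" "y \<in> crosses M" for x y
    using that is_map_alpha[OF M] unfolding face_perm_def by (metis o_apply)
  have O1: "?f d \<in> ?O" by (rule gen_orbit_step) auto
  have O2: "?f (?f d) \<in> ?O" by (rule gen_orbit_step[OF O1]) auto
  have ne: "?f d \<noteq> d"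
  proof
    assume "?f d = d"
    then have "?O \<subseteq> {d}" by (intro gen_orbit_least) auto
    then have "card ?O \<le> card {d}" by (rule card_mono[rotated]) simp
    then show False using cardO by simp
  qed
  have "finite ?O" using cardO by (simp add: card_ge_0_finite)
  then have "?O = {d, ?f d}"
    using card_seteq[of ?O "{d, ?f d}"] O1 ne cardO by auto
  then have "?f (?f d) = d" using O2 inj[of "?f d" d] ne fC dC by auto
  then have a1: "alpha1 M (alpha0 M (?f d)) = d" by (simp add: face_perm_def)
  let ?B = "{d, alpha0 M d, ?f d, alpha0 M (?f d)}"
  have "A \<subseteq> ?B"
    unfolding Ad
  proof (rule gen_orbit_least)
    fix x f assume x: "x \<in> ?B" and f: "f \<in> {alpha0 M, alpha1 M}"
    have 0: "alpha0 M (alpha0 M d) = d" "alpha0 M (alpha0 M (?f d)) = ?f d"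
      using is_map_alpha[OF M] dC fC by auto
    have 1: "alpha1 M (alpha0 M d) = ?f d" by (simp add: face_perm_def)
    have 2: "alpha1 M (?f d) = alpha0 M d"
      using is_map_alpha[OF M] dC by (simp add: face_perm_def)
    have 3: "alpha1 M d = alpha0 M (?f d)"
      using a1 is_map_alpha(5)[OF M] is_map_alpha(1)[OF M] fC dC by metis
    show "f x \<in> ?B" using x f 0 1 2 3 a1 by auto
  qed simp
  then have "card A \<le> card ?B" by (rule card_mono[rotated]) simp
  also have "\<dots> \<le> 4" by (auto simp: card_insert_if)
  finally show ?thesis .
qed

text \<open>If both sides of \<open>f\<close> were on the common face \<open>A\<close>, then
  \<open>A\<close> would contain three crosses of \<open>f\<close> and two of \<open>e\<close>, but
  it has at most four. So \<open>f\<close> separates two faces, which is what makes its deletion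
  harmless for the genus.\<close>

lemma duplicate_edges_sides:
  assumes M: "is_map M" and dup: "duplicate_edges M e f"
  obtains c where "c \<in> crosses M" "f = gen_orbit {alpha0 M, alpha2 M} c"
    "alpha2 M c \<notin> gen_orbit {alpha0 M, alpha1 M} c"
proof -
  obtain A where A: "A \<in> faces M" "face_degree M A = 2" "e \<inter> A \<noteq> {}" "f \<inter> A \<noteq> {}"
    and ef: "e \<in> edges M" "f \<in> edges M" "e \<noteq> f"
    using dup by (auto simp: duplicate_edges_def)
  have rev: "reversible_on {alpha0 M, alpha1 M} (crosses M)" using is_map_reversible[OF M] by simp
  have revE: "reversible_on {alpha0 M, alpha2 M} (crosses M)" using is_map_reversible[OF M] by simp
  obtain a where a: "a \<in> crosses M" "A = gen_orbit {alpha0 M, alpha1 M} a"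
    using A(1) by (auto simp: faces_def orbits_on_def)
  have AC: "A \<subseteq> crosses M" using gen_orbit_in[OF rev a(1)] a by simp
  obtain c d where c: "c \<in> f" "c \<in> A" and d: "d \<in> e" "d \<in> A" using A by blast
  have cC: "c \<in> crosses M" and dC: "d \<in> crosses M" using c d AC by auto
  have f: "f = gen_orbit {alpha0 M, alpha2 M} c"
    using ef(2) c(1) gen_orbit_eq[OF revE, of _ c] by (auto simp: edges_def orbits_on_def)
  have e: "e = gen_orbit {alpha0 M, alpha2 M} d"
    using ef(1) d(1) gen_orbit_eq[OF revE, of _ d] by (auto simp: edges_def orbits_on_def)
  have dis: "e \<inter> f = {}" unfolding e f by (rule gen_orbit_disjoint[OF revE dC cC]) (use ef e f in auto)
  note ic = is_map_alpha[OF M cC] and id = is_map_alpha[OF M dC]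
  have Acl: "alpha0 M c \<in> A" "alpha0 M d \<in> A"
    using gen_orbit_step[of _ "{alpha0 M, alpha1 M}" a "alpha0 M"] c d a by auto
  have mem: "alpha0 M c \<in> f" "alpha2 M c \<in> f" "alpha0 M d \<in> e"
    unfolding e f edge_eq[OF M cC] edge_eq[OF M dC] by auto
  have "alpha2 M c \<notin> A"
  proof
    assume "alpha2 M c \<in> A"
    then have sub: "{c, alpha0 M c, alpha2 M c, d, alpha0 M d} \<subseteq> A" using c d Acl by auto
    have "alpha0 M c \<noteq> alpha2 M c" using M cC by (simp add: is_map_def)
    moreover have "c \<notin> e" "alpha0 M c \<notin> e" "alpha2 M c \<notin> e" using dis c mem by auto
    ultimately have "card {c, alpha0 M c, alpha2 M c, d, alpha0 M d} = 5"
      using ic(7,9) id(7) d(1) mem(3) by (auto simp: card_insert_if)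
    moreover have "card {c, alpha0 M c, alpha2 M c, d, alpha0 M d} \<le> card A"
      by (rule card_mono[OF _ sub]) (use AC is_map_finite[OF M] finite_subset in blast)
    ultimately show False using face_degree_two_card[OF M A(1,2)] by simp
  qed
  moreover have "A = gen_orbit {alpha0 M, alpha1 M} c" using gen_orbit_eq[OF rev a(1), of c] c a by simp
  ultimately show thesis using that cC f by blast
qed

section \<open>Cycles given by lists\<close>

lemma cycle_of_list_nth:
  assumes "distinct w" "k < length w"
  shows "cycle_of_list w (w ! k) = w ! (Suc k mod length w)"
proof -
  have "map (cycle_of_list w) w = rotate1 w" using cyclic_rotation[OF assms(1), of 1] by simp
  then have "map (cycle_of_list w) w ! k = rotate1 w ! k" by simp
  then show ?thesis using assms by (simp add: nth_rotate1)
qed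

lemma cycle_of_list_funpow_nth:
  assumes "distinct w" "k < length w"
  shows "(cycle_of_list w ^^ m) (w ! k) = w ! ((k + m) mod length w)"
proof (induction m)
  case 0
  then show ?case using assms by simp
next
  case (Suc m)
  have "(k + m) mod length w < length w" using assms by (intro mod_less_divisor) auto
  then have "cycle_of_list w (w ! ((k + m) mod length w)) = w ! (Suc ((k + m) mod length w) mod length w)"
    by (rule cycle_of_list_nth[OF assms(1)])
  then show ?case using Suc by (simp add: mod_Suc_eq)
qed

lemma cycle_of_list_adjacent:
  assumes "distinct (A @ a # b # B)"
  shows "cycle_of_list (A @ a # b # B) a = b"
  using cycle_of_list_nth[OF assms, of "length A"] by (simp add: nth_append)

lemma cycle_of_list_rev:
  assumes w: "distinct w"
  shows "cycle_of_list (rev w) (cycle_of_list w h) = h"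
proof (cases "h \<in> set w")
  case False
  then show ?thesis by (simp add: id_outside_supp)
next
  case True
  then obtain k where k: "k < length w" "h = w ! k" by (metis in_set_conv_nth)
  let ?n = "length w"
  define j where "j = Suc k mod ?n"
  have j: "j < ?n" using k by (auto simp: j_def intro: mod_less_divisor)
  have "cycle_of_list w h = rev w ! (?n - 1 - j)"
    using cycle_of_list_nth[OF w k(1)] k j by (simp add: rev_nth j_def)
  then have "cycle_of_list (rev w) (cycle_of_list w h) = rev w ! (Suc (?n - 1 - j) mod ?n)"
    using cycle_of_list_nth[of "rev w" "?n - 1 - j"] w j by simp
  also have "\<dots> = w ! k"
  proof (cases "Suc k < ?n")
    case True
    then have "j = Suc k" by (simp add: j_def)
    then show ?thesis using True by (simp add: rev_nth Suc_diff_Suc)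
  next
    case False
    then have n: "?n = Suc k" using k by simp
    then have "j = 0" by (simp add: j_def)
    then show ?thesis by (simp add: rev_nth n)
  qed
  finally show ?thesis using k by simp
qed

lemma cycle_of_list_rev':
  assumes w: "distinct w"
  shows "cycle_of_list w (cycle_of_list (rev w) h) = h"
  using cycle_of_list_rev[of "rev w"] w by simp

lemma cycle_of_list_rotate:
  assumes "distinct (A @ B)"
  shows "cycle_of_list (A @ B) = cycle_of_list (B @ A)"
  using cycle_of_list_rotate_independent[OF assms, of "length A"] by (simp add: rotate_append)

lemma cycle_of_list_in: "h \<in> set w \<Longrightarrow> cycle_of_list w h \<in> set w"
  using cycle_permutes[of w] by (simp add: permutes_in_image)

lemma cycle_of_list_map:
  assumes "distinct w" "inj_on \<nu> (set w)" "h \<in> set w"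
  shows "cycle_of_list (map \<nu> w) (\<nu> h) = \<nu> (cycle_of_list w h)"
proof -
  obtain k where k: "k < length w" "h = w ! k" using assms(3) by (metis in_set_conv_nth)
  have "distinct (map \<nu> w)" using assms by (simp add: distinct_map)
  then have "cycle_of_list (map \<nu> w) (map \<nu> w ! k) = map \<nu> w ! (Suc k mod length w)"
    using cycle_of_list_nth[of "map \<nu> w" k] k by simp
  moreover have "Suc k mod length w < length w" using k by (intro mod_less_divisor) auto
  ultimately show ?thesis using k cycle_of_list_nth[OF assms(1) k(1)] by simp
qed

text \<open>With \<open>h\<close> rotated to the front, the first return skips the leading block of
  elements of \<open>D\<close> in the remaining list, and this is precisely what
  \<open>filter\<close> removes between \<open>h\<close> and its next letter.\<close>

lemma first_return_cycle:
  assumes w: "distinct w" and h: "h \<in> set w" "h \<notin> D"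
  shows "first_return (cycle_of_list w) D h = cycle_of_list (filter (\<lambda>x. x \<notin> D) w) h"
proof -
  obtain A B where AB: "w = A @ h # B" using h(1) by (metis split_list)
  define ys where "ys = B @ A"
  have dis: "distinct (h # ys)" using w by (auto simp: AB ys_def)
  have cw: "cycle_of_list w = cycle_of_list (h # ys)"
    using cycle_of_list_rotate[of A "h # B"] w by (simp add: AB ys_def)
  let ?f = "filter (\<lambda>x. x \<notin> D)"
  have "distinct (?f w)" using w by simp
  then have cf: "cycle_of_list (?f w) = cycle_of_list (h # ?f ys)"
    using cycle_of_list_rotate[of "?f A" "h # ?f B"] h(2) by (simp add: AB ys_def)
  let ?c = "cycle_of_list (h # ys)"
  have pow: "(?c ^^ m) h = (h # ys) ! (m mod length (h # ys))" for m
    using cycle_of_list_funpow_nth[OF dis, of 0 m] by simp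
  let ?zs = "takeWhile (\<lambda>x. x \<in> D) ys"
  have zs: "(?c ^^ m) h \<in> D" if "0 < m" "m \<le> length ?zs" for m
  proof -
    have "length ?zs \<le> length ys" by (rule length_takeWhile_le)
    then have "m mod length (h # ys) = m" using that by simp
    then have "(?c ^^ m) h = ys ! (m - 1)" using pow that by (simp add: nth_Cons')
    also have "\<dots> = ?zs ! (m - 1)" using that by (simp add: takeWhile_nth)
    finally show ?thesis using that set_takeWhileD[of "?zs ! (m - 1)"] by (metis Suc_diff_1 Suc_le_lessD nth_mem)
  qed
  show ?thesis
  proof (cases "dropWhile (\<lambda>x. x \<in> D) ys")
    \<comment> \<open>All other elements lie in \<open>D\<close>: the walk comes back to
      \<open>h\<close> after a full turn, and the cycle of a one-element list is the
      identity.\<close>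
    case Nil
    then have all: "\<forall>x\<in>set ys. x \<in> D" by (simp add: dropWhile_eq_Nil_conv)
    then have zl: "?zs = ys" by (simp add: takeWhile_eq_all_conv)
    have "(LEAST n. n > 0 \<and> (?c ^^ n) h \<notin> D) = Suc (length ys)"
    proof (rule Least_equality)
      show "0 < Suc (length ys) \<and> (?c ^^ Suc (length ys)) h \<notin> D" using pow[of "Suc (length ys)"] h by simp
      show "Suc (length ys) \<le> n" if "0 < n \<and> (?c ^^ n) h \<notin> D" for n
        using that zs[of n] zl by (metis not_less_eq_eq)
    qed
    then have "first_return ?c D h = h" unfolding first_return_def using pow[of "Suc (length ys)"] by simp
    moreover have "?f ys = []" using all by (simp add: filter_empty_conv)
    ultimately show ?thesis unfolding cw cf by simp
  next
    case (Cons d ts)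
    have ys: "ys = ?zs @ d # ts" using Cons takeWhile_dropWhile_id[of "\<lambda>x. x \<in> D" ys] by simp
    have d: "d \<notin> D" using Cons by (simp add: dropWhile_eq_Cons_conv)
    have fd: "(?c ^^ Suc (length ?zs)) h = d"
    proof -
      have "length ys = length ?zs + Suc (length ts)" by (metis ys length_append length_Cons)
      then have "Suc (length ?zs) mod length (h # ys) = Suc (length ?zs)" by simp
      then have "(?c ^^ Suc (length ?zs)) h = ys ! length ?zs" using pow[of "Suc (length ?zs)"] by (metis nth_Cons_Suc)
      also have "\<dots> = d" by (metis ys nth_append_length)
      finally show ?thesis .
    qed
    have "(LEAST n. n > 0 \<and> (?c ^^ n) h \<notin> D) = Suc (length ?zs)"
    proof (rule Least_equality)
      show "0 < Suc (length ?zs) \<and> (?c ^^ Suc (length ?zs)) h \<notin> D" using fd d by simp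
      show "Suc (length ?zs) \<le> n" if "0 < n \<and> (?c ^^ n) h \<notin> D" for n
        using that zs[of n] by (metis not_less_eq_eq)
    qed
    then have "first_return ?c D h = d" unfolding first_return_def using fd by simp
    moreover have "?f ys = d # ?f ts"
    proof -
      have "?f ?zs = []" by (auto simp: filter_empty_conv dest: set_takeWhileD)
      then show ?thesis using d by (subst ys) simp
    qed
    moreover have "distinct (h # ?f ys)" using dis by simp
    ultimately show ?thesis unfolding cw cf
      using cycle_of_list_adjacent[of "[]" h d "?f ts"] by simp
  qed
qed

lemma first_return_conj:
  assumes x: "x \<in> S" and g: "\<And>x. x \<in> S \<Longrightarrow> g x \<in> S" and conj: "\<And>x. x \<in> S \<Longrightarrow> f (k x) = k (g x)"
    and D: "\<And>x. x \<in> S \<Longrightarrow> k x \<in> D \<longleftrightarrow> x \<in> E"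
  shows "first_return f D (k x) = k (first_return g E x)"
proof -
  have S: "(g ^^ n) x \<in> S" for n by (induction n) (use x g in auto)
  have pow: "(f ^^ n) (k x) = k ((g ^^ n) x)" for n
    by (induction n) (use S conj in auto)
  then show ?thesis unfolding first_return_def using D[OF S] by simp
qed

section \<open>Words of half-edges\<close>

text \<open>A half-edge consists of the name of its edge, a flag telling whether the edge is twisted,
  and a flag distinguishing the two ends. A word lists the half-edges around the single vertex,
  and the crosses are the two sides of the half-edges.\<close>

datatype hedge = Hedge (hname: nat) (tw: bool) (hend: bool)

instance hedge :: countable
  by countable_datatype

definition bar :: "hedge \<Rightarrow> hedge" where "bar h = Hedge (hname h) (tw h) (\<not> hend h)"

lemma bar_simps [simp]: "bar (bar h) = h" "bar h \<noteq> h" "h \<noteq> bar h" "tw (bar h) = tw h" "bar h = bar h' \<longleftrightarrow> h = h'"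
  by (cases h; cases h'; auto simp: bar_def)+

text \<open>Sides are named as seen from the vertex, \<open>True\<close> being the one that faces
  the next half-edge of the word. Hence following an edge changes the name of the side if the edge
  is untwisted and keeps it if the edge is twisted.\<close>

fun wa0 :: "hedge \<times> bool \<Rightarrow> hedge \<times> bool" where "wa0 (h, s) = (bar h, s = tw h)"

fun wa2 :: "hedge \<times> bool \<Rightarrow> hedge \<times> bool" where "wa2 (h, s) = (h, \<not> s)"

text \<open>A half-edge outside \<open>w\<close> is detached: its two sides are exchanged by \<open>wa1 w\<close>.\<close>

fun wa1 :: "hedge list \<Rightarrow> hedge \<times> bool \<Rightarrow> hedge \<times> bool" where
  "wa1 w (h, s) = (if s then (cycle_of_list w h, False) else (cycle_of_list (rev w) h, True))"

lemma wa0_simps [simp]: "wa0 (wa0 x) = x" "wa0 x \<noteq> x"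
  by (cases x; auto)+

lemma wa2_simps [simp]: "wa2 (wa2 x) = x" "wa2 x \<noteq> x" "wa0 (wa2 x) = wa2 (wa0 x)" "wa0 x \<noteq> wa2 x"
  by (cases x; auto)+

lemma snd_wa1 [simp]: "snd (wa1 w x) = (\<not> snd x)"
  by (cases x) auto

lemma wa1_simps [simp]:
  assumes "distinct w"
  shows "wa1 w (wa1 w x) = x" "wa1 w x \<noteq> x"
proof -
  show "wa1 w (wa1 w x) = x" using cycle_of_list_rev[OF assms] cycle_of_list_rev'[OF assms] by (cases x) auto
  show "wa1 w x \<noteq> x" by (cases x) auto
qed

definition valid :: "hedge list \<Rightarrow> bool" where
  "valid w \<longleftrightarrow> distinct w \<and> (\<forall>h\<in>set w. bar h \<in> set w) \<and> w \<noteq> []"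

abbreviation sides :: "hedge list \<Rightarrow> (hedge \<times> bool) set" where
  "sides w \<equiv> set w \<times> UNIV"

lemma wa_sides:
  assumes "valid w" "x \<in> sides w"
  shows "wa0 x \<in> sides w" "wa1 w x \<in> sides w" "wa2 x \<in> sides w"
  using assms cycle_of_list_in[of _ w] cycle_of_list_in[of _ "rev w"]
  by (cases x; auto simp: valid_def)+

text \<open>Attaching the half-edge \<open>l\<close> in front of \<open>j\<close> conjugates
  \<open>wa1\<close> by a transposition, exactly as a vertex gluing does with \<open>alpha1\<close>.
  This makes \<open>merge_orbits\<close> available for counting faces. It rests on the recursion of
  \<open>cycle_of_list\<close>, whose step is the transposition of \<open>l\<close> and
  \<open>j\<close>.\<close>

lemma wa1_transpose:
  assumes "distinct (l # j # cs)"
  shows "wa1 (l # j # cs) x = transpose (l, False) (j, False) (wa1 (j # cs) (transpose (l, False) (j, False) x))"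
proof -
  let ?v = "j # cs" and ?w = "l # j # cs"
  obtain h s where x: "x = (h, s)" by (cases x)
  have v: "distinct ?v" using assms by simp
  have T: "transpose (l, False) (j, False) (h, s) = (if s then (h, s) else (transpose l j h, s))" for h s
    by (auto simp: transpose_def)
  have cw: "cycle_of_list ?w h = transpose l j (cycle_of_list ?v h)" for h by simp
  have "cycle_of_list (rev ?w) h = cycle_of_list (rev ?v) (transpose l j h)"
  proof -
    have "cycle_of_list ?w (cycle_of_list (rev ?v) (transpose l j h)) = h"
      using cycle_of_list_rev'[OF v] by simp
    then show ?thesis using cycle_of_list_rev[OF assms] by metis
  qed
  then show ?thesis unfolding x using cw[of h] by (simp add: T del: cycle_of_list.simps rev.simps)
qed

lemma word_reversible:
  assumes "valid w" "F \<subseteq> {wa0, wa1 w, wa2}"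
  shows "reversible_on F (sides w)"
proof (rule reversible_on_involutions)
  fix f x assume "f \<in> F" "x \<in> sides w"
  then have "f \<in> {wa0, wa1 w, wa2}" using assms by blast
  then show "f x \<in> sides w \<and> f (f x) = x"
    using wa_sides[OF assms(1) \<open>x \<in> sides w\<close>] assms(1) unfolding valid_def
    by (metis empty_iff insert_iff wa0_simps(1) wa1_simps(1) wa2_simps(1))
qed

lemma word_vertex_funpow: "((cycle_of_list w ^^ m) h, False) \<in> gen_orbit {wa1 w, wa2} (h, False)"
proof (induction m)
  case 0
  show ?case by simp
next
  case (Suc m)
  let ?y = "((cycle_of_list w ^^ m) h, False)"
  have g: "wa1 w \<in> {wa1 w, wa2}" "wa2 \<in> {wa1 w, wa2}" by blast+
  have "wa2 ?y \<in> gen_orbit {wa1 w, wa2} (h, False)" by (rule gen_orbit_step[OF Suc g(2)])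
  then have "wa1 w (wa2 ?y) \<in> gen_orbit {wa1 w, wa2} (h, False)" by (rule gen_orbit_step[OF _ g(1)])
  then show ?case by simp
qed

lemma word_vertex:
  assumes w: "valid w" and x: "x \<in> sides w"
  shows "gen_orbit {wa1 w, wa2} x = sides w"
proof
  have rev: "reversible_on {wa1 w, wa2} (sides w)" by (rule word_reversible[OF w]) auto
  show "gen_orbit {wa1 w, wa2} x \<subseteq> sides w" using gen_orbit_in[OF rev x] .
  have dist: "distinct w" using w by (simp add: valid_def)
  have g: "wa1 w \<in> {wa1 w, wa2}" "wa2 \<in> {wa1 w, wa2}" by blast+
  have reach: "(h', False) \<in> gen_orbit {wa1 w, wa2} (h, False)"
    if hh: "h \<in> set w" "h' \<in> set w" for h h'
  proof -
    obtain k k' where k: "k < length w" "h = w ! k" "k' < length w" "h' = w ! k'"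
      using hh by (metis in_set_conv_nth)
    \<comment> \<open>The full turn \<open>length w\<close> keeps the subtraction of natural numbers
      from being truncated.\<close>
    have "k + (length w + k' - k) = k' + length w" using k(1) by linarith
    then have "(k + (length w + k' - k)) mod length w = k'" using k(3) by (metis mod_add_self2 mod_less)
    then have "(cycle_of_list w ^^ (length w + k' - k)) h = h'"
      using cycle_of_list_funpow_nth[OF dist k(1), of "length w + k' - k"] k(2,4) by metis
    then show ?thesis using word_vertex_funpow[of "length w + k' - k" w h] by metis
  qed
  have flip: "(h, True) \<in> gen_orbit {wa1 w, wa2} y" if "(h, False) \<in> gen_orbit {wa1 w, wa2} y" for h y
  proof -
    have "wa2 (h, False) \<in> gen_orbit {wa1 w, wa2} y" by (rule gen_orbit_step[OF that g(2)])
    then show ?thesis by simp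
  qed
  have unflip: "(h, False) \<in> gen_orbit {wa1 w, wa2} (h, s)" for h s
  proof (cases s)
    case True
    have "wa2 (h, s) \<in> gen_orbit {wa1 w, wa2} (h, s)"
      by (rule gen_orbit_step[OF gen_orbit_refl g(2)])
    then show ?thesis using True by simp
  next
    case False
    then show ?thesis using gen_orbit_refl[of "(h, s)"] by simp
  qed
  show "sides w \<subseteq> gen_orbit {wa1 w, wa2} x"
  proof
    fix y assume y: "y \<in> sides w"
    obtain h s h' s' where xy: "x = (h, s)" "y = (h', s')" by (cases x, cases y)
    have "(h', False) \<in> gen_orbit {wa1 w, wa2} (h, s)"
      using reach[of h h'] x y xy gen_orbit_trans[OF unflip[of h s]] by blast
    then show "y \<in> gen_orbit {wa1 w, wa2} x" using flip[of h' "(h, s)"] xy by (cases s') simp_all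
  qed
qed

lemma word_component:
  assumes w: "valid w" and x: "x \<in> sides w"
  shows "gen_orbit {wa0, wa1 w, wa2} x = sides w"
proof
  have rev: "reversible_on {wa0, wa1 w, wa2} (sides w)" by (rule word_reversible[OF w]) auto
  show "gen_orbit {wa0, wa1 w, wa2} x \<subseteq> sides w" using gen_orbit_in[OF rev x] .
  have "gen_orbit {wa1 w, wa2} x \<subseteq> gen_orbit {wa0, wa1 w, wa2} x"
  proof (rule gen_orbit_least)
    fix y f assume "y \<in> gen_orbit {wa0, wa1 w, wa2} x" "f \<in> {wa1 w, wa2}"
    then show "f y \<in> gen_orbit {wa0, wa1 w, wa2} x"
      using gen_orbit_step[of y "{wa0, wa1 w, wa2}" x f] by blast
  qed simp
  then show "sides w \<subseteq> gen_orbit {wa0, wa1 w, wa2} x" using word_vertex[OF w x] by simp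
qed

lemma word_edge: "gen_orbit {wa0, wa2} (h, s) = {h, bar h} \<times> UNIV"
proof
  show "gen_orbit {wa0, wa2} (h, s) \<subseteq> {h, bar h} \<times> UNIV"
  proof (rule gen_orbit_least)
    fix x f assume "x \<in> {h, bar h} \<times> (UNIV :: bool set)" "f \<in> {wa0, wa2}"
    then show "f x \<in> {h, bar h} \<times> UNIV" by (cases x) auto
  qed simp
  let ?O = "gen_orbit {wa0, wa2} (h, s)"
  have "wa2 (h, s) \<in> ?O" by (rule gen_orbit_step[OF gen_orbit_refl, of wa2]) blast
  then have 1: "(h, t) \<in> ?O" for t using gen_orbit_refl[of "(h, s)" "{wa0, wa2}"] by (cases "t = s") simp_all
  have 2: "wa0 (h, t) \<in> ?O" for t by (rule gen_orbit_step[OF 1, of wa0]) blast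
  have "(bar h, t) \<in> ?O" for t using 2[of "t = tw h"] by (cases t; cases "tw h") simp_all
  then show "{h, bar h} \<times> UNIV \<subseteq> ?O" using 1 by auto
qed

section \<open>Faces and twists under deletion of an edge\<close>

definition nfaces :: "hedge list \<Rightarrow> nat" where
  "nfaces w = card (orbits_on {wa0, wa1 w} (sides w))"

text \<open>\<open>a\<close> and \<open>b\<close> are the words with and without \<open>l\<close>,
  in either order, so that one statement serves attaching and detaching: whichever word has
  \<open>(l, False)\<close> and \<open>(j, False)\<close> in different orbits, passing to the other
  merges these. Counting over \<open>S\<close>, detached half-edges included, lets both words act on
  the same set.\<close>

lemma card_orbits_detach:
  assumes S: "finite S" "\<And>h. h \<in> S \<Longrightarrow> bar h \<in> S" and w: "distinct (l # j # cs)" "set (l # j # cs) \<subseteq> S"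
    and a: "a \<in> {l # j # cs, j # cs}" and b: "b \<in> {l # j # cs, j # cs}" "a \<noteq> b"
    and neq: "gen_orbit {wa0, wa1 a} (l, False) \<noteq> gen_orbit {wa0, wa1 a} (j, False)"
  shows "Suc (card (orbits_on {wa0, wa1 b} (S \<times> UNIV))) = card (orbits_on {wa0, wa1 a} (S \<times> UNIV))"
proof -
  have cyc: "cycle_of_list v h \<in> S" if "h \<in> S" "set v \<subseteq> S" for v h
    using that cycle_of_list_in[of h v] by (cases "h \<in> set v") (auto simp: id_outside_supp)
  have da: "distinct a" "set a \<subseteq> S" using a w by auto
  have sets: "{wa0, wa1 v} = insert (wa1 v) {wa0}" for v by blast
  have T: "wa1 b x = transpose (l, False) (j, False) (wa1 a (transpose (l, False) (j, False) x))" for x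
  proof (cases "a = j # cs")
    case True
    then have "b = l # j # cs" using b by blast
    then show ?thesis using True wa1_transpose[OF w(1)] by blast
  next
    case False
    then have "a = l # j # cs" "b = j # cs" using a b by auto
    then show ?thesis using wa1_transpose[OF w(1), of "transpose (l, False) (j, False) x"] by simp
  qed
  show ?thesis
    unfolding sets
  proof (rule merge_orbits(3)[of _ _ _ wa0 _ "(l, False)" "(j, False)"])
    show "finite (S \<times> (UNIV :: bool set))" using S by simp
    show "f x \<in> S \<times> UNIV \<and> f (f x) = x" if "f \<in> {wa0}" "x \<in> S \<times> UNIV" for f x
      using that S(2) by (cases x) auto
    show "wa1 a x \<in> S \<times> UNIV \<and> wa1 a (wa1 a x) = x \<and> wa1 a x \<noteq> x" if "x \<in> S \<times> UNIV" for x
    proof -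
      have "wa1 a x \<in> S \<times> UNIV" using that cyc[of "fst x" a] cyc[of "fst x" "rev a"] da by (cases x) auto
      then show ?thesis using wa1_simps[OF da(1)] by blast
    qed
    show "gen_orbit (insert (wa1 a) {wa0}) (l, False) \<noteq> gen_orbit (insert (wa1 a) {wa0}) (j, False)"
      using neq unfolding sets .
    show "wa1 b x = transpose (l, False) (j, False) (wa1 a (transpose (l, False) (j, False) x))" for x by (rule T)
  qed (use w in auto)
qed

lemma wa1_rotate:
  assumes "distinct (A @ B)"
  shows "wa1 (A @ B) = wa1 (B @ A)"
proof -
  have "cycle_of_list (A @ B) = cycle_of_list (B @ A)" by (rule cycle_of_list_rotate[OF assms])
  moreover have "cycle_of_list (rev (A @ B)) = cycle_of_list (rev (B @ A))"
    using cycle_of_list_rotate[of "rev B" "rev A"] assms by auto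
  ultimately show ?thesis by (simp add: fun_eq_iff)
qed

definition del_hedge :: "hedge \<Rightarrow> hedge list \<Rightarrow> hedge list" where
  "del_hedge l w = filter (\<lambda>x. x \<notin> {l, bar l}) w"

lemma valid_del_hedge: "valid w \<Longrightarrow> del_hedge l w \<noteq> [] \<Longrightarrow> valid (del_hedge l w)"
  unfolding valid_def del_hedge_def by auto

lemma wa1_rotate_to_front:
  assumes "distinct w" "h \<in> set w" "filter (\<lambda>x. x \<noteq> h) w \<noteq> []"
  obtains j cs where "distinct (h # j # cs)" "set (h # j # cs) = set w" "wa1 (h # j # cs) = wa1 w"
    "wa1 (j # cs) = wa1 (filter (\<lambda>x. x \<noteq> h) w)"
proof -
  obtain A B where AB: "w = A @ h # B" using assms(2) by (metis split_list)
  have no: "h \<notin> set A" "h \<notin> set B" using assms(1) AB by auto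
  have "filter (\<lambda>x. x \<noteq> h) A = A" "filter (\<lambda>x. x \<noteq> h) B = B"
    using no by (auto simp: filter_id_conv)
  then have f: "filter (\<lambda>x. x \<noteq> h) w = A @ B" unfolding AB by simp
  obtain j cs where jc: "B @ A = j # cs" using assms(3) f by (cases "B @ A") auto
  have "distinct (h # B @ A)" using assms(1) AB by auto
  moreover have "wa1 (h # B @ A) = wa1 w" using wa1_rotate[of A "h # B"] assms(1) AB by simp
  moreover have "wa1 (B @ A) = wa1 (A @ B)" using wa1_rotate[of A B] assms(1) AB by simp
  moreover have "set (h # B @ A) = set w" using AB by auto
  ultimately show thesis using that[of j cs] jc f by simp
qed

text \<open>The two ends are detached one after the other. Detaching \<open>l\<close> merges the
  faces on its two sides; detaching \<open>bar l\<close> then splits off the detached edge as an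
  orbit of its own, which is not a face of the remaining word. The three changes add up to the loss
  of one face.\<close>

lemma nfaces_del_hedge:
  assumes w: "valid w" and l: "l \<in> set w" and ne: "del_hedge l w \<noteq> []"
    and sides: "(l, True) \<notin> gen_orbit {wa0, wa1 w} (l, False)"
  shows "nfaces w = Suc (nfaces (del_hedge l w))"
proof -
  let ?S = "set w"
  have dist: "distinct w" and bar: "\<And>h. h \<in> set w \<Longrightarrow> bar h \<in> set w" using w by (auto simp: valid_def)
  let ?v = "filter (\<lambda>x. x \<noteq> l) w" and ?u = "del_hedge l w"
  have u: "?u = filter (\<lambda>x. x \<noteq> bar l) ?v" unfolding del_hedge_def by (simp add: conj_commute)
  let ?n = "\<lambda>w. card (orbits_on {wa0, wa1 w} (?S \<times> UNIV))"
  have revw: "reversible_on {wa0, wa1 w} (sides w)" by (rule word_reversible[OF w]) auto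
  have vne: "?v \<noteq> []" using ne unfolding u by (metis filter.simps(1))
  \<comment> \<open>The corner after \<open>l\<close> joins \<open>(l, True)\<close> to
    \<open>(j, False)\<close>, so the two orbits to be merged are the faces on the two sides of
    \<open>l\<close>.\<close>
  have 1: "Suc (?n ?v) = ?n w"
  proof -
    obtain j cs where jc: "distinct (l # j # cs)" "set (l # j # cs) = set w" "wa1 (l # j # cs) = wa1 w"
      "wa1 (j # cs) = wa1 ?v"
      using wa1_rotate_to_front[OF dist l vne] by blast
    have "wa1 w (l, True) = (j, False)"
      unfolding jc(3)[symmetric] using cycle_of_list_adjacent[of "[]" l j cs] jc(1) by simp
    moreover have "gen_orbit {wa0, wa1 w} (wa1 w (l, True)) = gen_orbit {wa0, wa1 w} (l, True)"
      by (rule gen_orbit_step_eq[OF revw]) (use l in auto)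
    ultimately have "gen_orbit {wa0, wa1 w} (l, False) \<noteq> gen_orbit {wa0, wa1 w} (j, False)"
      using sides by auto
    moreover have sub: "set (l # j # cs) \<subseteq> ?S" using jc(2) by simp
    ultimately have "Suc (?n (j # cs)) = ?n (l # j # cs)"
      using bar jc(1,3) by (intro card_orbits_detach[of ?S l j cs]) simp_all
    then show ?thesis unfolding jc(3,4) .
  qed
  have bl: "bar l \<in> set ?v" using bar[OF l] by simp
  \<comment> \<open>Read backwards: in \<open>?u\<close> both ends are detached, so the orbit of
    \<open>bar l\<close> stays within the edge, and attaching \<open>bar l\<close> merges it with
    the orbit of \<open>j\<close>.\<close>
  have 2: "Suc (?n ?v) = ?n ?u"
  proof -
    have "distinct ?v" using dist by simp
    then obtain j cs where jc: "distinct (bar l # j # cs)" "set (bar l # j # cs) = set ?v"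
      "wa1 (bar l # j # cs) = wa1 ?v" "wa1 (j # cs) = wa1 ?u"
      using wa1_rotate_to_front[of ?v "bar l"] bl ne unfolding u by blast
    have out: "l \<notin> set ?u" "bar l \<notin> set ?u" by (auto simp: del_hedge_def)
    have "gen_orbit {wa0, wa1 ?u} (bar l, False) \<subseteq> {l, bar l} \<times> UNIV"
    proof (rule gen_orbit_least)
      fix x f assume "x \<in> {l, bar l} \<times> (UNIV :: bool set)" "f \<in> {wa0, wa1 ?u}"
      then show "f x \<in> {l, bar l} \<times> UNIV" using out by (cases x) (auto simp: id_outside_supp)
    qed simp
    moreover have "j \<notin> {l, bar l}" using jc(1,2) by auto
    ultimately have "gen_orbit {wa0, wa1 ?u} (bar l, False) \<noteq> gen_orbit {wa0, wa1 ?u} (j, False)"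
      using gen_orbit_refl[of "(j, False)" "{wa0, wa1 ?u}"] by auto
    moreover have sub: "set (bar l # j # cs) \<subseteq> ?S" using jc(2) by auto
    ultimately have "Suc (?n (bar l # j # cs)) = ?n (j # cs)"
      using bar jc(1,4) by (intro card_orbits_detach[of ?S "bar l" j cs]) simp_all
    then show ?thesis unfolding jc(3,4) .
  qed
  \<comment> \<open>On the detached edge \<open>wa1\<close> acts like \<open>wa2\<close>, so its
    four sides form exactly one orbit.\<close>
  have 3: "?n ?u = Suc (nfaces ?u)"
  proof -
    have vu: "valid ?u" by (rule valid_del_hedge[OF w ne])
    have S: "?S \<times> (UNIV :: bool set) = sides ?u \<union> {l, bar l} \<times> UNIV"
      using l bar[OF l] by (auto simp: del_hedge_def)
    have out: "l \<notin> set ?u" "bar l \<notin> set ?u" by (auto simp: del_hedge_def)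
    have orb: "gen_orbit {wa0, wa1 ?u} x = {l, bar l} \<times> UNIV" if x: "x \<in> {l, bar l} \<times> UNIV" for x
    proof -
      have eq: "wa1 ?u y = wa2 y" if "y \<in> {l, bar l} \<times> UNIV" for y
        using that out by (cases y) (auto simp: id_outside_supp)
      obtain h s where hs: "x = (h, s)" "h \<in> {l, bar l}" using x by auto
      have "gen_orbit {wa0, wa1 ?u} (id x) = id ` gen_orbit {wa0, wa2} x"
      proof (rule gen_orbit_image[OF x])
        show "f y \<in> {l, bar l} \<times> UNIV" if "f \<in> {wa0, wa2}" "y \<in> {l, bar l} \<times> UNIV" for f y
          using that by (cases y) auto
        show "(\<lambda>g. g (id y)) ` {wa0, wa1 ?u} = (\<lambda>f. id (f y)) ` {wa0, wa2}" if "y \<in> {l, bar l} \<times> UNIV" for y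
          using eq[OF that] by simp
      qed
      then show ?thesis using word_edge[of h s] hs by auto
    qed
    have new: "orbits_on {wa0, wa1 ?u} (?S \<times> UNIV) =
      insert ({l, bar l} \<times> UNIV) (orbits_on {wa0, wa1 ?u} (sides ?u))"
    proof -
      have "gen_orbit {wa0, wa1 ?u} ` ({l, bar l} \<times> UNIV) = {{l, bar l} \<times> UNIV}"
        using orb by (auto simp del: insert_Times_insert)
      then show ?thesis unfolding orbits_on_def S image_Un by blast
    qed
    have rev: "reversible_on {wa0, wa1 ?u} (sides ?u)" by (rule word_reversible[OF vu]) auto
    have "{l, bar l} \<times> UNIV \<notin> orbits_on {wa0, wa1 ?u} (sides ?u)"
    proof
      assume "{l, bar l} \<times> UNIV \<in> orbits_on {wa0, wa1 ?u} (sides ?u)"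
      then obtain x where "x \<in> sides ?u" "{l, bar l} \<times> (UNIV :: bool set) = gen_orbit {wa0, wa1 ?u} x"
        unfolding orbits_on_def by (rule imageE)
      then have "{l, bar l} \<times> (UNIV :: bool set) \<subseteq> sides ?u"
        using gen_orbit_in[OF rev, of x] by argo
      then have "(l, True) \<in> sides ?u" by blast
      then show False using out by simp
    qed
    then show ?thesis unfolding new nfaces_def by (simp add: orbits_on_def)
  qed
  show ?thesis using 1 2 3 unfolding nfaces_def[of w] by simp
qed

text \<open>Only the case that \<open>l\<close> carries the sole twist needs an argument. Around the
  face of \<open>(l, False)\<close> the flag \<open>snd\<close> changes at every corner and along
  every untwisted edge, and the face meets \<open>l\<close> on one side only. By
  \<open>flip_across_cut\<close> the flag changes along \<open>l\<close> too, so \<open>l\<close> is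
  not twisted.\<close>

lemma twisted_del_hedge:
  assumes w: "valid w" and l: "l \<in> set w"
    and sides: "(l, True) \<notin> gen_orbit {wa0, wa1 w} (l, False)"
  shows "(\<exists>h\<in>set (del_hedge l w). tw h) \<longleftrightarrow> (\<exists>h\<in>set w. tw h)"
proof (rule ccontr)
  assume neg: "\<not> ?thesis"
  then have un: "\<not> tw h" if "h \<in> set w" "h \<notin> {l, bar l}" for h
    using that by (auto simp: del_hedge_def)
  have "tw l" using neg by (auto simp: del_hedge_def)
  let ?A = "gen_orbit {wa0, wa1 w} (l, False)"
  have dist: "distinct w" using w by (simp add: valid_def)
  have rev: "reversible_on {wa0, wa1 w} (sides w)" by (rule word_reversible[OF w]) auto
  have A: "?A \<subseteq> sides w" using gen_orbit_in[OF rev, of "(l, False)"] l by auto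
  have no: "(bar l, True) \<notin> ?A"
  proof
    assume "(bar l, True) \<in> ?A"
    then have "wa0 (bar l, True) \<in> ?A" by (rule gen_orbit_step[of _ _ _ wa0]) blast
    then show False using sides \<open>tw l\<close> by simp
  qed
  have "snd (l, False) \<noteq> snd (wa0 (l, False))"
  proof (rule flip_across_cut[of ?A _ _ "wa1 w"])
    show "finite ?A" using A finite_subset by fastforce
    fix x assume x: "x \<in> ?A"
    show "wa0 x \<in> ?A \<and> wa0 (wa0 x) = x" using gen_orbit_step[OF x, of wa0] by simp
    show "wa1 w x \<in> ?A \<and> wa1 w (wa1 w x) = x" using gen_orbit_step[OF x, of "wa1 w"] dist by simp
    show "snd (wa1 w x) \<noteq> snd x" by simp
    assume "x \<noteq> (l, False)" "x \<noteq> wa0 (l, False)"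
    then have "fst x \<notin> {l, bar l}" using x sides no \<open>tw l\<close> by (cases x; cases "snd x") auto
    then have "\<not> tw (fst x)" using un A x by auto
    then show "snd (wa0 x) \<noteq> snd x" by (cases x) auto
  qed simp
  then show False using \<open>tw l\<close> by simp
qed

section \<open>Maps with one vertex\<close>

text \<open>The value outside the image of \<open>S\<close> is the one that \<open>permutes\<close>
  prescribes. Thus an arbitrary map with one vertex can be equal, and not merely isomorphic, to one
  built from a word.\<close>

definition lift :: "('b \<Rightarrow> 'a) \<Rightarrow> 'b set \<Rightarrow> ('b \<Rightarrow> 'b) \<Rightarrow> 'a \<Rightarrow> 'a" where
  "lift \<iota> S f c = (if c \<in> \<iota> ` S then \<iota> (f (inv_into S \<iota> c)) else c)"

lemma lift_apply [simp]: "inj_on \<iota> S \<Longrightarrow> x \<in> S \<Longrightarrow> lift \<iota> S f (\<iota> x) = \<iota> (f x)"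
  by (simp add: lift_def)

lemma lift_outside: "c \<notin> \<iota> ` S \<Longrightarrow> lift \<iota> S f c = c"
  by (simp add: lift_def)

lemma fpf_involution_lift:
  assumes inj: "inj_on \<iota> S" and f: "\<And>x. x \<in> S \<Longrightarrow> f x \<in> S \<and> f (f x) = x \<and> f x \<noteq> x"
  shows "fpf_involution_on (\<iota> ` S) (lift \<iota> S f)"
proof -
  have 1: "lift \<iota> S f c \<in> \<iota> ` S \<and> lift \<iota> S f (lift \<iota> S f c) = c \<and> lift \<iota> S f c \<noteq> c" if c: "c \<in> \<iota> ` S" for c
  proof -
    obtain x where x: "x \<in> S" "c = \<iota> x" using c by blast
    have fx: "f x \<in> S" "f (f x) = x" "f x \<noteq> x" using f[OF x(1)] by auto
    have "\<iota> (f x) \<noteq> \<iota> x" using fx x(1) inj_onD[OF inj] by blast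
    then show ?thesis using x fx inj by simp
  qed
  have inv: "lift \<iota> S f \<circ> lift \<iota> S f = id"
  proof
    fix c
    show "(lift \<iota> S f \<circ> lift \<iota> S f) c = id c"
      using 1[of c] lift_outside[of c \<iota> S f] by (cases "c \<in> \<iota> ` S") auto
  qed
  have "bij (lift \<iota> S f)" by (rule o_bij[OF inv inv])
  then have "lift \<iota> S f permutes \<iota> ` S" 
    using lift_outside[of _ \<iota> S f] by (simp add: permutes_def bij_iff)
  then show ?thesis using 1 by (simp add: fpf_involution_on_def)
qed

definition wmap :: "(hedge \<times> bool \<Rightarrow> 'a) \<Rightarrow> hedge list \<Rightarrow> 'a cmap" where
  "wmap \<iota> w = \<lparr>crosses = \<iota> ` sides w, alpha0 = lift \<iota> (sides w) wa0, alpha1 = lift \<iota> (sides w) (wa1 w),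
     alpha2 = lift \<iota> (sides w) wa2, isolated = 0\<rparr>"

lemma wmap_simps [simp]:
  "crosses (wmap \<iota> w) = \<iota> ` sides w" "alpha0 (wmap \<iota> w) = lift \<iota> (sides w) wa0"
  "alpha1 (wmap \<iota> w) = lift \<iota> (sides w) (wa1 w)" "alpha2 (wmap \<iota> w) = lift \<iota> (sides w) wa2"
  "isolated (wmap \<iota> w) = 0"
  by (simp_all add: wmap_def)

definition twisted :: "hedge list \<Rightarrow> bool" where
  "twisted w \<longleftrightarrow> (\<exists>h\<in>set w. tw h)"

text \<open>This is \<open>2 * k - (v - e + f)\<close> for one component and one vertex, where
  \<open>e\<close> is half the number of letters.\<close>

definition weg :: "hedge list \<Rightarrow> int" where
  "weg w = 1 + int (length w div 2) - int (nfaces w)"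

locale word_map =
  fixes \<iota> :: "hedge \<times> bool \<Rightarrow> 'a" and w :: "hedge list"
  assumes valid: "valid w" and inj: "inj_on \<iota> (sides w)"
begin

abbreviation "M \<equiv> wmap \<iota> w"

lemma dist: "distinct w" and bar_in: "h \<in> set w \<Longrightarrow> bar h \<in> set w" and nonempty: "w \<noteq> []"
  using valid by (auto simp: valid_def)

lemma is_map: "is_map M"
proof -
  note s = wa_sides[OF valid]
  have "lift \<iota> (sides w) wa0 (lift \<iota> (sides w) wa2 c) = lift \<iota> (sides w) wa2 (lift \<iota> (sides w) wa0 c)" for c
  proof (cases "c \<in> \<iota> ` sides w")
    case True
    then obtain x where "x \<in> sides w" "c = \<iota> x" by blast
    then show ?thesis using s inj by simp
  next
    case False
    then show ?thesis by (simp add: lift_outside)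
  qed
  moreover have "lift \<iota> (sides w) wa0 c \<noteq> lift \<iota> (sides w) wa2 c" if c: "c \<in> \<iota> ` sides w" for c
  proof -
    obtain x where x: "x \<in> sides w" "c = \<iota> x" using c by blast
    then show ?thesis using inj_onD[OF inj, of "wa0 x" "wa2 x"] s[OF x(1)] inj by auto
  qed
  ultimately show ?thesis
    using s fpf_involution_lift[OF inj] wa1_simps[OF dist] by (simp add: is_map_def fun_eq_iff)
qed

lemma gen_orbit_lift:
  assumes F: "F \<subseteq> {wa0, wa1 w, wa2}" and x: "x \<in> sides w"
  shows "gen_orbit (lift \<iota> (sides w) ` F) (\<iota> x) = \<iota> ` gen_orbit F x"
proof (rule gen_orbit_image[OF x])
  show "f y \<in> sides w" if "f \<in> F" "y \<in> sides w" for f y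
    using F that wa_sides[OF valid] by blast
  show "(\<lambda>g. g (\<iota> y)) ` lift \<iota> (sides w) ` F = (\<lambda>f. \<iota> (f y)) ` F" if "y \<in> sides w" for y
    using that inj by (simp add: image_image)
qed

lemma card_orbits_lift:
  assumes F: "F \<subseteq> {wa0, wa1 w, wa2}"
  shows "card (orbits_on (lift \<iota> (sides w) ` F) (\<iota> ` sides w)) = card (orbits_on F (sides w))"
proof (rule card_orbits_on_image[OF word_reversible[OF valid F] inj])
  show "(\<lambda>g. g (\<iota> y)) ` lift \<iota> (sides w) ` F = (\<lambda>f. \<iota> (f y)) ` F" if "y \<in> sides w" for y
    using that inj by (simp add: image_image)
qed

lemma incident_vertex: "x \<in> sides w \<Longrightarrow> incident_vertex M (\<iota> x) = \<iota> ` sides w"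
  using gen_orbit_lift[of "{wa1 w, wa2}" x] word_vertex[OF valid] by (simp add: incident_vertex_def)

lemma component: "x \<in> sides w \<Longrightarrow> component_of M (\<iota> x) = \<iota> ` sides w"
  using gen_orbit_lift[of "{wa0, wa1 w, wa2}" x] word_component[OF valid] by (simp add: component_of_def)

lemma edge: "h \<in> set w \<Longrightarrow> gen_orbit {alpha0 M, alpha2 M} (\<iota> (h, s)) = \<iota> ` ({h, bar h} \<times> UNIV)"
  using gen_orbit_lift[of "{wa0, wa2}" "(h, s)"] word_edge[of h s] by simp

lemma face: "x \<in> sides w \<Longrightarrow> gen_orbit {alpha0 M, alpha1 M} (\<iota> x) = \<iota> ` gen_orbit {wa0, wa1 w} x"
  using gen_orbit_lift[of "{wa0, wa1 w}" x] by simp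

lemma sides_nonempty: "sides w \<noteq> {}"
  using nonempty by simp

lemma vertices: "vertices M = {\<iota> ` sides w}"
proof -
  have "vertices M = incident_vertex M ` \<iota> ` sides w"
    by (simp add: vertices_def orbits_on_def incident_vertex_def)
  also have "\<dots> = (\<lambda>x. \<iota> ` sides w) ` sides w"
    unfolding image_image using incident_vertex by (rule image_cong[OF refl])
  finally show ?thesis using sides_nonempty by (simp add: image_constant_conv)
qed

lemma components: "components M = {\<iota> ` sides w}"
proof -
  have "components M = component_of M ` \<iota> ` sides w"
    by (simp add: components_def orbits_on_def component_of_def)
  also have "\<dots> = (\<lambda>x. \<iota> ` sides w) ` sides w"
    unfolding image_image using component by (rule image_cong[OF refl])
  finally show ?thesis using sides_nonempty by (simp add: image_constant_conv)
qed

lemma num_faces: "num_faces M = nfaces w"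
  using card_orbits_lift[of "{wa0, wa1 w}"] by (simp add: num_faces_def faces_def nfaces_def)

lemma length_num_edges: "length w = 2 * num_edges M"
proof -
  have "card (crosses M) = card (sides w)" using inj by (simp add: card_image)
  also have "\<dots> = 2 * length w" using dist by (simp add: card_cartesian_product distinct_card)
  finally show ?thesis using card_crosses_eq[OF is_map] by simp
qed

lemma euler_genus: "euler_genus M = weg w"
  using length_num_edges num_faces
  by (simp add: euler_genus_def euler_char_def num_components_def num_vertices_def vertices components weg_def)

text \<open>Without twists the flag of the side is a colouring. Conversely, one turn step around the
  vertex crosses two colour changes, so all sides with flag \<open>False\<close> have one colour;
  along a twisted edge \<open>wa0\<close> joins two of them.\<close>

lemma orientable: "orientable M \<longleftrightarrow> \<not> twisted w"
proof
  assume "\<not> twisted w"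
  then have un: "\<not> tw h" if "h \<in> set w" for h using that by (auto simp: twisted_def)
  define s where "s c = snd (inv_into (sides w) \<iota> c)" for c
  have s: "s (\<iota> x) = snd x" if "x \<in> sides w" for x using that inj by (simp add: s_def)
  have "colouring_on M (crosses M) s"
    unfolding colouring_on_def
  proof
    fix c assume "c \<in> crosses M"
    then obtain x where x: "x \<in> sides w" "c = \<iota> x" by auto
    have "snd (wa0 x) \<noteq> snd x" "snd (wa2 x) \<noteq> snd x" using un x(1) by (cases x; auto)+
    then show "s (alpha0 M c) \<noteq> s c \<and> s (alpha1 M c) \<noteq> s c \<and> s (alpha2 M c) \<noteq> s c"
      using x inj wa_sides[OF valid x(1)] by (simp add: s)
  qed
  then show "orientable M" by (auto simp: orientable_def)
next
  assume "orientable M"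
  then obtain t where t: "colouring_on M (crosses M) t" by (auto simp: orientable_def)
  define s where "s x = t (\<iota> x)" for x
  have s: "s (wa0 x) \<noteq> s x" "s (wa1 w x) \<noteq> s x" "s (wa2 x) \<noteq> s x" if x: "x \<in> sides w" for x
    using t x inj by (auto simp: colouring_on_def s_def)
  show "\<not> twisted w"
  proof
    assume "twisted w"
    then obtain h where h: "h \<in> set w" "tw h" by (auto simp: twisted_def)
    have step: "s (cycle_of_list w g, False) = s (g, False)" if g: "g \<in> set w" for g
      using s(3)[of "(g, False)"] s(2)[of "(g, True)"] g by auto
    obtain k k' where k: "k < length w" "h = w ! k" "k' < length w" "bar h = w ! k'"
      using h(1) bar_in by (metis in_set_conv_nth)
    have pow: "(cycle_of_list w ^^ m) h \<in> set w \<and> s ((cycle_of_list w ^^ m) h, False) = s (h, False)" for m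
      by (induction m) (use h step cycle_of_list_in in auto)
    have "k + (length w + k' - k) = k' + length w" using k(1) by linarith
    then have "(k + (length w + k' - k)) mod length w = k'" using k(3) by (metis mod_add_self2 mod_less)
    then have "(cycle_of_list w ^^ (length w + k' - k)) h = bar h"
      using cycle_of_list_funpow_nth[OF dist k(1), of "length w + k' - k"] k(2,4) by metis
    then have "s (bar h, False) = s (h, False)" using pow by metis
    then show False using s(1)[of "(h, False)"] h by simp
  qed
qed

lemma signed_genus:
  "signed_genus M = (if twisted w then - of_int (weg w) else of_int (weg w) / 2)"
  using signed_genus_eq[OF is_map] sides_nonempty orientable euler_genus by simp

text \<open>The rotation around the vertex is the cycle of the word on one flag and of its reverse
  on the other, so taking first returns means filtering the word. \<open>ne\<close> keeps the vertex
  from becoming isolated.\<close>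

lemma del_edges:
  assumes H: "\<Union>F = \<iota> ` (H \<times> UNIV)" "H \<subseteq> set w" and ne: "filter (\<lambda>h. h \<notin> H) w \<noteq> []"
    and barH: "\<And>h. h \<in> H \<Longrightarrow> bar h \<in> H"
  shows "del_edges M F = wmap \<iota> (filter (\<lambda>h. h \<notin> H) w)"
proof -
  let ?u = "filter (\<lambda>h. h \<notin> H) w"
  let ?D = "\<iota> ` (H \<times> UNIV)"
  have HS: "H \<times> UNIV \<subseteq> sides w" using H by auto
  have mem: "\<iota> x \<in> ?D \<longleftrightarrow> x \<in> H \<times> UNIV" if x: "x \<in> sides w" for x
    using inj_on_image_mem_iff[OF inj x HS] .
  have C: "\<iota> ` sides w - ?D = \<iota> ` sides ?u"
    using inj_on_image_set_diff[OF inj, of "sides w" "H \<times> UNIV"] HS by (auto simp: set_diff_eq[symmetric] Sigma_Diff_distrib1)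
  have us: "sides ?u \<subseteq> sides w" by auto
  have inju: "inj_on \<iota> (sides ?u)" using inj us by (rule inj_on_subset)
  have vp: "vertex_perm M (\<iota> y) = \<iota> ((wa1 w \<circ> wa2) y)" if y: "y \<in> sides w" for y
    using inj y wa_sides[OF valid y] by (simp add: vertex_perm_def)
  have fr: "first_return (vertex_perm M) ?D (alpha2 M (\<iota> x)) = \<iota> (wa1 ?u x)" if x: "x \<in> sides ?u" for x
  proof -
    obtain h s where hs: "x = (h, s)" "h \<in> set w" "h \<notin> H" using x by auto
    have y: "wa2 x \<in> sides w" using hs by simp
    have "first_return (vertex_perm M) ?D (\<iota> (wa2 x)) = \<iota> (first_return (wa1 w \<circ> wa2) (H \<times> UNIV) (wa2 x))"
      by (rule first_return_conj[of _ "sides w"]) (use y vp mem wa_sides[OF valid] in auto)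
    also have "first_return (wa1 w \<circ> wa2) (H \<times> UNIV) (wa2 x) = wa1 ?u x"
    proof (cases s)
      case True
      have "first_return (wa1 w \<circ> wa2) (H \<times> UNIV) (h, False) = (first_return (cycle_of_list w) H h, False)"
        by (rule first_return_conj[of _ UNIV]) auto
      then show ?thesis using True hs first_return_cycle[OF dist hs(2,3)] by simp
    next
      case False
      have "first_return (wa1 w \<circ> wa2) (H \<times> UNIV) (h, True) = (first_return (cycle_of_list (rev w)) H h, True)"
        by (rule first_return_conj[of _ UNIV]) auto
      moreover have "first_return (cycle_of_list (rev w)) H h = cycle_of_list (rev ?u) h"
        using first_return_cycle[of "rev w" h H] dist hs by (simp add: rev_filter)
      ultimately show ?thesis using False hs by simp
    qed
    finally show ?thesis using inj x us by auto
  qed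
  have lifts: "(\<lambda>c. if c \<in> \<iota> ` sides ?u then lift \<iota> (sides w) f c else c) = lift \<iota> (sides ?u) f" for f
  proof
    fix c
    show "(if c \<in> \<iota> ` sides ?u then lift \<iota> (sides w) f c else c) = lift \<iota> (sides ?u) f c"
    proof (cases "c \<in> \<iota> ` sides ?u")
      case True
      then obtain x where x: "x \<in> sides ?u" "c = \<iota> x" by blast
      then have "x \<in> sides w" using us by blast
      then show ?thesis using True x lift_apply[OF inj] lift_apply[OF inju] by metis
    next
      case False
      then show ?thesis using lift_outside[OF False] by metis
    qed
  qed
  have a1: "(\<lambda>c. if c \<in> \<iota> ` sides ?u then first_return (vertex_perm M) ?D (alpha2 M c) else c) = lift \<iota> (sides ?u) (wa1 ?u)"
  proof
    fix c
    show "(if c \<in> \<iota> ` sides ?u then first_return (vertex_perm M) ?D (alpha2 M c) else c) = lift \<iota> (sides ?u) (wa1 ?u) c"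
    proof (cases "c \<in> \<iota> ` sides ?u")
      case True
      then obtain x where x: "x \<in> sides ?u" "c = \<iota> x" by blast
      then show ?thesis using True fr[OF x(1)] lift_apply[OF inju x(1)] by metis
    next
      case False
      then show ?thesis using lift_outside[OF False] by metis
    qed
  qed
  have iso: "{V \<in> vertices M. V \<subseteq> ?D} = {}"
  proof -
    obtain h where h: "h \<in> set ?u" using ne by (meson last_in_set)
    then have "\<iota> (h, True) \<in> \<iota> ` sides w" "\<iota> (h, True) \<notin> ?D" using mem[of "(h, True)"] by auto
    then show ?thesis unfolding vertices by blast
  qed
  show ?thesis
    unfolding del_edges_def Let_def H(1) wmap_simps(1) C
    unfolding a1 iso unfolding wmap_simps lifts by (simp add: wmap_def)
qed

lemma no_vertex_gluing: "\<not> vertex_gluing M N"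
proof
  assume "vertex_gluing M N"
  then show False
  proof cases
    case (1 a b)
    then show False using incident_vertex by auto
  next
    case 2
    then show False by simp
  qed
qed

lemma core_if_no_duplicates:
  assumes "\<And>e f. \<not> duplicate_edges M e f"
  shows "is_core M"
proof (rule rigid_is_core[OF is_map])
  show "\<not> gluing M N" for N
    using no_vertex_gluing assms by (auto simp: gluing_def elim: duplicate_gluing.cases)
qed simp

lemma core_if_large_faces:
  assumes "\<And>x. x \<in> sides w \<Longrightarrow> card (gen_orbit {wa0, wa1 w} x) > 4"
  shows "is_core M"
proof (rule core_if_no_duplicates)
  show "\<not> duplicate_edges M e f" for e f
  proof
    assume "duplicate_edges M e f"
    then obtain A where A: "A \<in> faces M" "face_degree M A = 2" by (auto simp: duplicate_edges_def)
    then obtain x where x: "x \<in> sides w" "A = gen_orbit {alpha0 M, alpha1 M} (\<iota> x)"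
      by (auto simp: faces_def orbits_on_def)
    have "gen_orbit {wa0, wa1 w} x \<subseteq> sides w"
      by (rule gen_orbit_in[OF word_reversible[OF valid] x(1)]) blast
    then have "inj_on \<iota> (gen_orbit {wa0, wa1 w} x)" by (rule inj_on_subset[OF inj])
    then have "card A = card (gen_orbit {wa0, wa1 w} x)" unfolding x(2) face[OF x(1)] by (rule card_image)
    then show False using face_degree_two_card[OF is_map A] assms[OF x(1)] by simp
  qed
qed

text \<open>Needed besides \<open>core_if_large_faces\<close>, since one edge has only four crosses;
  this covers the projective plane with a single edge.\<close>

lemma core_if_one_edge:
  assumes "length w = 2"
  shows "is_core M"
proof (rule core_if_no_duplicates)
  have "card (edges M) = 1" using length_num_edges assms by (simp add: num_edges_def)
  then show "\<not> duplicate_edges M e f" for e f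
    by (auto simp: duplicate_edges_def card_1_singleton_iff)
qed

end

section \<open>Removing duplicate edges and reducing to one face\<close>

lemma nfaces_one_orbit:
  assumes w: "valid w" and one: "nfaces w = 1" and x: "x \<in> sides w"
  shows "gen_orbit {wa0, wa1 w} x = sides w"
proof -
  have rev: "reversible_on {wa0, wa1 w} (sides w)" by (rule word_reversible[OF w]) blast
  obtain A where A: "orbits_on {wa0, wa1 w} (sides w) = {A}"
    using one unfolding nfaces_def by (auto simp: card_1_singleton_iff)
  have eq: "gen_orbit {wa0, wa1 w} y = A" if "y \<in> sides w" for y
    using A that unfolding orbits_on_def by blast
  show ?thesis
  proof
    show "gen_orbit {wa0, wa1 w} x \<subseteq> sides w" by (rule gen_orbit_in[OF rev x])
    show "sides w \<subseteq> gen_orbit {wa0, wa1 w} x"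
    proof
      fix y assume "y \<in> sides w"
      then have "gen_orbit {wa0, wa1 w} y = gen_orbit {wa0, wa1 w} x" using eq x by metis
      then show "y \<in> gen_orbit {wa0, wa1 w} x" using gen_orbit_refl by metis
    qed
  qed
qed

lemma length_del_hedge:
  assumes w: "valid w" and l: "l \<in> set w"
  shows "length w = length (del_hedge l w) + 2"
proof -
  have "distinct w" "bar l \<in> set w" using w l by (auto simp: valid_def)
  then have "length w = card (set w)" "length (del_hedge l w) = card (set (del_hedge l w))"
    unfolding del_hedge_def by (metis distinct_card distinct_filter)+
  moreover have "set (del_hedge l w) = set w - {l, bar l}" by (auto simp: del_hedge_def)
  moreover have "card (set w - {l, bar l}) = card (set w) - card {l, bar l}"
    using l \<open>bar l \<in> set w\<close> by (simp add: card_Diff_subset)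
  moreover have "card {l, bar l} \<le> card (set w)"
    by (rule card_mono) (use l \<open>bar l \<in> set w\<close> in auto)
  moreover have "card {l, bar l} = 2" by simp
  ultimately show ?thesis by simp
qed

lemma del_hedge_invariants:
  assumes w: "valid w" and l: "l \<in> set w" and ne: "del_hedge l w \<noteq> []"
    and sides: "(l, True) \<notin> gen_orbit {wa0, wa1 w} (l, False)"
  shows "weg (del_hedge l w) = weg w" "twisted (del_hedge l w) = twisted w"
  using nfaces_del_hedge[OF assms] length_del_hedge[OF w l] twisted_del_hedge[OF w l sides]
  by (simp_all add: weg_def twisted_def)

text \<open>A duplicate edge separates two faces by \<open>duplicate_edges_sides\<close>, so gluing
  it away keeps the invariants; the other edge of the pair keeps the word nonempty.\<close>

lemma remove_duplicates:
  assumes "word_map \<iota> w"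
  shows "\<exists>u. word_map \<iota> u \<and> gluing\<^sup>*\<^sup>* (wmap \<iota> w) (wmap \<iota> u) \<and> weg u = weg w \<and> twisted u = twisted w \<and>
    is_core (wmap \<iota> u)"
  using assms
proof (induction "length w" arbitrary: w rule: less_induct)
  case less
  interpret word_map \<iota> w by (rule less.prems)
  show ?case
  proof (cases "\<exists>e f. duplicate_edges M e f")
    case False
    then have "is_core M" using core_if_no_duplicates by blast
    then show ?thesis using less.prems by blast
  next
    case True
    then obtain e f where dup: "duplicate_edges M e f" by blast
    obtain c where c: "c \<in> crosses M" "f = gen_orbit {alpha0 M, alpha2 M} c"
      "alpha2 M c \<notin> gen_orbit {alpha0 M, alpha1 M} c"
      using duplicate_edges_sides[OF is_map dup] by blast
    then obtain l s where l: "l \<in> set w" "c = \<iota> (l, s)" by auto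
    have rev: "reversible_on {wa0, wa1 w} (sides w)" by (rule word_reversible[OF valid]) blast
    have "\<iota> (wa2 (l, s)) \<notin> \<iota> ` gen_orbit {wa0, wa1 w} (l, s)"
      using c(3) l face[of "(l, s)"] inj by simp
    then have ns: "(l, \<not> s) \<notin> gen_orbit {wa0, wa1 w} (l, s)" by auto
    have sides: "(l, True) \<notin> gen_orbit {wa0, wa1 w} (l, False)"
    proof (cases s)
      case False
      then show ?thesis using ns by simp
    next
      case True
      show ?thesis
      proof
        assume a: "(l, True) \<in> gen_orbit {wa0, wa1 w} (l, False)"
        have "gen_orbit {wa0, wa1 w} (l, True) = gen_orbit {wa0, wa1 w} (l, False)"
          by (rule gen_orbit_eq[OF rev _ a]) (use l in simp)
        then show False using ns True by auto
      qed
    qed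
    let ?H = "{l, bar l}"
    have f: "f = \<iota> ` (?H \<times> UNIV)" using c(2) l edge by simp
    have "e \<in> edges M" "f \<in> edges M" "e \<noteq> f" using dup by (auto simp: duplicate_edges_def)
    have ne: "del_hedge l w \<noteq> []"
    proof
      assume "del_hedge l w = []"
      then have "length w = 2" using length_del_hedge[OF valid l(1)] by simp
      then have "card (edges M) = 1" using length_num_edges by (simp add: num_edges_def)
      then show False using \<open>e \<in> edges M\<close> \<open>f \<in> edges M\<close> \<open>e \<noteq> f\<close> by (auto simp: card_1_singleton_iff)
    qed
    let ?u = "del_hedge l w"
    have del: "del_edges M {f} = wmap \<iota> ?u"
      unfolding del_hedge_def by (rule del_edges) (use f l bar_in ne in \<open>auto simp: del_hedge_def\<close>)
    have "sides ?u \<subseteq> sides w" by (auto simp: del_hedge_def)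
    then have u: "word_map \<iota> ?u"
      using valid_del_hedge[OF valid ne] inj_on_subset[OF inj] by (simp add: word_map_def)
    have "duplicate_gluing M (wmap \<iota> ?u)"
      by (rule duplicate_gluing.intros[OF dup]) (use del map_iso_refl word_map.is_map[OF u] in simp_all)
    then have g: "gluing M (wmap \<iota> ?u)" by (simp add: gluing_def)
    have "length ?u < length w" using length_del_hedge[OF valid l(1)] by simp
    then obtain v where v: "word_map \<iota> v" "gluing\<^sup>*\<^sup>* (wmap \<iota> ?u) (wmap \<iota> v)" "weg v = weg ?u"
      "twisted v = twisted ?u" "is_core (wmap \<iota> v)"
      using less.hyps[OF _ u] by blast
    have "gluing\<^sup>*\<^sup>* M (wmap \<iota> v)" using g v(2) by (rule converse_rtranclp_into_rtranclp)
    then show ?thesis using v del_hedge_invariants[OF valid l(1) ne sides] by auto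
  qed
qed

text \<open>If every edge had the same face on both sides, faces would be closed under
  \<open>wa2\<close> and so be the whole connected set. Hence with several faces some edge separates
  two of them and can be deleted. It is never the last edge: one edge between two faces has Euler
  genus \<open>1 + 1 - 2 = 0\<close>. \<open>H\<close> collects the deleted half-edges.\<close>

lemma one_face_subword:
  assumes "valid w" "weg w \<noteq> 0"
  shows "\<exists>H. H \<subseteq> set w \<and> (\<forall>h\<in>H. bar h \<in> H) \<and> valid (filter (\<lambda>h. h \<notin> H) w) \<and>
    nfaces (filter (\<lambda>h. h \<notin> H) w) = 1 \<and> weg (filter (\<lambda>h. h \<notin> H) w) = weg w \<and>
    twisted (filter (\<lambda>h. h \<notin> H) w) = twisted w"
  using assms
proof (induction "length w" arbitrary: w rule: less_induct)
  case less
  note w = less.prems(1)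
  have rev: "reversible_on {wa0, wa1 w} (sides w)" by (rule word_reversible[OF w]) blast
  have revA: "reversible_on {wa0, wa1 w, wa2} (sides w)" by (rule word_reversible[OF w]) blast
  let ?O = "gen_orbit {wa0, wa1 w}"
  have bar: "bar h \<in> set w" if "h \<in> set w" for h using w that by (simp add: valid_def)
  show ?case
  proof (cases "nfaces w = 1")
    case True
    then show ?thesis using w by (intro exI[of _ "{}"]) simp
  next
    case False
    have "\<exists>l\<in>set w. (l, True) \<notin> ?O (l, False)"
    proof (rule ccontr)
      assume "\<not> (\<exists>l\<in>set w. (l, True) \<notin> ?O (l, False))"
      then have all: "(l, True) \<in> ?O (l, False)" if "l \<in> set w" for l using that by blast
      have eq: "?O (l, True) = ?O (l, False)" if "l \<in> set w" for l
        by (rule gen_orbit_eq[OF rev _ all[OF that]]) (use that in simp)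
      have orb: "?O x = sides w" if x: "x \<in> sides w" for x
      proof
        show "?O x \<subseteq> sides w" by (rule gen_orbit_in[OF rev x])
        have "gen_orbit {wa0, wa1 w, wa2} x \<subseteq> {y \<in> sides w. ?O y = ?O x}"
        proof (rule gen_orbit_least)
          fix y f assume y: "y \<in> {y \<in> sides w. ?O y = ?O x}" and f: "f \<in> {wa0, wa1 w, wa2}"
          then have ys: "y \<in> sides w" by simp
          have "f y \<in> sides w" using revA f ys unfolding reversible_on_def by blast
          moreover have "?O (f y) = ?O y"
          proof (cases "f = wa2")
            case True
            obtain l s where l: "y = (l, s)" "l \<in> set w" using ys by auto
            then show ?thesis using True eq[OF l(2)] by (cases s) simp_all
          next
            case False
            then have "f \<in> {wa0, wa1 w}" using f by blast
            then show ?thesis by (rule gen_orbit_step_eq[OF rev ys])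
          qed
          ultimately show "f y \<in> {y \<in> sides w. ?O y = ?O x}" using y by simp
        qed (use x in simp)
        then have sub: "sides w \<subseteq> {y \<in> sides w. ?O y = ?O x}" unfolding word_component[OF w x] .
        show "sides w \<subseteq> ?O x"
        proof
          fix y assume "y \<in> sides w"
          then have "?O y = ?O x" using sub by blast
          then show "y \<in> ?O x" using gen_orbit_refl by metis
        qed
      qed
      have "orbits_on {wa0, wa1 w} (sides w) = (\<lambda>x. sides w) ` sides w"
        unfolding orbits_on_def using orb by (rule image_cong[OF refl])
      also have "\<dots> = {sides w}" using w by (simp add: valid_def image_constant_conv)
      finally show False using False by (simp add: nfaces_def)
    qed
    then obtain l where l: "l \<in> set w" and sides: "(l, True) \<notin> ?O (l, False)" by blast
    have ne: "del_hedge l w \<noteq> []"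
    proof
      assume "del_hedge l w = []"
      then have "length w = 2" using length_del_hedge[OF w l] by simp
      have ws: "sides w = {l, bar l} \<times> UNIV"
        using \<open>del_hedge l w = []\<close> l bar[OF l] by (auto simp: del_hedge_def filter_empty_conv)
      have "?O x \<in> {?O (l, True), ?O (l, False)}" if x: "x \<in> sides w" for x
      proof -
        have z: "?O (wa0 (l, t)) = ?O (l, t)" for t
          by (rule gen_orbit_step_eq[OF rev]) (use l in auto)
        obtain h s where hs: "x = (h, s)" "h = l \<or> h = bar l" using x ws by auto
        show ?thesis
        proof (cases "h = l")
          case True
          then show ?thesis using hs by (cases s) simp_all
        next
          case False
          then have "x = wa0 (l, s = tw l)" using hs by auto
          then show ?thesis using z[of "s = tw l"] by (cases "s = tw l") simp_all
        qed
      qed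
      then have sub: "orbits_on {wa0, wa1 w} (sides w) \<subseteq> {?O (l, True), ?O (l, False)}"
        unfolding orbits_on_def by blast
      have "nfaces w \<le> card {?O (l, True), ?O (l, False)}"
        unfolding nfaces_def by (rule card_mono[OF _ sub]) simp
      then have "nfaces w \<le> 2" by (auto simp: card_insert_if split: if_splits)
      moreover have "nfaces w \<noteq> 0"
      proof -
        have "orbits_on {wa0, wa1 w} (sides w) \<noteq> {}" using l by (auto simp: orbits_on_def)
        then show ?thesis unfolding nfaces_def by (simp add: orbits_on_def)
      qed
      ultimately have "nfaces w = 2" using False by simp
      then show False using less.prems(2) \<open>length w = 2\<close> by (simp add: weg_def)
    qed
    let ?u = "del_hedge l w"
    note inv = del_hedge_invariants[OF w l ne sides]
    have "length ?u < length w" using length_del_hedge[OF w l] by simp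
    then obtain H where H: "H \<subseteq> set ?u" "\<forall>h\<in>H. bar h \<in> H" "valid (filter (\<lambda>h. h \<notin> H) ?u)"
      "nfaces (filter (\<lambda>h. h \<notin> H) ?u) = 1" "weg (filter (\<lambda>h. h \<notin> H) ?u) = weg ?u"
      "twisted (filter (\<lambda>h. h \<notin> H) ?u) = twisted ?u"
      using less.hyps[of ?u] valid_del_hedge[OF w ne] inv less.prems(2) by auto
    have f: "filter (\<lambda>h. h \<notin> H) ?u = filter (\<lambda>h. h \<notin> H \<union> {l, bar l}) w"
      unfolding del_hedge_def filter_filter by (rule filter_cong) auto
    show ?thesis
      by (rule exI[of _ "H \<union> {l, bar l}"])
        (use H inv l bar[OF l] in \<open>auto simp: f[symmetric] del_hedge_def\<close>)
  qed
qed

section \<open>Every map with one vertex comes from a word\<close>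

lemma vertex_orbits_disjoint:
  assumes M: "is_map M" and y: "y \<in> crosses M"
  shows "alpha2 M y \<notin> gen_orbit {vertex_perm M} y"
proof -
  note a = is_map_alpha[OF M]
  let ?t = "vertex_perm M"
  have tC: "?t z \<in> crosses M" if "z \<in> crosses M" for z using that a by (simp add: vertex_perm_def)
  have inj: "z = z'" if "?t z = ?t z'" "z \<in> crosses M" "z' \<in> crosses M" for z z'
    using that a unfolding vertex_perm_def by (metis o_apply)
  have pC: "(?t ^^ k) z \<in> crosses M" if "z \<in> crosses M" for z k
    by (induction k) (use that tC in auto)
  \<comment> \<open>Since \<open>alpha2\<close> conjugates \<open>?t\<close> to its inverse,
    \<open>(?t ^^ (m + 2)) y = alpha2 M y\<close> implies
    \<open>(?t ^^ m) (?t y) = alpha2 M (?t y)\<close>. Peeling off two steps at a time ends at a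
    fixed point of \<open>alpha2\<close> or of \<open>alpha1\<close>.\<close>
  have ne: "(?t ^^ k) y \<noteq> alpha2 M y" for k
    using y
  proof (induction k arbitrary: y rule: less_induct)
    case (less k)
    note i = a[OF less.prems]
    consider "k = 0" | "k = 1" | m where "k = Suc (Suc m)" by (metis One_nat_def not0_implies_Suc)
    then show ?case
    proof cases
      case 1
      then show ?thesis using i by simp
    next
      case 2
      then show ?thesis using a(8)[OF i(3)] by (simp add: vertex_perm_def)
    next
      case 3
      let ?z = "?t y"
      have z: "?z \<in> crosses M" using tC less.prems .
      show ?thesis
      proof
        assume "(?t ^^ k) y = alpha2 M y"
        then have "?t ((?t ^^ m) ?z) = alpha2 M y" using 3 by (simp add: funpow_swap1)
        moreover have "?t (alpha2 M ?z) = alpha2 M y"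
          using a(6)[OF z] a(5)[OF i(3)] by (simp add: vertex_perm_def)
        ultimately have "(?t ^^ m) ?z = alpha2 M ?z"
          using inj[OF _ pC[OF z] a(3)[OF z]] by metis
        then show False using less.IH[of m ?z] z 3 by simp
      qed
    qed
  qed
  have sub: "gen_orbit {?t} y \<subseteq> range (\<lambda>k. (?t ^^ k) y)"
  proof (rule gen_orbit_least)
    show "y \<in> range (\<lambda>k. (?t ^^ k) y)" by (rule range_eqI[of _ _ 0]) simp
    fix x f assume "x \<in> range (\<lambda>k. (?t ^^ k) y)" and f: "f \<in> {?t}"
    then obtain k where "x = (?t ^^ k) y" by blast
    then have "f x = (?t ^^ Suc k) y" using f by simp
    then show "f x \<in> range (\<lambda>k. (?t ^^ k) y)" by blast
  qed
  show ?thesis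
  proof
    assume "alpha2 M y \<in> gen_orbit {?t} y"
    then have "alpha2 M y \<in> range (\<lambda>k. (?t ^^ k) y)" using sub by (rule rev_subsetD)
    then obtain k where "alpha2 M y = (?t ^^ k) y" by (rule rangeE)
    then show False using ne[of k] by simp
  qed
qed

text \<open>The vertex consists of two disjoint cycles of the vertex permutation that
  \<open>alpha2\<close> exchanges. One of them, \<open>Q\<close>, serves as the set of half-edges:
  \<open>c\<close> in \<open>Q\<close> is the side \<open>False\<close>, and
  \<open>alpha2 M c\<close> the side \<open>True\<close>.\<close>

lemma one_vertex_is_word_map:
  assumes M: "is_map M" "isolated M = 0" "card (vertices M) = 1"
  shows "\<exists>(\<iota> :: hedge \<times> bool \<Rightarrow> 'a) w. word_map \<iota> w \<and> (M :: 'a cmap) = wmap \<iota> w"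
proof -
  note a = is_map_alpha[OF M(1)]
  let ?t = "vertex_perm M" and ?C = "crosses M"
  obtain V where V: "vertices M = {V}" using M(3) by (auto simp: card_1_singleton_iff)
  then have "V \<in> vertices M" by simp
  then obtain c0 where c0: "c0 \<in> ?C" by (auto simp: vertices_def orbits_on_def)
  have one: "gen_orbit {alpha1 M, alpha2 M} c0 = ?C"
  proof -
    have rev: "reversible_on {alpha1 M, alpha2 M} ?C" using is_map_reversible[OF M(1)] by simp
    have eq: "gen_orbit {alpha1 M, alpha2 M} c = V" if "c \<in> ?C" for c
      using V that unfolding vertices_def orbits_on_def by blast
    have "?C \<subseteq> gen_orbit {alpha1 M, alpha2 M} c0"
      using eq c0 gen_orbit_refl by (metis subsetI)
    then show ?thesis using gen_orbit_in[OF rev c0] by blast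
  qed
  have tperm: "?t permutes ?C"
    unfolding vertex_perm_def by (intro permutes_compose is_map_permutes[OF M(1)]) auto
  have perm: "permutation ?t" using tperm is_map_finite[OF M(1)] by (rule permutes_imp_permutation[rotated])
  have tinv: "?t (alpha2 M (alpha1 M c)) = c" "alpha2 M (alpha1 M (?t c)) = c" if "c \<in> ?C" for c
    using a[OF that] a(6)[OF a(2)[OF that]] a(5)[OF a(3)[OF that]] by (simp_all add: vertex_perm_def)
  have rev: "reversible_on {?t} ?C"
    by (rule reversible_on_permutations) (use tperm is_map_finite[OF M(1)] in auto)
  define Q where "Q = gen_orbit {?t} c0"
  have QC: "Q \<subseteq> ?C" unfolding Q_def by (rule gen_orbit_in[OF rev c0])
  have c0Q: "c0 \<in> Q" by (simp add: Q_def)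
  have Qt: "?t c \<in> Q" if "c \<in> Q" for c
    using that unfolding Q_def by (rule gen_orbit_step) simp
  have Qinv: "alpha2 M (alpha1 M c) \<in> Q" if c: "c \<in> Q" for c
  proof -
    have cC: "c \<in> ?C" using c QC by blast
    let ?d = "alpha2 M (alpha1 M c)"
    have d: "?d \<in> ?C" using a cC by simp
    have "gen_orbit {?t} (?t ?d) = gen_orbit {?t} ?d" by (rule gen_orbit_step_eq[OF rev d]) simp
    then have "gen_orbit {?t} ?d = gen_orbit {?t} c" using tinv(1)[OF cC] by simp
    also have "\<dots> = Q" unfolding Q_def by (rule gen_orbit_eq[OF rev c0]) (use c in \<open>simp add: Q_def\<close>)
    finally show ?thesis using gen_orbit_refl by metis
  qed
  have dis: "alpha2 M c \<notin> Q" if c: "c \<in> Q" for c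
  proof -
    have cC: "c \<in> ?C" using c QC by blast
    have "gen_orbit {?t} c = Q" unfolding Q_def by (rule gen_orbit_eq[OF rev c0]) (use c in \<open>simp add: Q_def\<close>)
    then show ?thesis using vertex_orbits_disjoint[OF M(1) cC] by simp
  qed
  have cover: "c \<in> Q \<or> alpha2 M c \<in> Q" if "c \<in> ?C" for c
  proof -
    have "gen_orbit {alpha1 M, alpha2 M} c0 \<subseteq> {c \<in> ?C. c \<in> Q \<or> alpha2 M c \<in> Q}"
    proof (rule gen_orbit_least)
      fix x f assume x: "x \<in> {c \<in> ?C. c \<in> Q \<or> alpha2 M c \<in> Q}" and f: "f \<in> {alpha1 M, alpha2 M}"
      then have xC: "x \<in> ?C" by simp
      show "f x \<in> {c \<in> ?C. c \<in> Q \<or> alpha2 M c \<in> Q}"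
      proof (cases "f = alpha2 M")
        case True
        then show ?thesis using x a[OF xC] by auto
      next
        case False
        then have f1: "f = alpha1 M" using f by blast
        show ?thesis
        proof (cases "x \<in> Q")
          case True
          then show ?thesis using Qinv[OF True] a(2)[OF xC] f1 by simp
        next
          case False
          then have "alpha2 M x \<in> Q" using x by simp
          then have "?t (alpha2 M x) \<in> Q" by (rule Qt)
          then show ?thesis using a[OF xC] f1 by (simp add: vertex_perm_def)
        qed
      qed
    qed (use c0 c0Q in simp)
    then show ?thesis using that unfolding one by blast
  qed
  define xs where "xs = support ?t c0"
  have dxs: "distinct xs" unfolding xs_def by (rule cycle_of_permutation[OF perm])
  have sxs: "set xs = Q"
  proof
    have s: "set xs = range (\<lambda>i. (?t ^^ i) c0)" unfolding xs_def by (rule support_set[OF perm])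
    show "set xs \<subseteq> Q" unfolding s Q_def by (auto intro: gen_orbit_funpow)
    have "gen_orbit {?t} c0 \<subseteq> range (\<lambda>k. (?t ^^ k) c0)"
    proof (rule gen_orbit_least)
      show "c0 \<in> range (\<lambda>k. (?t ^^ k) c0)" by (rule range_eqI[of _ _ 0]) simp
      fix x f assume "x \<in> range (\<lambda>k. (?t ^^ k) c0)" and f: "f \<in> {?t}"
      then obtain k where "x = (?t ^^ k) c0" by blast
      then have "f x = (?t ^^ Suc k) c0" using f by simp
      then show "f x \<in> range (\<lambda>k. (?t ^^ k) c0)" by blast
    qed
    then show "Q \<subseteq> set xs" unfolding s Q_def .
  qed
  have cyc: "cycle_of_list xs c = ?t c" if "c \<in> Q" for c
    using cycle_restrict[OF perm, of c c0] that sxs unfolding xs_def by simp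
  have finQ: "finite Q" using QC is_map_finite[OF M(1)] finite_subset by blast
  obtain i :: "'a \<Rightarrow> nat" where i: "inj_on i Q" using finite_imp_inj_to_nat_seg[OF finQ] by blast
  \<comment> \<open>\<open>pr c\<close> is the other end of the edge of \<open>c\<close>,
    represented in \<open>Q\<close>. Since \<open>wa0\<close> keeps the flag just along twisted
    edges, the edge counts as twisted when \<open>alpha0 M c\<close> is in \<open>Q\<close>.\<close>
  define pr where "pr c = (if alpha0 M c \<in> Q then alpha0 M c else alpha2 M (alpha0 M c))" for c
  have pr: "pr c \<in> Q" "pr (pr c) = c" "pr c \<noteq> c" "alpha0 M (pr c) \<in> Q \<longleftrightarrow> alpha0 M c \<in> Q" if c: "c \<in> Q" for c
  proof -
    have cC: "c \<in> ?C" using c QC by blast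
    note b = a[OF cC] and b0 = a[OF a(1)[OF cC]]
    show Q: "pr c \<in> Q" using cover[OF b(1)] by (auto simp: pr_def)
    have e: "alpha0 M (alpha2 M (alpha0 M c)) = alpha2 M c"
      using b by (simp add: is_map_commute[OF M(1)])
    show "pr (pr c) = c" using e dis[OF c] b c by (auto simp: pr_def)
    have "alpha0 M c \<noteq> alpha2 M c" using M(1) cC by (simp add: is_map_def)
    then have "alpha2 M (alpha0 M c) \<noteq> c" using b0(6) by metis
    then show "pr c \<noteq> c" using b(7) by (simp add: pr_def)
    show "alpha0 M (pr c) \<in> Q \<longleftrightarrow> alpha0 M c \<in> Q" using e dis[OF c] b c by (auto simp: pr_def)
  qed
  \<comment> \<open>Names of edges are natural numbers, so \<open>Q\<close> is numbered by
    \<open>i\<close>. An edge is named after the smaller of the numbers of its ends, and the end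
    flag tells whether \<open>c\<close> is the end with that number.\<close>
  define \<nu> where "\<nu> c = Hedge (min (i c) (i (pr c))) (alpha0 M c \<in> Q) (i c < i (pr c))" for c
  have tw\<nu>: "tw (\<nu> c) \<longleftrightarrow> alpha0 M c \<in> Q" for c by (simp add: \<nu>_def)
  have ipr: "i (pr c) \<noteq> i c" if "c \<in> Q" for c using inj_onD[OF i] pr[OF that] that by metis
  have bar\<nu>: "bar (\<nu> c) = \<nu> (pr c)" if c: "c \<in> Q" for c
    using pr[OF c] ipr[OF c] by (auto simp: \<nu>_def bar_def min.commute)
  have inj\<nu>: "inj_on \<nu> Q"
  proof (rule inj_onI)
    fix c d assume cd: "c \<in> Q" "d \<in> Q" "\<nu> c = \<nu> d"
    then have mins: "min (i c) (i (pr c)) = min (i d) (i (pr d))" and ord: "(i c < i (pr c)) = (i d < i (pr d))"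
      by (auto simp: \<nu>_def)
    show "c = d"
    proof (cases "i c < i (pr c)")
      case True
      then have "i c = i d" using mins ord by simp
      then show ?thesis using inj_onD[OF i] cd by blast
    next
      case False
      then have "i (pr c) = i (pr d)" using mins ord by simp
      then have "pr c = pr d" using inj_onD[OF i] pr(1) cd by blast
      then show ?thesis using pr(2) cd by metis
    qed
  qed
  define w where "w = map \<nu> xs"
  have sw: "set w = \<nu> ` Q" by (simp add: w_def sxs)
  have dw: "distinct w" using dxs inj\<nu> by (simp add: w_def distinct_map sxs)
  have valid: "valid w" unfolding valid_def
    using dw sw bar\<nu> pr(1) c0Q by auto
  define \<iota> where "\<iota> x = (let c = inv_into Q \<nu> (fst x) in if snd x then alpha2 M c else c)" for x
  have \<iota>: "\<iota> (\<nu> c, True) = alpha2 M c" "\<iota> (\<nu> c, False) = c" if "c \<in> Q" for c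
    using inj\<nu> that by (simp_all add: \<iota>_def)
  have inj: "inj_on \<iota> (sides w)"
  proof (rule inj_onI)
    fix x y assume xy: "x \<in> sides w" "y \<in> sides w" "\<iota> x = \<iota> y"
    obtain c s where c: "c \<in> Q" "x = (\<nu> c, s)" using xy(1) sw by auto
    obtain d r where d: "d \<in> Q" "y = (\<nu> d, r)" using xy(2) sw by auto
    have CC: "c \<in> ?C" "d \<in> ?C" using c d QC by auto
    have "c = d \<and> s = r"
    proof (cases s; cases r)
      assume "s" "r"
      then have "alpha2 M c = alpha2 M d" using xy(3) c d \<iota> by simp
      then show ?thesis using a(6)[OF CC(1)] a(6)[OF CC(2)] \<open>s\<close> \<open>r\<close> by metis
    next
      assume "s" "\<not> r"
      then have "alpha2 M c = d" using xy(3) c d \<iota> by simp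
      then show ?thesis using dis[OF c(1)] d(1) by simp
    next
      assume "\<not> s" "r"
      then have "alpha2 M d = c" using xy(3) c d \<iota> by simp
      then show ?thesis using dis[OF d(1)] c(1) by simp
    next
      assume "\<not> s" "\<not> r"
      then show ?thesis using xy(3) c d \<iota> by simp
    qed
    then show "x = y" using c d by simp
  qed
  have C: "?C = \<iota> ` sides w"
  proof
    show "\<iota> ` sides w \<subseteq> ?C"
    proof
      fix z assume "z \<in> \<iota> ` sides w"
      then obtain c s where "c \<in> Q" "z = \<iota> (\<nu> c, s)" using sw by auto
      then show "z \<in> ?C" using \<iota> QC a by (cases s) auto
    qed
    show "?C \<subseteq> \<iota> ` sides w"
    proof
      fix z assume z: "z \<in> ?C"
      show "z \<in> \<iota> ` sides w"
      proof (cases "z \<in> Q")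
        case True
        then have "z = \<iota> (\<nu> z, False)" "(\<nu> z, False) \<in> sides w" using \<iota> sw by auto
        then show ?thesis by blast
      next
        case False
        then have q: "alpha2 M z \<in> Q" using cover[OF z] by blast
        then have "z = \<iota> (\<nu> (alpha2 M z), True)" "(\<nu> (alpha2 M z), True) \<in> sides w"
          using \<iota>(1)[OF q] sw a(6)[OF z] by auto
        then show ?thesis by blast
      qed
    qed
  qed
  have lifts: "f = lift \<iota> (sides w) g"
    if f: "f \<in> {alpha0 M, alpha1 M, alpha2 M}" and eq: "\<And>c s. c \<in> Q \<Longrightarrow> f (\<iota> (\<nu> c, s)) = \<iota> (g (\<nu> c, s))" for f g
  proof
    fix z
    show "f z = lift \<iota> (sides w) g z"
    proof (cases "z \<in> \<iota> ` sides w")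
      case True
      then obtain c s where c: "c \<in> Q" "z = \<iota> (\<nu> c, s)" using sw by auto
      then have "(\<nu> c, s) \<in> sides w" using sw by simp
      then show ?thesis using eq[OF c(1)] c(2) lift_apply[OF inj] by metis
    next
      case False
      then have "f z = z" using permutes_not_in[OF is_map_permutes[OF M(1) f]] C by blast
      then show ?thesis using lift_outside[OF False] by metis
    qed
  qed
  have m0: "alpha0 M (\<iota> (\<nu> c, s)) = \<iota> (wa0 (\<nu> c, s))" if c: "c \<in> Q" for c s
  proof -
    have cC: "c \<in> ?C" using c QC by blast
    note b = a[OF cC] and b0 = a[OF a(1)[OF cC]]
    show ?thesis
      using b b0 \<iota>[OF c] \<iota>[OF pr(1)[OF c]]
      by (cases s; cases "alpha0 M c \<in> Q")
        (simp_all add: bar\<nu>[OF c] tw\<nu> pr_def is_map_commute[OF M(1)])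
  qed
  have m2: "alpha2 M (\<iota> (\<nu> c, s)) = \<iota> (wa2 (\<nu> c, s))" if c: "c \<in> Q" for c s
    using \<iota>[OF c] a(6)[of c] c QC by (cases s) auto
  have m1: "alpha1 M (\<iota> (\<nu> c, s)) = \<iota> (wa1 w (\<nu> c, s))" if c: "c \<in> Q" for c s
  proof (cases s)
    case True
    have "cycle_of_list w (\<nu> c) = \<nu> (?t c)"
      unfolding w_def using cycle_of_list_map[OF dxs, of \<nu> c] inj\<nu> c sxs cyc[OF c] by simp
    then show ?thesis using True \<iota>[OF c] \<iota>[OF Qt[OF c]] by (simp add: vertex_perm_def)
  next
    case False
    let ?d = "alpha2 M (alpha1 M c)"
    have cC: "c \<in> ?C" using c QC by blast
    have d: "?d \<in> Q" by (rule Qinv[OF c])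
    have "cycle_of_list w (\<nu> ?d) = \<nu> (?t ?d)"
      unfolding w_def using cycle_of_list_map[OF dxs, of \<nu> ?d] inj\<nu> d sxs cyc[OF d] by simp
    then have "cycle_of_list w (\<nu> ?d) = \<nu> c" using tinv(1)[OF cC] by simp
    then have "cycle_of_list (rev w) (\<nu> c) = \<nu> ?d" using cycle_of_list_rev[OF dw] by metis
    then show ?thesis using False \<iota>[OF c] \<iota>(1)[OF d] a(6)[OF a(2)[OF cC]] by simp
  qed
  have "M = wmap \<iota> w"
    unfolding wmap_def using C M(2) lifts[of "alpha0 M", OF _ m0] lifts[of "alpha1 M", OF _ m1] lifts[of "alpha2 M", OF _ m2]
    by (intro cmap.equality) simp_all
  then show ?thesis using valid inj by (auto simp: word_map_def)
qed

section \<open>Sliding one edge over another\<close>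

lemma hom_exists_submap:
  assumes "is_map N" "is_map M" "signed_genus N = signed_genus M" "submap N M"
  shows "hom_exists N M"
  unfolding hom_exists_def using assms map_iso_refl by blast

lemma hom_exists_iso:
  assumes "is_map N" "is_map M" "signed_genus N = signed_genus M" "map_iso N M"
  shows "hom_exists N M"
  unfolding hom_exists_def using assms submap_refl by blast

definition linked :: "int \<Rightarrow> ('a cmap \<times> 'a cmap) set" where
  "linked g = {(M, N). M \<in> cores g \<and> N \<in> cores g \<and> (hom_exists M N \<or> hom_exists N M)}\<^sup>*"

lemma linkedI:
  "M \<in> cores g \<Longrightarrow> N \<in> cores g \<Longrightarrow> hom_exists M N \<or> hom_exists N M \<Longrightarrow> (M, N) \<in> linked g"
  by (auto simp: linked_def)

lemma linked_trans: "(M, N) \<in> linked g \<Longrightarrow> (N, P) \<in> linked g \<Longrightarrow> (M, P) \<in> linked g"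
  unfolding linked_def by (rule rtrancl_trans)

lemma linked_refl: "(M, M) \<in> linked g"
  by (simp add: linked_def)

lemma linked_sym: "(M, N) \<in> linked g \<Longrightarrow> (N, M) \<in> linked g"
proof -
  have "sym ({(M, N). M \<in> cores g \<and> N \<in> cores g \<and> (hom_exists M N \<or> hom_exists N M)} :: ('a cmap \<times> 'a cmap) set)"
    by (auto simp: sym_def)
  then show "(M, N) \<in> linked g \<Longrightarrow> (N, M) \<in> linked g"
    unfolding linked_def by (meson symD sym_rtrancl)
qed

lemma wa1_adjacent:
  assumes "distinct (A @ h # k # B)"
  shows "wa1 (A @ h # k # B) (h, True) = (k, False)" "wa1 (A @ h # k # B) (k, False) = (h, True)"
proof -
  show "wa1 (A @ h # k # B) (h, True) = (k, False)" using cycle_of_list_adjacent[OF assms] by simp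
  then show "wa1 (A @ h # k # B) (k, False) = (h, True)" using wa1_simps(1)[OF assms] by metis
qed

context word_map begin

lemma word_map_sub: "valid v \<Longrightarrow> set v \<subseteq> set w \<Longrightarrow> word_map \<iota> v"
  using inj inj_on_subset[of \<iota> "sides w" "sides v"] by (auto simp: word_map_def)

lemma submap_filter:
  assumes H: "H \<subseteq> set w" "\<And>h. h \<in> H \<Longrightarrow> bar h \<in> H" and ne: "filter (\<lambda>h. h \<notin> H) w \<noteq> []"
  shows "submap (wmap \<iota> (filter (\<lambda>h. h \<notin> H) w)) M"
proof -
  let ?F = "(\<lambda>h. gen_orbit {alpha0 M, alpha2 M} (\<iota> (h, True))) ` H"
  have "?F \<subseteq> edges M" using H by (auto simp: edges_def orbits_on_def)
  moreover have "\<Union>?F = \<iota> ` (H \<times> UNIV)"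
  proof -
    have "gen_orbit {alpha0 M, alpha2 M} (\<iota> (h, True)) = \<iota> ` ({h, bar h} \<times> UNIV)" if "h \<in> H" for h
      by (rule edge) (use that H in blast)
    then have "\<Union>?F = (\<Union>h\<in>H. \<iota> ` ({h, bar h} \<times> UNIV))" by (metis (no_types, lifting) SUP_cong)
    also have "\<dots> = \<iota> ` (\<Union>h\<in>H. {h, bar h} \<times> UNIV)" by (simp only: image_UN)
    also have "(\<Union>h\<in>H. {h, bar h} \<times> UNIV) = H \<times> (UNIV :: bool set)" using H(2) by auto
    finally show ?thesis .
  qed
  ultimately have "del_edges M ?F = wmap \<iota> (filter (\<lambda>h. h \<notin> H) w)"
    using del_edges[OF _ H(1) ne H(2)] by blast
  then show ?thesis unfolding submap_def using \<open>?F \<subseteq> edges M\<close> by (metis rtranclp.rtrancl_refl)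
qed

text \<open>The single face contains all crosses, at least eight if there are two edges, and a face
  of degree two has at most four.\<close>

lemma core_if_one_face:
  assumes "nfaces w = 1"
  shows "is_core M"
proof (cases "length w = 2")
  case True
  then show ?thesis by (rule core_if_one_edge)
next
  case False
  have "length w \<noteq> 0" using nonempty by simp
  then have "length w \<ge> 4" using False length_num_edges by presburger
  moreover have "card (sides w) = 2 * length w" using dist by (simp add: card_cartesian_product distinct_card)
  ultimately show ?thesis
    using nfaces_one_orbit[OF valid assms] by (intro core_if_large_faces) simp
qed

end

text \<open>Reading the word backwards only exchanges the names of the sides: \<open>wa2\<close>
  conjugates \<open>wa1 w\<close> to \<open>wa1 (rev w)\<close> and commutes with
  \<open>wa0\<close>.\<close>

lemma rev_invariants:
  assumes "valid w"
  shows "valid (rev w)" "nfaces (rev w) = nfaces w" "weg (rev w) = weg w" "twisted (rev w) = twisted w"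
proof -
  show "valid (rev w)" using assms by (simp add: valid_def)
  have im: "wa2 ` sides w = sides w" by force
  have "card (orbits_on {wa0, wa1 (rev w)} (wa2 ` sides w)) = card (orbits_on {wa0, wa1 w} (sides w))"
  proof (rule card_orbits_on_image)
    show "reversible_on {wa0, wa1 w} (sides w)" by (rule word_reversible[OF assms]) blast
    show "inj_on wa2 (sides w)" by (rule inj_onI) (metis wa2_simps(1))
    show "(\<lambda>g. g (wa2 x)) ` {wa0, wa1 (rev w)} = (\<lambda>f. wa2 (f x)) ` {wa0, wa1 w}" for x
      by (cases x) auto
  qed
  then show "nfaces (rev w) = nfaces w" unfolding im by (simp add: nfaces_def)
  then show "weg (rev w) = weg w" "twisted (rev w) = twisted w" by (simp_all add: weg_def twisted_def)
qed

lemma wmap_rev_iso: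
  assumes "word_map \<iota> w"
  shows "map_iso (wmap \<iota> w) (wmap \<iota> (rev w))"
proof -
  interpret word_map \<iota> w by fact
  let ?h = "lift \<iota> (sides w) wa2"
  have inv: "wa2 x \<in> sides w" "wa0 x \<in> sides w" "wa1 w x \<in> sides w" if "x \<in> sides w" for x
    using wa_sides[OF valid that] by auto
  have conj: "wa1 (rev w) (wa2 x) = wa2 (wa1 w x)" for x by (cases x) auto
  have fp: "fpf_involution_on (\<iota> ` sides w) ?h" using inv by (intro fpf_involution_lift[OF inj]) auto
  have "bij_betw ?h (crosses M) (crosses (wmap \<iota> (rev w)))"
    using fp by (auto simp: fpf_involution_on_def permutes_imp_bij)
  moreover have "?h (alpha0 M c) = alpha0 (wmap \<iota> (rev w)) (?h c) \<and> ?h (alpha1 M c) = alpha1 (wmap \<iota> (rev w)) (?h c) \<and>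
    ?h (alpha2 M c) = alpha2 (wmap \<iota> (rev w)) (?h c)" if "c \<in> crosses M" for c
  proof -
    obtain x where x: "x \<in> sides w" "c = \<iota> x" using \<open>c \<in> crosses M\<close> by auto
    show ?thesis using inv[OF x(1)] inv(1)[OF inv(1)[OF x(1)]] x inj conj[of x] by simp
  qed
  ultimately show ?thesis unfolding map_iso_def by auto
qed

lemma side_faces_distinct:
  assumes w: "valid w" and y: "y \<in> sides w"
    and "(l, s) \<in> gen_orbit {wa0, wa1 w} y" "(l, \<not> s) \<notin> gen_orbit {wa0, wa1 w} y"
  shows "(l, True) \<notin> gen_orbit {wa0, wa1 w} (l, False)"
proof
  assume a: "(l, True) \<in> gen_orbit {wa0, wa1 w} (l, False)"
  have rev: "reversible_on {wa0, wa1 w} (sides w)" by (rule word_reversible[OF w]) blast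
  have ls: "(l, s) \<in> sides w" using assms(3) gen_orbit_in[OF rev y] by blast
  then have "(l, False) \<in> sides w" by simp
  then have "gen_orbit {wa0, wa1 w} (l, True) = gen_orbit {wa0, wa1 w} (l, False)"
    using gen_orbit_eq[OF rev _ a] by blast
  then have "gen_orbit {wa0, wa1 w} (l, \<not> s) = gen_orbit {wa0, wa1 w} (l, s)" by (cases s) simp_all
  also have "\<dots> = gen_orbit {wa0, wa1 w} y" by (rule gen_orbit_eq[OF rev y assms(3)])
  finally show False using assms(4) gen_orbit_refl by metis
qed

text \<open>Sliding \<open>a\<close> over the adjacent \<open>b\<close>: first an edge \<open>a'\<close> parallel to the path along \<open>a\<close> and \<open>b\<close> is
  added, so that \<open>a\<close>, \<open>b\<close> and \<open>a'\<close> bound a triangle, and then \<open>a\<close> is deleted.\<close>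

definition slide_insert :: "hedge \<Rightarrow> hedge \<Rightarrow> hedge \<Rightarrow> hedge \<Rightarrow> hedge list" where
  "slide_insert a b a' h =
     (if h = bar b then (if tw b then [a', bar b] else [bar b, a'])
      else if h = bar a then (if tw a then [bar a, bar a'] else [bar a', bar a])
      else [h])"

text \<open>What \<open>slide_insert\<close> leaves once \<open>a\<close> and \<open>bar a\<close>
  are deleted, stated directly so that slides can be evaluated on explicit words.\<close>

definition slide_out :: "hedge \<Rightarrow> hedge \<Rightarrow> hedge \<Rightarrow> hedge \<Rightarrow> hedge list" where
  "slide_out a b a' h =
     (if h = a then []
      else if h = bar b then (if tw b then [a', bar b] else [bar b, a'])
      else if h = bar a then [bar a']
      else [h])"

text \<open>The new edge follows \<open>a\<close> and then \<open>b\<close>, so by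
  \<open>twa'\<close> it is twisted when exactly one of them is. \<open>ab\<close> excludes that
  \<open>a\<close> and \<open>b\<close> are the ends of one edge.\<close>

locale handle_slide =
  fixes w A B :: "hedge list" and a b a' :: hedge
  assumes valid: "valid w" and w: "w = A @ a # b # B" and ab: "a \<noteq> bar b"
    and fresh: "a' \<notin> set w" "bar a' \<notin> set w" and twa': "tw a' = (tw a \<noteq> tw b)"
begin

definition "m = concat (map (slide_insert a b a') w)"
definition "v = concat (map (slide_out a b a') w)"

lemma distw: "distinct w" and barw: "h \<in> set w \<Longrightarrow> bar h \<in> set w"
  using valid by (auto simp: valid_def)

lemma letters: "a \<in> set w" "b \<in> set w" "bar a \<in> set w" "bar b \<in> set w" "a \<noteq> b" "b \<noteq> bar a" "bar a \<noteq> bar b"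
proof -
  show 1: "a \<in> set w" "b \<in> set w" by (simp_all add: w)
  show "bar a \<in> set w" "bar b \<in> set w" by (rule barw[OF 1(1)], rule barw[OF 1(2)])
  show "a \<noteq> b" using distw by (auto simp: w)
  then show "bar a \<noteq> bar b" by simp
  show "b \<noteq> bar a" using ab by auto
qed

lemma fresh_neq: "h \<in> set w \<Longrightarrow> h \<noteq> a'" "h \<in> set w \<Longrightarrow> h \<noteq> bar a'"
  using fresh by auto

lemma neqs: "a \<noteq> a'" "a \<noteq> bar a'" "b \<noteq> a'" "b \<noteq> bar a'" "bar a \<noteq> a'" "bar b \<noteq> a'" "bar a \<noteq> bar a'" "bar b \<noteq> bar a'"
  using fresh_neq letters by blast+

lemma set_insert: "set (slide_insert a b a' h) = {h} \<union> (if h = bar b then {a'} else if h = bar a then {bar a'} else {})"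
  by (auto simp: slide_insert_def)

lemma set_m: "set m = set w \<union> {a', bar a'}"
  unfolding m_def using letters by (auto simp: set_insert split: if_splits)

lemma valid_m: "valid m"
proof -
  have "distinct m"
    unfolding m_def
  proof (rule distinct_concat)
    have "inj_on (slide_insert a b a') (set w)"
    proof (rule inj_onI)
      fix h k assume hk: "h \<in> set w" "k \<in> set w" "slide_insert a b a' h = slide_insert a b a' k"
      then have "h \<in> set (slide_insert a b a' k)" using set_insert[of h] by auto
      then show "h = k" using fresh_neq[OF hk(1)] by (auto simp: set_insert split: if_splits)
    qed
    then show "distinct (map (slide_insert a b a') w)" using distw by (simp add: distinct_map)
    show "distinct ys" if "ys \<in> set (map (slide_insert a b a') w)" for ys
      using that neqs neqs[symmetric] by (auto simp: slide_insert_def)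
    show "set ys \<inter> set zs = {}"
      if yz: "ys \<in> set (map (slide_insert a b a') w)" "zs \<in> set (map (slide_insert a b a') w)" "ys \<noteq> zs" for ys zs
    proof -
      obtain h k where "h \<in> set w" "k \<in> set w" "ys = slide_insert a b a' h" "zs = slide_insert a b a' k" "h \<noteq> k"
        using yz by auto
      then show ?thesis using fresh_neq letters by (auto simp: set_insert split: if_splits)
    qed
  qed
  moreover have "bar h \<in> set m" if "h \<in> set m" for h using that barw unfolding set_m by auto
  moreover have "m \<noteq> []" using set_m by force
  ultimately show ?thesis by (simp add: valid_def)
qed

lemma m_split:
  assumes "h \<in> set w"
  obtains X Y where "m = X @ slide_insert a b a' h @ Y"
proof -
  obtain X Y where "w = X @ h # Y" using assms by (metis split_list)
  then have "concat (map (slide_insert a b a') w) =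
      concat (map (slide_insert a b a') X) @ slide_insert a b a' h @ concat (map (slide_insert a b a') Y)"
    by simp
  then show thesis by (rule that[unfolded m_def])
qed

lemma dist_m: "distinct m"
  using valid_m by (simp add: valid_def)

text \<open>The positions in \<open>slide_insert\<close> are chosen for these corners. The path
  along the triangle reaches \<open>bar b\<close> on the side \<open>\<not> tw b\<close> and
  \<open>bar a\<close> on the side \<open>tw a\<close>, and these flags decide whether a new letter
  stands before or after the old one.\<close>

lemma triangle_corners:
  "wa1 m (a, True) = (b, False)" "wa1 m (b, False) = (a, True)"
  "wa1 m (bar b, \<not> tw b) = (a', tw b)" "wa1 m (a', tw b) = (bar b, \<not> tw b)"
  "wa1 m (bar a', \<not> tw a) = (bar a, tw a)" "wa1 m (bar a, tw a) = (bar a', \<not> tw a)"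
proof -
  have ins: "slide_insert a b a' a = [a]" "slide_insert a b a' b = [b]"
    using letters ab by (auto simp: slide_insert_def)
  have "concat (map (slide_insert a b a') w) =
      concat (map (slide_insert a b a') A) @ a # b # concat (map (slide_insert a b a') B)"
    by (subst w) (simp add: ins)
  then have m1: "m = concat (map (slide_insert a b a') A) @ a # b # concat (map (slide_insert a b a') B)"
    unfolding m_def .
  show "wa1 m (a, True) = (b, False)"
    using wa1_adjacent(1)[of "concat (map (slide_insert a b a') A)" a b] dist_m unfolding m1 by blast
  then show "wa1 m (b, False) = (a, True)" using wa1_simps(1)[OF dist_m] by metis
  have adj: "wa1 m (h, True) = (k, False) \<and> wa1 m (k, False) = (h, True)" if "m = X @ h # k # Y" for X h k Y
    using wa1_adjacent[of X h k Y] dist_m unfolding that by blast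
  obtain X Y where mb: "m = X @ slide_insert a b a' (bar b) @ Y" using m_split[OF letters(4)] .
  show b1: "wa1 m (bar b, \<not> tw b) = (a', tw b)"
  proof (cases "tw b")
    case True
    then have "m = X @ a' # bar b # Y" using mb by (simp add: slide_insert_def)
    then show ?thesis using adj True by simp
  next
    case False
    then have "m = X @ bar b # a' # Y" using mb by (simp add: slide_insert_def)
    then show ?thesis using adj False by simp
  qed
  then show "wa1 m (a', tw b) = (bar b, \<not> tw b)" using wa1_simps(1)[OF dist_m] by metis
  obtain X' Y' where ma: "m = X' @ slide_insert a b a' (bar a) @ Y'" using m_split[OF letters(3)] .
  show a1: "wa1 m (bar a', \<not> tw a) = (bar a, tw a)"
  proof (cases "tw a")
    case True
    then have "m = X' @ bar a # bar a' # Y'" using ma letters by (simp add: slide_insert_def)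
    then show ?thesis using adj True by simp
  next
    case False
    then have "m = X' @ bar a' # bar a # Y'" using ma letters by (simp add: slide_insert_def)
    then show ?thesis using adj False by simp
  qed
  then show "wa1 m (bar a, tw a) = (bar a', \<not> tw a)" using wa1_simps(1)[OF dist_m] by metis
qed

text \<open>The crosses are listed in walking order, alternately passing a corner by
  \<open>wa1 m\<close> and an edge by \<open>wa0\<close>.\<close>

definition "slide_triangle = {(a, True), (b, False), (bar b, \<not> tw b), (a', tw b), (bar a', \<not> tw a), (bar a, tw a)}"

lemma triangle_edges:
  "wa0 (a, True) = (bar a, tw a)" "wa0 (b, False) = (bar b, \<not> tw b)" "wa0 (a', tw b) = (bar a', \<not> tw a)"
  "wa0 (bar a, tw a) = (a, True)" "wa0 (bar b, \<not> tw b) = (b, False)" "wa0 (bar a', \<not> tw a) = (a', tw b)"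
  using twa' by auto

lemma triangle_face: "gen_orbit {wa0, wa1 m} (a, True) = slide_triangle"
proof
  show "gen_orbit {wa0, wa1 m} (a, True) \<subseteq> slide_triangle"
  proof (rule gen_orbit_least)
    fix x f assume x: "x \<in> slide_triangle" and f: "f \<in> {wa0, wa1 m}"
    have "wa0 x \<in> slide_triangle" using x triangle_edges unfolding slide_triangle_def by (elim insertE) auto
    moreover have "wa1 m x \<in> slide_triangle"
      using x triangle_corners unfolding slide_triangle_def by (elim insertE) (auto simp del: wa1.simps)
    ultimately show "f x \<in> slide_triangle" using f by blast
  qed (simp add: slide_triangle_def)
  let ?O = "gen_orbit {wa0, wa1 m} (a, True)"
  have g: "wa0 \<in> {wa0, wa1 m}" "wa1 m \<in> {wa0, wa1 m}" by blast+
  have 1: "(a, True) \<in> ?O" by simp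
  have 2: "(b, False) \<in> ?O" using gen_orbit_step[OF 1 g(2)] triangle_corners by metis
  have 3: "(bar b, \<not> tw b) \<in> ?O" using gen_orbit_step[OF 2 g(1)] triangle_edges by metis
  have 4: "(a', tw b) \<in> ?O" using gen_orbit_step[OF 3 g(2)] triangle_corners by metis
  have 5: "(bar a', \<not> tw a) \<in> ?O" using gen_orbit_step[OF 4 g(1)] triangle_edges by metis
  have 6: "(bar a, tw a) \<in> ?O" using gen_orbit_step[OF 5 g(2)] triangle_corners by metis
  show "slide_triangle \<subseteq> ?O" unfolding slide_triangle_def using 1 2 3 4 5 6 by blast
qed

lemma card_triangle: "card slide_triangle = 6"
  unfolding slide_triangle_def using neqs neqs[symmetric] letters(5-7) letters(5-7)[symmetric] ab ab[symmetric] by simp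

text \<open>The three edges of the triangle are distinct, so it runs along each on one side only.
  Hence \<open>a\<close> as well as \<open>a'\<close> separates two faces of \<open>m\<close>, and
  deleting either keeps the invariants; the results are \<open>v\<close> and
  \<open>w\<close>.\<close>

lemma sides_a: "(a, True) \<notin> gen_orbit {wa0, wa1 m} (a, False)"
proof (rule side_faces_distinct[OF valid_m, of "(a, True)" _ True])
  show "(a, True) \<in> sides m" using letters set_m by simp
  show "(a, \<not> True) \<notin> gen_orbit {wa0, wa1 m} (a, True)"
    unfolding triangle_face slide_triangle_def using neqs letters ab by auto
qed simp

lemma sides_a': "(a', True) \<notin> gen_orbit {wa0, wa1 m} (a', False)"
proof (rule side_faces_distinct[OF valid_m, of "(a, True)" _ "tw b"])
  show "(a, True) \<in> sides m" using letters set_m by simp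
  show "(a', tw b) \<in> gen_orbit {wa0, wa1 m} (a, True)" unfolding triangle_face slide_triangle_def by simp
  show "(a', \<not> tw b) \<notin> gen_orbit {wa0, wa1 m} (a, True)"
    unfolding triangle_face slide_triangle_def using neqs letters ab by auto
qed

lemma del_new: "del_hedge a' m = w"
proof -
  have "filter (\<lambda>x. x \<notin> {a', bar a'}) (concat (map (slide_insert a b a') u)) = u" if "set u \<subseteq> set w" for u
    using that
  proof (induction u)
    case (Cons h u)
    have "filter (\<lambda>x. x \<notin> {a', bar a'}) (slide_insert a b a' h) = [h]"
      using fresh_neq[of h] Cons.prems by (auto simp: slide_insert_def)
    then show ?case using Cons by simp
  qed simp
  then show ?thesis by (simp add: del_hedge_def m_def)
qed

lemma del_old: "del_hedge a m = v"
proof -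
  have "filter (\<lambda>x. x \<notin> {a, bar a}) (concat (map (slide_insert a b a') u)) = concat (map (slide_out a b a') u)" for u
  proof (induction u)
    case (Cons h u)
    have "filter (\<lambda>x. x \<notin> {a, bar a}) (slide_insert a b a' h) = slide_out a b a' h"
      using neqs neqs[symmetric] letters letters(5-7)[symmetric] ab by (auto simp: slide_insert_def slide_out_def)
    then show ?case using Cons by simp
  qed simp
  then show ?thesis by (simp add: del_hedge_def m_def v_def)
qed

lemma set_v: "set v = set w - {a, bar a} \<union> {a', bar a'}"
  unfolding del_old[symmetric] del_hedge_def using set_m neqs by auto

lemma v_nonempty: "v \<noteq> []"
  using set_v by force

lemma valid_v: "valid v"
  using valid_del_hedge[OF valid_m, of a] del_old v_nonempty by simp

lemma length_m: "length m = length w + 2"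
  using length_del_hedge[OF valid_m, of a'] del_new set_m by simp

lemma length_w: "length w \<ge> 4"
proof -
  have "{a, bar a, b, bar b} \<subseteq> set w" using letters by simp
  then have "card {a, bar a, b, bar b} \<le> card (set w)" by (rule card_mono[rotated]) simp
  moreover have "card {a, bar a, b, bar b} = 4" using letters ab by auto
  ultimately show ?thesis using distw by (simp add: distinct_card)
qed

lemma nfaces_m: "nfaces m = Suc (nfaces w)" "nfaces m = Suc (nfaces v)"
  using nfaces_del_hedge[OF valid_m _ _ sides_a'] nfaces_del_hedge[OF valid_m _ _ sides_a]
    del_new del_old set_m letters v_nonempty valid by (auto simp: valid_def)

lemma invariants_m: "weg m = weg w" "twisted m = twisted w" "weg m = weg v" "twisted m = twisted v"
proof -
  have "del_hedge a' m \<noteq> []" using del_new valid by (simp add: valid_def)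
  then show "weg m = weg w" "twisted m = twisted w"
    using del_hedge_invariants[OF valid_m _ _ sides_a'] del_new set_m by auto
  have "del_hedge a m \<noteq> []" "a \<in> set m" using del_old v_nonempty letters set_m by auto
  then show "weg m = weg v" "twisted m = twisted v"
    using del_hedge_invariants[OF valid_m _ _ sides_a] del_old by auto
qed

text \<open>One of the two faces of \<open>m\<close> is the triangle, with six crosses. The other
  has all remaining ones: \<open>w\<close> has at least four letters, so \<open>m\<close> has at
  least six letters and twelve crosses, of which six are left.\<close>

lemma large_faces:
  assumes "nfaces w = 1" and x: "x \<in> sides m"
  shows "card (gen_orbit {wa0, wa1 m} x) > 4"
proof (cases "gen_orbit {wa0, wa1 m} x = slide_triangle")
  case True
  then show ?thesis using card_triangle by simp
next
  case False
  let ?O = "gen_orbit {wa0, wa1 m} x"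
  have rev: "reversible_on {wa0, wa1 m} (sides m)" by (rule word_reversible[OF valid_m]) blast
  have a: "(a, True) \<in> sides m" using letters set_m by simp
  have two: "card (orbits_on {wa0, wa1 m} (sides m)) = 2"
    using nfaces_m assms unfolding nfaces_def[of m] by simp
  have sub: "{slide_triangle, ?O} \<subseteq> orbits_on {wa0, wa1 m} (sides m)"
    using x a triangle_face unfolding orbits_on_def by blast
  have "{slide_triangle, ?O} = orbits_on {wa0, wa1 m} (sides m)"
  proof (rule card_seteq[OF _ sub])
    show "finite (orbits_on {wa0, wa1 m} (sides m))" by (simp add: orbits_on_def)
    show "card (orbits_on {wa0, wa1 m} (sides m)) \<le> card {slide_triangle, ?O}" using two False by auto
  qed
  then have orbs: "orbits_on {wa0, wa1 m} (sides m) = {slide_triangle, ?O}" by simp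
  have "sides m \<subseteq> slide_triangle \<union> ?O"
  proof
    fix y assume "y \<in> sides m"
    then have "gen_orbit {wa0, wa1 m} y \<in> {slide_triangle, ?O}" unfolding orbs[symmetric] orbits_on_def by (rule imageI)
    then show "y \<in> slide_triangle \<union> ?O" using gen_orbit_refl[of y "{wa0, wa1 m}"] by auto
  qed
  moreover have "?O \<subseteq> sides m" by (rule gen_orbit_in[OF rev x])
  then have fin: "finite ?O" using finite_subset by fastforce
  ultimately have "card (sides m) \<le> card (slide_triangle \<union> ?O)"
    by (intro card_mono) (auto simp: slide_triangle_def)
  also have "\<dots> \<le> card slide_triangle + card ?O" by (rule card_Un_le)
  finally have "card (sides m) \<le> 6 + card ?O" using card_triangle by simp
  moreover have "card (sides m) = 2 * length m"
    using dist_m by (simp add: card_cartesian_product distinct_card)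
  ultimately show ?thesis using length_m length_w by simp
qed

lemma linked_slide:
  fixes \<iota> :: "hedge \<times> bool \<Rightarrow> 'a"
  assumes \<iota>: "inj \<iota>" and one: "nfaces w = 1" and sg: "signed_genus (wmap \<iota> w) = of_int g"
  shows "(wmap \<iota> w, wmap \<iota> v) \<in> linked g"
proof -
  have W: "word_map \<iota> w" "word_map \<iota> m" "word_map \<iota> v"
    using valid valid_m valid_v inj_on_subset[OF \<iota>] by (auto simp: word_map_def)
  have one_v: "nfaces v = 1" using nfaces_m one by simp
  have cores: "is_core (wmap \<iota> w)" "is_core (wmap \<iota> v)" "is_core (wmap \<iota> m)"
    using word_map.core_if_one_face[OF W(1) one] word_map.core_if_one_face[OF W(3) one_v]
      word_map.core_if_large_faces[OF W(2) large_faces[OF one]] by auto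
  have sgs: "signed_genus (wmap \<iota> m) = of_int g" "signed_genus (wmap \<iota> v) = of_int g"
    using word_map.signed_genus[OF W(1)] word_map.signed_genus[OF W(2)]
      word_map.signed_genus[OF W(3)] sg invariants_m by simp_all
  have in_cores: "wmap \<iota> w \<in> cores g" "wmap \<iota> m \<in> cores g" "wmap \<iota> v \<in> cores g"
    using cores sg sgs by (auto simp: cores_def)
  have sub: "submap (wmap \<iota> (del_hedge l m)) (wmap \<iota> m)" if "l \<in> set m" "del_hedge l m \<noteq> []" for l
    unfolding del_hedge_def
    by (rule word_map.submap_filter[OF W(2)]) (use that valid_m in \<open>auto simp: valid_def del_hedge_def\<close>)
  have "submap (wmap \<iota> w) (wmap \<iota> m)"
    using sub[of a'] del_new set_m valid by (simp add: valid_def)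
  then have "hom_exists (wmap \<iota> w) (wmap \<iota> m)"
    by (intro hom_exists_submap) (use word_map.is_map W sg sgs in auto)
  then have l1: "(wmap \<iota> w, wmap \<iota> m) \<in> linked g" using in_cores by (intro linkedI) auto
  have "submap (wmap \<iota> v) (wmap \<iota> m)"
    using sub[of a] del_old set_m letters v_nonempty by simp
  then have "hom_exists (wmap \<iota> v) (wmap \<iota> m)"
    by (intro hom_exists_submap) (use word_map.is_map W sgs in auto)
  then have l2: "(wmap \<iota> m, wmap \<iota> v) \<in> linked g" using in_cores by (intro linkedI) auto
  show ?thesis by (rule linked_trans[OF l1 l2])
qed

end

section \<open>Normal forms of words\<close>

definition slide_step :: "hedge list \<Rightarrow> hedge list \<Rightarrow> bool" where
  "slide_step w v \<longleftrightarrow> (\<exists>A a b B a'. handle_slide w A B a b a' \<and> v = concat (map (slide_out a b a') w))"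

text \<open>\<open>handle_slide\<close> moves a half-edge over its right neighbour only; steps
  between the reversed words supply the moves over the left neighbour.\<close>

abbreviation slide_conn :: "hedge list \<Rightarrow> hedge list \<Rightarrow> bool" (infix "\<leadsto>" 50) where
  "w \<leadsto> v \<equiv> (\<lambda>w v. slide_step w v \<or> slide_step (rev w) (rev v))\<^sup>*\<^sup>* w v"

lemma valid_distinct: "valid w \<Longrightarrow> distinct w"
  by (simp add: valid_def)

lemma slide_step_valid:
  assumes "slide_step w v"
  shows "valid w" "valid v" "length v = length w"
proof -
  obtain A a b B a' where h: "handle_slide w A B a b a'" "v = concat (map (slide_out a b a') w)"
    using assms by (auto simp: slide_step_def)
  interpret handle_slide w A B a b a' by (rule h(1))
  have v: "v = handle_slide.v w a b a'" unfolding h(2) v_def ..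
  show "valid w" by (rule valid)
  show "valid v" unfolding v by (rule valid_v)
  have "length m = length (del_hedge a m) + 2" using length_del_hedge[OF valid_m, of a] set_m letters by simp
  then show "length v = length w" using length_m del_old unfolding v by simp
qed

lemma slide_conn_valid: "w \<leadsto> v \<Longrightarrow> valid w \<Longrightarrow> valid v \<and> length v = length w"
proof (induction rule: rtranclp_induct)
  case (step v u)
  then have v: "valid v" "length v = length w" by auto
  from step.hyps(2) show ?case
  proof
    assume "slide_step v u"
    then show ?thesis using slide_step_valid[of v u] v by simp
  next
    assume "slide_step (rev v) (rev u)"
    then show ?thesis using slide_step_valid[of "rev v" "rev u"] rev_invariants(1)[of "rev u"] v by simp
  qed
qed simp

lemma slide_conn_rev: "w \<leadsto> v \<Longrightarrow> rev w \<leadsto> rev v"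
proof (induction rule: rtranclp_induct)
  case (step v u)
  have "slide_step (rev v) (rev u) \<or> slide_step (rev (rev v)) (rev (rev u))" using step.hyps(2) by auto
  with step.IH show ?case by (rule rtranclp.rtrancl_into_rtrancl)
qed simp

lemma ex_fresh: "finite S \<Longrightarrow> \<exists>a'. a' \<notin> S \<and> bar a' \<notin> S \<and> tw a' = t"
proof -
  assume S: "finite S"
  then obtain n where n: "n \<notin> hname ` S" using ex_new_if_finite[OF infinite_UNIV_nat, of "hname ` S"] by auto
  then have "Hedge n t True \<notin> S" "Hedge n t False \<notin> S" by force+
  then show ?thesis by (intro exI[of _ "Hedge n t True"]) (simp add: bar_def)
qed

text \<open>A slid edge is a new edge, so the end that stays in place changes its name from
  \<open>bar a\<close> to \<open>bar a'\<close>.\<close>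

definition ren :: "hedge \<Rightarrow> hedge \<Rightarrow> hedge \<Rightarrow> hedge" where
  "ren a a' h = (if h = bar a then bar a' else h)"

abbreviation tws :: "hedge list \<Rightarrow> hedge set" where
  "tws w \<equiv> {h \<in> set w. tw h}"

lemma map_ren_id: "bar a \<notin> set X \<Longrightarrow> map (ren a a') X = X"
  by (rule map_idI) (auto simp: ren_def)

lemma concat_slide_out:
  "a \<notin> set X \<Longrightarrow> bar b \<notin> set X \<Longrightarrow> concat (map (slide_out a b a') X) = map (ren a a') X"
  by (induction X) (auto simp: slide_out_def ren_def)

lemma slide_exists:
  assumes v: "valid w" and w: "w = A @ a # b # B" and ab: "a \<noteq> bar b"
  obtains a' where "a' \<notin> set w" "bar a' \<notin> set w" "tw a' = (tw a \<noteq> tw b)"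
    "slide_step w (concat (map (slide_out a b a') w))"
    "\<not> tw a \<Longrightarrow> \<not> tw b \<Longrightarrow> tws (concat (map (slide_out a b a') w)) \<subseteq> tws w"
proof -
  obtain a' where a': "a' \<notin> set w" "bar a' \<notin> set w" "tw a' = (tw a \<noteq> tw b)"
    using ex_fresh[of "set w"] by blast
  interpret handle_slide w A B a b a' by standard (use v w ab a' in auto)
  have "slide_step w (concat (map (slide_out a b a') w))"
    unfolding slide_step_def using handle_slide_axioms by blast
  moreover have "tws (concat (map (slide_out a b a') w)) \<subseteq> tws w" if "\<not> tw a" "\<not> tw b"
    using set_v that a' unfolding v_def by auto
  ultimately show thesis using that a' by blast
qed

text \<open>A half-edge just before \<open>b\<close> runs along that side of the edge. At
  \<open>bar b\<close> this side lies after the letter if the edge is untwisted and before it if the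
  edge is twisted, and the twist of \<open>b\<close> is added to that of \<open>a\<close>. The
  variants below differ in the order of \<open>b\<close> and \<open>bar b\<close> and in the side on
  which \<open>a\<close> starts.\<close>

lemma slide_left:
  assumes v: "valid (X @ a # b # Y @ bar b # Z)"
  obtains a' where "a' \<notin> set (X @ a # b # Y @ bar b # Z)" "bar a' \<notin> set (X @ a # b # Y @ bar b # Z)"
    "tw a' = (tw a \<noteq> tw b)"
    "X @ a # b # Y @ bar b # Z \<leadsto>
       map (ren a a') X @ b # map (ren a a') Y @ (if tw b then [a', bar b] else [bar b, a']) @ map (ren a a') Z"
    "\<not> tw a \<Longrightarrow> \<not> tw b \<Longrightarrow> tws (map (ren a a') X @ b # map (ren a a') Y @ (if tw b then [a', bar b] else [bar b, a']) @ map (ren a a') Z)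
       \<subseteq> tws (X @ a # b # Y @ bar b # Z)"
proof -
  let ?w = "X @ a # b # Y @ bar b # Z"
  have d: "distinct ?w" by (rule valid_distinct[OF v])
  have ab: "a \<noteq> bar b" "b \<noteq> bar a" using d by auto
  obtain a' where a': "a' \<notin> set ?w" "bar a' \<notin> set ?w" "tw a' = (tw a \<noteq> tw b)"
    "slide_step ?w (concat (map (slide_out a b a') ?w))"
    "\<not> tw a \<Longrightarrow> \<not> tw b \<Longrightarrow> tws (concat (map (slide_out a b a') ?w)) \<subseteq> tws ?w"
    using slide_exists[OF v _ ab(1), of X "Y @ bar b # Z"] by blast
  have "concat (map (slide_out a b a') ?w) =
    map (ren a a') X @ b # map (ren a a') Y @ (if tw b then [a', bar b] else [bar b, a']) @ map (ren a a') Z"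
    using d ab by (simp add: concat_slide_out) (auto simp: slide_out_def)
  then show thesis using that[OF a'(1-3)] a'(4,5) by auto
qed

lemma slide_left':
  assumes v: "valid (X @ bar b # Y @ a # b # Z)"
  obtains a' where "a' \<notin> set (X @ bar b # Y @ a # b # Z)" "bar a' \<notin> set (X @ bar b # Y @ a # b # Z)"
    "tw a' = (tw a \<noteq> tw b)"
    "X @ bar b # Y @ a # b # Z \<leadsto>
       map (ren a a') X @ (if tw b then [a', bar b] else [bar b, a']) @ map (ren a a') Y @ b # map (ren a a') Z"
    "\<not> tw a \<Longrightarrow> \<not> tw b \<Longrightarrow> tws (map (ren a a') X @ (if tw b then [a', bar b] else [bar b, a']) @ map (ren a a') Y @ b # map (ren a a') Z)
       \<subseteq> tws (X @ bar b # Y @ a # b # Z)"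
proof -
  let ?w = "X @ bar b # Y @ a # b # Z"
  have d: "distinct ?w" by (rule valid_distinct[OF v])
  have ab: "a \<noteq> bar b" "b \<noteq> bar a" using d by auto
  obtain a' where a': "a' \<notin> set ?w" "bar a' \<notin> set ?w" "tw a' = (tw a \<noteq> tw b)"
    "slide_step ?w (concat (map (slide_out a b a') ?w))"
    "\<not> tw a \<Longrightarrow> \<not> tw b \<Longrightarrow> tws (concat (map (slide_out a b a') ?w)) \<subseteq> tws ?w"
    using slide_exists[OF v _ ab(1), of "X @ bar b # Y" Z] by auto
  have "concat (map (slide_out a b a') ?w) =
    map (ren a a') X @ (if tw b then [a', bar b] else [bar b, a']) @ map (ren a a') Y @ b # map (ren a a') Z"
    using d ab by (simp add: concat_slide_out) (auto simp: slide_out_def)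
  then show thesis using that[OF a'(1-3)] a'(4,5) by auto
qed

text \<open>Mirror image of \<open>slide_left'\<close>; reversing the word also exchanges the order
  of \<open>b\<close> and \<open>bar b\<close>, so \<open>slide_left\<close> would give the other
  variant.\<close>

lemma slide_right:
  assumes v: "valid (X @ b # a # Y @ bar b # Z)"
  obtains a' where "a' \<notin> set (X @ b # a # Y @ bar b # Z)" "bar a' \<notin> set (X @ b # a # Y @ bar b # Z)"
    "tw a' = (tw a \<noteq> tw b)"
    "X @ b # a # Y @ bar b # Z \<leadsto>
       map (ren a a') X @ b # map (ren a a') Y @ (if tw b then [bar b, a'] else [a', bar b]) @ map (ren a a') Z"
    "\<not> tw a \<Longrightarrow> \<not> tw b \<Longrightarrow> tws (map (ren a a') X @ b # map (ren a a') Y @ (if tw b then [bar b, a'] else [a', bar b]) @ map (ren a a') Z)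
       \<subseteq> tws (X @ b # a # Y @ bar b # Z)"
proof -
  have "valid (rev Z @ bar b # rev Y @ a # b # rev X)"
    using rev_invariants(1)[OF v] by simp
  then obtain a' where a': "a' \<notin> set (rev Z @ bar b # rev Y @ a # b # rev X)"
    "bar a' \<notin> set (rev Z @ bar b # rev Y @ a # b # rev X)" "tw a' = (tw a \<noteq> tw b)"
    "rev Z @ bar b # rev Y @ a # b # rev X \<leadsto> map (ren a a') (rev Z) @
      (if tw b then [a', bar b] else [bar b, a']) @ map (ren a a') (rev Y) @ b # map (ren a a') (rev X)"
    "\<not> tw a \<Longrightarrow> \<not> tw b \<Longrightarrow> tws (map (ren a a') (rev Z) @ (if tw b then [a', bar b] else [bar b, a']) @ map (ren a a') (rev Y) @ b # map (ren a a') (rev X))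
       \<subseteq> tws (rev Z @ bar b # rev Y @ a # b # rev X)"
    using slide_left'[of "rev Z" b "rev Y" a "rev X"] by blast
  show thesis
  proof (rule that[of a'])
    show "a' \<notin> set (X @ b # a # Y @ bar b # Z)" "bar a' \<notin> set (X @ b # a # Y @ bar b # Z)"
      using a'(1,2) by auto
    show "tw a' = (tw a \<noteq> tw b)" by (rule a'(3))
    show "X @ b # a # Y @ bar b # Z \<leadsto>
       map (ren a a') X @ b # map (ren a a') Y @ (if tw b then [bar b, a'] else [a', bar b]) @ map (ren a a') Z"
      using slide_conn_rev[OF a'(4)] by (cases "tw b") (simp_all add: rev_map)
    show "tws (map (ren a a') X @ b # map (ren a a') Y @ (if tw b then [bar b, a'] else [a', bar b]) @ map (ren a a') Z)
       \<subseteq> tws (X @ b # a # Y @ bar b # Z)" if "\<not> tw a" "\<not> tw b"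
      using a'(5)[OF that] by auto
  qed
qed

lemma slide_left_twisted:
  assumes "valid (X @ a # b # Y @ bar b # Z)" "tw b"
  shows "\<exists>a'. a' \<notin> set (X @ a # b # Y @ bar b # Z) \<and> bar a' \<notin> set (X @ a # b # Y @ bar b # Z) \<and>
    tw a' = (\<not> tw a) \<and>
    X @ a # b # Y @ bar b # Z \<leadsto> map (ren a a') X @ b # map (ren a a') Y @ a' # bar b # map (ren a a') Z"
  by (rule slide_left[OF assms(1)]) (use assms(2) in auto)

lemma slide_right_twisted:
  assumes "valid (X @ b # a # Y @ bar b # Z)" "tw b"
  shows "\<exists>a'. a' \<notin> set (X @ b # a # Y @ bar b # Z) \<and> bar a' \<notin> set (X @ b # a # Y @ bar b # Z) \<and>
    tw a' = (\<not> tw a) \<and>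
    X @ b # a # Y @ bar b # Z \<leadsto> map (ren a a') X @ b # map (ren a a') Y @ bar b # a' # map (ren a a') Z"
  by (rule slide_right[OF assms(1)]) (use assms(2) in auto)

lemma slide_left_untwisted:
  assumes "valid (X @ a # b # Y @ bar b # Z)" "\<not> tw a" "\<not> tw b"
  shows "\<exists>a'. \<not> tw a' \<and>
    X @ a # b # Y @ bar b # Z \<leadsto> map (ren a a') X @ b # map (ren a a') Y @ bar b # a' # map (ren a a') Z \<and>
    tws (map (ren a a') X @ b # map (ren a a') Y @ bar b # a' # map (ren a a') Z) \<subseteq> tws (X @ a # b # Y @ bar b # Z)"
  by (rule slide_left[OF assms(1)], rule exI) (use assms(2,3) in simp)

lemma slide_left'_untwisted:
  assumes "valid (X @ bar b # Y @ a # b # Z)" "\<not> tw a" "\<not> tw b"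
  shows "\<exists>a'. \<not> tw a' \<and>
    X @ bar b # Y @ a # b # Z \<leadsto> map (ren a a') X @ bar b # a' # map (ren a a') Y @ b # map (ren a a') Z \<and>
    tws (map (ren a a') X @ bar b # a' # map (ren a a') Y @ b # map (ren a a') Z) \<subseteq> tws (X @ bar b # Y @ a # b # Z)"
  by (rule slide_left'[OF assms(1)], rule exI) (use assms(2,3) in simp)

lemma slide_right_untwisted:
  assumes "valid (X @ b # a # Y @ bar b # Z)" "\<not> tw a" "\<not> tw b"
  shows "\<exists>a'. \<not> tw a' \<and>
    X @ b # a # Y @ bar b # Z \<leadsto> map (ren a a') X @ b # map (ren a a') Y @ a' # bar b # map (ren a a') Z \<and>
    tws (map (ren a a') X @ b # map (ren a a') Y @ a' # bar b # map (ren a a') Z) \<subseteq> tws (X @ b # a # Y @ bar b # Z)"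
  by (rule slide_right[OF assms(1)], rule exI) (use assms(2,3) in simp)

section \<open>Collecting twisted blocks and handle blocks\<close>

definition closed :: "hedge list \<Rightarrow> bool" where
  "closed P \<longleftrightarrow> (\<forall>h\<in>set P. bar h \<in> set P)"

text \<open>Finished blocks form a closed prefix. A letter outside it has its other end outside too,
  so the renaming caused by a slide leaves the prefix alone.\<close>

lemma map_ren_closed:
  "closed P \<Longrightarrow> a \<notin> set P \<Longrightarrow> map (ren a a') P = P"
  by (rule map_ren_id) (metis bar_simps(1) closed_def)

text \<open>A letter just before the twisted \<open>x\<close> slides to the place just before
  \<open>bar x\<close> and so passes from \<open>D\<close> to \<open>A\<close>. The induction is on
  lengths because slides rename the letters.\<close>

lemma twisted_clear_left:
  assumes "valid (P @ D @ x # A @ bar x # C)" "closed P" "tw x"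
  shows "\<exists>A' C'. P @ D @ x # A @ bar x # C \<leadsto> P @ x # A' @ bar x # C'"
  using assms
proof (induction D arbitrary: A C rule: length_induct)
  case (1 D)
  show ?case
  proof (cases D rule: rev_cases)
    case Nil
    then show ?thesis by auto
  next
    case (snoc D1 d)
    have v: "valid ((P @ D1) @ d # x # A @ bar x # C)" using 1(2) snoc by simp
    obtain d' where d: "(P @ D1) @ d # x # A @ bar x # C \<leadsto>
       map (ren d d') (P @ D1) @ x # map (ren d d') A @ d' # bar x # map (ren d d') C"
      using slide_left_twisted[OF v 1(4)] by blast
    have "d \<notin> set P" using v by (simp add: valid_def)
    then have P: "map (ren d d') P = P" by (rule map_ren_closed[OF 1(3)])
    let ?D = "map (ren d d') D1" and ?A = "map (ren d d') A @ [d']" and ?C = "map (ren d d') C"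
    have s: "P @ D @ x # A @ bar x # C \<leadsto> P @ ?D @ x # ?A @ bar x # ?C" using d snoc P by simp
    have "valid (P @ ?D @ x # ?A @ bar x # ?C)" using slide_conn_valid[OF s 1(2)] by blast
    moreover have "length ?D < length D" using snoc by simp
    ultimately obtain A' C' where "P @ ?D @ x # ?A @ bar x # ?C \<leadsto> P @ x # A' @ bar x # C'"
      using 1(1,3,4) by blast
    with s have "P @ D @ x # A @ bar x # C \<leadsto> P @ x # A' @ bar x # C'" by (rule rtranclp_trans)
    then show ?thesis by blast
  qed
qed

text \<open>A letter just after the twisted \<open>x\<close> slides to the place just after
  \<open>bar x\<close>, so the gap between the two ends gets shorter.\<close>

lemma twisted_clear_inside:
  assumes "valid (P @ x # A @ bar x # C)" "closed P" "tw x"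
  shows "\<exists>C'. P @ x # A @ bar x # C \<leadsto> P @ x # bar x # C'"
  using assms
proof (induction A arbitrary: C rule: length_induct)
  case (1 A)
  show ?case
  proof (cases A)
    case Nil
    then show ?thesis by auto
  next
    case (Cons e A1)
    have v: "valid (P @ x # e # A1 @ bar x # C)" using 1(2) Cons by simp
    obtain e' where e: "P @ x # e # A1 @ bar x # C \<leadsto>
       map (ren e e') P @ x # map (ren e e') A1 @ bar x # e' # map (ren e e') C"
      using slide_right_twisted[OF v 1(4)] by blast
    have "e \<notin> set P" using v by (auto simp: valid_def)
    then have P: "map (ren e e') P = P" by (rule map_ren_closed[OF 1(3)])
    let ?A = "map (ren e e') A1" and ?C = "e' # map (ren e e') C"
    have s: "P @ x # A @ bar x # C \<leadsto> P @ x # ?A @ bar x # ?C" using e Cons P by simp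
    have "valid (P @ x # ?A @ bar x # ?C)" using slide_conn_valid[OF s 1(2)] by blast
    moreover have "length ?A < length A" using Cons by simp
    ultimately obtain C' where "P @ x # ?A @ bar x # ?C \<leadsto> P @ x # bar x # C'"
      using 1(1,3,4) by blast
    with s have "P @ x # A @ bar x # C \<leadsto> P @ x # bar x # C'" by (rule rtranclp_trans)
    then show ?thesis by blast
  qed
qed

lemma pair_split:
  assumes "x \<in> set u" "bar x \<in> set u"
  obtains y D A C where "y \<in> {x, bar x}" "u = D @ y # A @ bar y # C"
proof -
  obtain D E where u: "u = D @ x # E" using assms(1) by (metis split_list)
  show thesis
  proof (cases "bar x \<in> set E")
    case True
    then obtain A C where "E = A @ bar x # C" by (metis split_list)
    then show ?thesis using that[of x D A C] u by simp
  next
    case False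
    then have "bar x \<in> set D" using assms(2) u by auto
    then obtain D1 A where "D = D1 @ bar x # A" by (metis split_list)
    then show ?thesis using that[of "bar x" D1 A E] u by simp
  qed
qed

lemma valid_closed_rest:
  assumes "valid (P @ u)" "closed P"
  shows "closed u"
  unfolding closed_def
proof
  fix h assume h: "h \<in> set u"
  then have "bar h \<in> set (P @ u)" using assms(1) by (simp add: valid_def)
  moreover have "bar h \<notin> set P"
  proof
    assume "bar h \<in> set P"
    then have "bar (bar h) \<in> set P" using assms(2) unfolding closed_def by blast
    then show False using h assms(1) by (auto simp: valid_def)
  qed
  ultimately show "bar h \<in> set u" by simp
qed

text \<open>A block has one vertex, one edge and one face, so the words stand for connected sums of
  projective planes.\<close>

inductive twisted_blocks :: "hedge list \<Rightarrow> bool" where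
  "twisted_blocks []"
| "tw x \<Longrightarrow> twisted_blocks w \<Longrightarrow> twisted_blocks (x # bar x # w)"

text \<open>A block has one vertex, two edges and one face, so the words stand for connected sums of
  tori.\<close>

inductive handle_blocks :: "hedge list \<Rightarrow> bool" where
  "handle_blocks []"
| "\<not> tw x \<Longrightarrow> \<not> tw y \<Longrightarrow> handle_blocks w \<Longrightarrow> handle_blocks (x # y # bar x # bar y # w)"

lemma twisted_blocks_closed: "twisted_blocks w \<Longrightarrow> closed w"
  by (induction rule: twisted_blocks.induct) (auto simp: closed_def)

lemma handle_blocks_closed: "handle_blocks w \<Longrightarrow> closed w"
  by (induction rule: handle_blocks.induct) (auto simp: closed_def)

text \<open>Slides over \<open>x\<close> may change which of the other letters are twisted, so the
  measure is the length of the rest: each new block joins the prefix, and slides keep the total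
  length.\<close>

lemma extract_twisted_blocks:
  assumes "valid (P @ u)" "closed P"
  shows "\<exists>Q u'. P @ u \<leadsto> P @ Q @ u' \<and> twisted_blocks Q \<and> (\<forall>h\<in>set u'. \<not> tw h)"
  using assms
proof (induction u arbitrary: P rule: length_induct)
  case (1 u)
  show ?case
  proof (cases "\<exists>x\<in>set u. tw x")
    case False
    then show ?thesis by (intro exI[of _ "[]"] exI[of _ u]) (auto intro: twisted_blocks.intros)
  next
    case True
    then obtain x0 where x0: "x0 \<in> set u" "tw x0" by blast
    then have "bar x0 \<in> set u" using valid_closed_rest[OF 1(2,3)] by (simp add: closed_def)
    then obtain x D A C where x: "x \<in> {x0, bar x0}" "u = D @ x # A @ bar x # C"
      using pair_split x0(1) by metis
    have tx: "tw x" using x x0 by auto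
    have v: "valid (P @ D @ x # A @ bar x # C)" using 1(2) x by simp
    obtain A' C' where s1: "P @ D @ x # A @ bar x # C \<leadsto> P @ x # A' @ bar x # C'"
      using twisted_clear_left[OF v 1(3) tx] by blast
    have v1: "valid (P @ x # A' @ bar x # C')" using slide_conn_valid[OF s1 v] by blast
    obtain C'' where s2: "P @ x # A' @ bar x # C' \<leadsto> P @ x # bar x # C''"
      using twisted_clear_inside[OF v1 1(3) tx] by blast
    have s: "P @ u \<leadsto> (P @ [x, bar x]) @ C''" using rtranclp_trans[OF s1 s2] x by simp
    have v2: "valid ((P @ [x, bar x]) @ C'')" "length ((P @ [x, bar x]) @ C'') = length (P @ u)"
      using slide_conn_valid[OF s 1(2)] by auto
    have "closed (P @ [x, bar x])" using 1(3) by (auto simp: closed_def)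
    moreover have "length C'' < length u" using v2(2) by simp
    ultimately obtain Q u' where Q: "(P @ [x, bar x]) @ C'' \<leadsto> (P @ [x, bar x]) @ Q @ u'"
      "twisted_blocks Q" "\<forall>h\<in>set u'. \<not> tw h"
      using 1(1) v2(1) by blast
    have "P @ u \<leadsto> P @ (x # bar x # Q) @ u'" using rtranclp_trans[OF s Q(1)] by simp
    moreover have "twisted_blocks (x # bar x # Q)" using tx Q(2) by (rule twisted_blocks.intros)
    ultimately show ?thesis using Q(3) by blast
  qed
qed

text \<open>The condition on \<open>tws\<close> says that all letters after the finished prefix are
  untwisted, which slides of untwisted edges over each other preserve. The gaps of an interleaved
  pair are cleared from left to right: letters of \<open>D\<close> pass to \<open>F\<close>, those
  of \<open>A\<close> to \<open>E\<close>, those of \<open>E\<close> to \<open>F\<close>, and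
  finally those of \<open>F\<close> to \<open>G\<close>, so that a cleared gap ends up
  clear.\<close>

lemma untwisted_clear_left:
  assumes "valid (P @ D @ x # A @ y # E @ bar x # F @ bar y # G)" "closed P"
    "tws (P @ D @ x # A @ y # E @ bar x # F @ bar y # G) \<subseteq> set P"
  shows "\<exists>A' E' F' G'. P @ D @ x # A @ y # E @ bar x # F @ bar y # G \<leadsto> P @ x # A' @ y # E' @ bar x # F' @ bar y # G' \<and>
     tws (P @ x # A' @ y # E' @ bar x # F' @ bar y # G') \<subseteq> set P"
  using assms
proof (induction D arbitrary: A E F G rule: length_induct)
  case (1 D)
  show ?case
  proof (cases D rule: rev_cases)
    case Nil
    then show ?thesis using 1(4) by auto
  next
    case (snoc D1 d)
    let ?w = "P @ D @ x # A @ y # E @ bar x # F @ bar y # G"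
    have w: "?w = (P @ D1) @ d # x # (A @ y # E) @ bar x # F @ bar y # G" using snoc by simp
    have dist: "distinct ?w" by (rule valid_distinct[OF 1(2)])
    have nt: "\<not> tw d" "\<not> tw x" using dist 1(4) snoc by auto
    obtain d' where d: "?w \<leadsto>
       map (ren d d') (P @ D1) @ x # map (ren d d') (A @ y # E) @ bar x # d' # map (ren d d') (F @ bar y # G)"
      "tws (map (ren d d') (P @ D1) @ x # map (ren d d') (A @ y # E) @ bar x # d' # map (ren d d') (F @ bar y # G)) \<subseteq> tws ?w"
      using slide_left_untwisted[OF 1(2)[unfolded w] nt] unfolding w by blast
    have "d \<notin> set P" using dist snoc by auto
    then have P: "map (ren d d') P = P" by (rule map_ren_closed[OF 1(3)])
    have "y \<noteq> bar d" "bar y \<noteq> bar d" using dist snoc by auto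
    then have y: "ren d d' y = y" "ren d d' (bar y) = bar y" by (simp_all add: ren_def)
    let ?r = "map (ren d d')"
    let ?w' = "P @ ?r D1 @ x # ?r A @ y # ?r E @ bar x # (d' # ?r F) @ bar y # ?r G"
    have s: "?w \<leadsto> ?w'" "tws ?w' \<subseteq> tws ?w" using d P y by simp_all
    have t: "tws ?w' \<subseteq> set P" by (rule subset_trans[OF s(2) 1(4)])
    have v: "valid ?w'" using slide_conn_valid[OF s(1) 1(2)] by blast
    have "length (?r D1) < length D" using snoc by simp
    from 1(1)[rule_format, OF this v 1(3) t] obtain A' E' F' G' where
      i: "?w' \<leadsto> P @ x # A' @ y # E' @ bar x # F' @ bar y # G'" "tws (P @ x # A' @ y # E' @ bar x # F' @ bar y # G') \<subseteq> set P"
      by blast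
    show ?thesis using rtranclp_trans[OF s(1) i(1)] i(2) by blast
  qed
qed

lemma untwisted_clear_first:
  assumes "valid (P @ x # A @ y # E @ bar x # F @ bar y # G)" "closed P"
    "tws (P @ x # A @ y # E @ bar x # F @ bar y # G) \<subseteq> set P"
  shows "\<exists>E' F' G'. P @ x # A @ y # E @ bar x # F @ bar y # G \<leadsto> P @ x # y # E' @ bar x # F' @ bar y # G' \<and>
     tws (P @ x # y # E' @ bar x # F' @ bar y # G') \<subseteq> set P"
  using assms
proof (induction A arbitrary: E F G rule: length_induct)
  case (1 A)
  show ?case
  proof (cases A)
    case Nil
    then show ?thesis using 1(4) by auto
  next
    case (Cons e A1)
    let ?w = "P @ x # A @ y # E @ bar x # F @ bar y # G"
    have w: "?w = P @ x # e # (A1 @ y # E) @ bar x # F @ bar y # G" using Cons by simp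
    have dist: "distinct ?w" by (rule valid_distinct[OF 1(2)])
    have nt: "\<not> tw e" "\<not> tw x" using dist 1(4) Cons by auto
    obtain e' where d: "?w \<leadsto>
       map (ren e e') P @ x # map (ren e e') (A1 @ y # E) @ e' # bar x # map (ren e e') (F @ bar y # G)"
      "tws (map (ren e e') P @ x # map (ren e e') (A1 @ y # E) @ e' # bar x # map (ren e e') (F @ bar y # G)) \<subseteq> tws ?w"
      using slide_right_untwisted[OF 1(2)[unfolded w] nt] unfolding w by blast
    have "e \<notin> set P" using dist Cons by auto
    then have P: "map (ren e e') P = P" by (rule map_ren_closed[OF 1(3)])
    have "y \<noteq> bar e" "bar y \<noteq> bar e" using dist Cons by auto
    then have y: "ren e e' y = y" "ren e e' (bar y) = bar y" by (simp_all add: ren_def)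
    let ?r = "map (ren e e')"
    let ?w' = "P @ x # ?r A1 @ y # (?r E @ [e']) @ bar x # ?r F @ bar y # ?r G"
    have s: "?w \<leadsto> ?w'" "tws ?w' \<subseteq> tws ?w" using d P y by simp_all
    have t: "tws ?w' \<subseteq> set P" by (rule subset_trans[OF s(2) 1(4)])
    have v: "valid ?w'" using slide_conn_valid[OF s(1) 1(2)] by blast
    have "length (?r A1) < length A" using Cons by simp
    from 1(1)[rule_format, OF this v 1(3) t] obtain E' F' G' where
      i: "?w' \<leadsto> P @ x # y # E' @ bar x # F' @ bar y # G'" "tws (P @ x # y # E' @ bar x # F' @ bar y # G') \<subseteq> set P"
      by blast
    show ?thesis using rtranclp_trans[OF s(1) i(1)] i(2) by blast
  qed
qed

lemma untwisted_clear_second: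
  assumes "valid (P @ x # y # E @ bar x # F @ bar y # G)" "closed P"
    "tws (P @ x # y # E @ bar x # F @ bar y # G) \<subseteq> set P"
  shows "\<exists>F' G'. P @ x # y # E @ bar x # F @ bar y # G \<leadsto> P @ x # y # bar x # F' @ bar y # G' \<and>
     tws (P @ x # y # bar x # F' @ bar y # G') \<subseteq> set P"
  using assms
proof (induction E arbitrary: F G rule: length_induct)
  case (1 E)
  show ?case
  proof (cases E)
    case Nil
    then show ?thesis using 1(4) by auto
  next
    case (Cons e E1)
    let ?w = "P @ x # y # E @ bar x # F @ bar y # G"
    have w: "?w = (P @ [x]) @ y # e # (E1 @ bar x # F) @ bar y # G" using Cons by simp
    have dist: "distinct ?w" by (rule valid_distinct[OF 1(2)])
    have nt: "\<not> tw e" "\<not> tw y" using dist 1(4) Cons by auto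
    obtain e' where d: "?w \<leadsto>
       map (ren e e') (P @ [x]) @ y # map (ren e e') (E1 @ bar x # F) @ e' # bar y # map (ren e e') G"
      "tws (map (ren e e') (P @ [x]) @ y # map (ren e e') (E1 @ bar x # F) @ e' # bar y # map (ren e e') G) \<subseteq> tws ?w"
      using slide_right_untwisted[OF 1(2)[unfolded w] nt] unfolding w by blast
    have "e \<notin> set P" using dist Cons by auto
    then have P: "map (ren e e') P = P" by (rule map_ren_closed[OF 1(3)])
    have "x \<noteq> bar e" "bar x \<noteq> bar e" using dist Cons by auto
    then have x: "ren e e' x = x" "ren e e' (bar x) = bar x" by (simp_all add: ren_def)
    let ?r = "map (ren e e')"
    let ?w' = "P @ x # y # ?r E1 @ bar x # (?r F @ [e']) @ bar y # ?r G"
    have s: "?w \<leadsto> ?w'" "tws ?w' \<subseteq> tws ?w" using d P x by simp_all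
    have t: "tws ?w' \<subseteq> set P" by (rule subset_trans[OF s(2) 1(4)])
    have v: "valid ?w'" using slide_conn_valid[OF s(1) 1(2)] by blast
    have "length (?r E1) < length E" using Cons by simp
    from 1(1)[rule_format, OF this v 1(3) t] obtain F' G' where
      i: "?w' \<leadsto> P @ x # y # bar x # F' @ bar y # G'" "tws (P @ x # y # bar x # F' @ bar y # G') \<subseteq> set P"
      by blast
    show ?thesis using rtranclp_trans[OF s(1) i(1)] i(2) by blast
  qed
qed

text \<open>The last letter of \<open>F\<close> stands before \<open>bar y\<close>. It slides over
  \<open>bar y\<close> to the place after \<open>y\<close>, then over \<open>bar x\<close> to the
  place after \<open>x\<close>, where it is just before \<open>y\<close>, and then over
  \<open>y\<close> to the place after \<open>bar y\<close>.\<close>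

lemma untwisted_clear_third:
  assumes "valid (P @ x # y # bar x # F @ bar y # G)" "closed P"
    "tws (P @ x # y # bar x # F @ bar y # G) \<subseteq> set P"
  shows "\<exists>G'. P @ x # y # bar x # F @ bar y # G \<leadsto> P @ x # y # bar x # bar y # G' \<and>
     tws (P @ x # y # bar x # bar y # G') \<subseteq> set P"
  using assms
proof (induction F arbitrary: G rule: length_induct)
  case (1 F)
  show ?case
  proof (cases F rule: rev_cases)
    case Nil
    then show ?thesis using 1(4) by auto
  next
    case (snoc F1 f)
    let ?w = "P @ x # y # bar x # F @ bar y # G"
    let ?u = "(P @ [x]) @ bar (bar y) # (bar x # F1) @ f # bar y # G"
    have v0: "valid ?u" using 1(2) snoc by simp
    have dist: "distinct ?w" by (rule valid_distinct[OF 1(2)])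
    have nt: "\<not> tw f" "\<not> tw x" "\<not> tw y" using dist 1(4) snoc by auto
    have nty: "\<not> tw (bar y)" "\<not> tw (bar x)" using nt by simp_all
    obtain f1 where f1: "\<not> tw f1" "?u \<leadsto>
       map (ren f f1) (P @ [x]) @ bar (bar y) # f1 # map (ren f f1) (bar x # F1) @ bar y # map (ren f f1) G"
      "tws (map (ren f f1) (P @ [x]) @ bar (bar y) # f1 # map (ren f f1) (bar x # F1) @ bar y # map (ren f f1) G) \<subseteq> tws ?u"
      using slide_left'_untwisted[OF v0 nt(1) nty(1)] by blast
    have "f \<notin> set P" using dist snoc by auto
    then have P: "map (ren f f1) P = P" by (rule map_ren_closed[OF 1(3)])
    have "x \<noteq> bar f" "bar x \<noteq> bar f" using dist snoc by auto
    then have x: "ren f f1 x = x" "ren f f1 (bar x) = bar x" by (simp_all add: ren_def)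
    let ?ra = "map (ren f f1)"
    let ?ua = "P @ x # y # f1 # bar x # ?ra F1 @ bar y # ?ra G"
    have s1: "?w \<leadsto> ?ua" "tws ?ua \<subseteq> tws ?w" using f1(2,3) P x snoc by simp_all
    have v1: "valid ?ua" using slide_conn_valid[OF s1(1) 1(2)] by blast
    have d1: "distinct ?ua" by (rule valid_distinct[OF v1])
    have v1': "valid (P @ bar (bar x) # [y] @ f1 # bar x # ?ra F1 @ bar y # ?ra G)" using v1 by simp
    obtain f2 where f2: "\<not> tw f2" "P @ bar (bar x) # [y] @ f1 # bar x # ?ra F1 @ bar y # ?ra G \<leadsto>
       map (ren f1 f2) P @ bar (bar x) # f2 # map (ren f1 f2) [y] @ bar x # map (ren f1 f2) (?ra F1 @ bar y # ?ra G)"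
      "tws (map (ren f1 f2) P @ bar (bar x) # f2 # map (ren f1 f2) [y] @ bar x # map (ren f1 f2) (?ra F1 @ bar y # ?ra G))
        \<subseteq> tws (P @ bar (bar x) # [y] @ f1 # bar x # ?ra F1 @ bar y # ?ra G)"
      using slide_left'_untwisted[OF v1' f1(1) nty(2)] by blast
    have "f1 \<notin> set P" using d1 by auto
    then have P1: "map (ren f1 f2) P = P" by (rule map_ren_closed[OF 1(3)])
    have "y \<noteq> bar f1" "bar y \<noteq> bar f1" using d1 by auto
    then have y1: "ren f1 f2 y = y" "ren f1 f2 (bar y) = bar y" by (simp_all add: ren_def)
    let ?Fb = "map (ren f1 f2) (?ra F1)" and ?Gb = "map (ren f1 f2) (?ra G)"
    let ?ub = "P @ x # f2 # y # bar x # ?Fb @ bar y # ?Gb"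
    have s2: "?ua \<leadsto> ?ub" "tws ?ub \<subseteq> tws ?ua" using f2(2,3) P1 y1 by simp_all
    have v2: "valid ?ub" using slide_conn_valid[OF s2(1) v1] by blast
    have d2: "distinct ?ub" by (rule valid_distinct[OF v2])
    let ?ubp = "(P @ [x]) @ f2 # y # (bar x # ?Fb) @ bar y # ?Gb"
    have v2': "valid ?ubp" using v2 by simp
    obtain f3 where f3: "?ubp \<leadsto>
       map (ren f2 f3) (P @ [x]) @ y # map (ren f2 f3) (bar x # ?Fb) @ bar y # f3 # map (ren f2 f3) ?Gb"
      "tws (map (ren f2 f3) (P @ [x]) @ y # map (ren f2 f3) (bar x # ?Fb) @ bar y # f3 # map (ren f2 f3) ?Gb) \<subseteq> tws ?ubp"
      using slide_left_untwisted[OF v2' f2(1) nt(3)] by blast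
    have "f2 \<notin> set P" using d2 by auto
    then have P2: "map (ren f2 f3) P = P" by (rule map_ren_closed[OF 1(3)])
    have "x \<noteq> bar f2" "bar x \<noteq> bar f2" using d2 by auto
    then have x2: "ren f2 f3 x = x" "ren f2 f3 (bar x) = bar x" by (simp_all add: ren_def)
    let ?Fc = "map (ren f2 f3) ?Fb" and ?Gc = "f3 # map (ren f2 f3) ?Gb"
    let ?uc = "P @ x # y # bar x # ?Fc @ bar y # ?Gc"
    have s3: "?ub \<leadsto> ?uc" "tws ?uc \<subseteq> tws ?ub" using f3 P2 x2 by simp_all
    have s: "?w \<leadsto> ?uc" by (rule rtranclp_trans[OF s1(1) rtranclp_trans[OF s2(1) s3(1)]])
    have t: "tws ?uc \<subseteq> set P"
      by (rule subset_trans[OF s3(2) subset_trans[OF s2(2) subset_trans[OF s1(2) 1(4)]]])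
    have v: "valid ?uc" using slide_conn_valid[OF s 1(2)] by blast
    have "length ?Fc < length F" using snoc by simp
    from 1(1)[rule_format, OF this v 1(3) t] obtain G' where
      i: "?uc \<leadsto> P @ x # y # bar x # bar y # G'" "tws (P @ x # y # bar x # bar y # G') \<subseteq> set P"
      by blast
    show ?thesis using rtranclp_trans[OF s i(1)] i(2) by blast
  qed
qed

text \<open>Take an edge with the fewest letters between its ends. If there are none, its ends are
  adjacent. Otherwise the first letter between them has its other end outside, by minimality, and
  the two edges interleave.\<close>

lemma innermost_pair:
  assumes "closed u" "u \<noteq> []"
  shows "(\<exists>X h Y. u = X @ h # bar h # Y) \<or> (\<exists>x y D A E F G. u = D @ x # A @ y # E @ bar x # F @ bar y # G)"
proof -
  define S where "S = {length A |A D h C. u = D @ h # A @ bar h # C}"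
  obtain h0 where h0: "h0 \<in> set u" using assms(2) by (cases u) auto
  then have "bar h0 \<in> set u" using assms(1) by (simp add: closed_def)
  then obtain y0 D0 A0 C0 where "u = D0 @ y0 # A0 @ bar y0 # C0" using pair_split h0 by metis
  then have "length A0 \<in> S" unfolding S_def by blast
  then have "(LEAST n. n \<in> S) \<in> S" by (rule LeastI)
  then have "\<exists>A D h C. (LEAST n. n \<in> S) = length A \<and> u = D @ h # A @ bar h # C"
    unfolding S_def mem_Collect_eq .
  then obtain A D h C where A: "(LEAST n. n \<in> S) = length A" "u = D @ h # A @ bar h # C" by metis
  have min: "length A \<le> length A'" if "u = D' @ h' # A' @ bar h' # C'" for D' h' A' C'
    unfolding A(1)[symmetric] by (rule Least_le) (use that in \<open>auto simp: S_def\<close>)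
  show ?thesis
  proof (cases A)
    case Nil
    then show ?thesis using A(2) by auto
  next
    case (Cons y A2)
    have "y \<in> set u" using A(2) Cons by simp
    then have "bar y \<in> set u" using assms(1) by (simp add: closed_def)
    moreover have "bar y \<noteq> y" by simp
    ultimately consider "bar y \<in> set D" | "bar y = h" | "bar y \<in> set A2" | "bar y = bar h" | "bar y \<in> set C"
      using A(2) Cons by auto
    then show ?thesis
    proof cases
      case 1
      then obtain D1 D2 where "D = D1 @ bar y # D2" by (metis split_list)
      then have "u = D1 @ bar y # D2 @ h # [] @ bar (bar y) # A2 @ bar h # C" using A(2) Cons by simp
      then show ?thesis by blast
    next
      case 2
      then have "h = bar y" by simp
      then have "u = D @ h # [] @ bar h # A2 @ bar h # C" using A(2) Cons by simp
      then have "length A \<le> length ([] :: hedge list)" by (rule min)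
      then show ?thesis using Cons by simp
    next
      case 3
      then obtain A3 A4 where "A2 = A3 @ bar y # A4" by (metis split_list)
      then have "u = (D @ [h]) @ y # A3 @ bar y # A4 @ bar h # C" "length A3 < length A" using A(2) Cons by auto
      then show ?thesis using min[of "D @ [h]" y A3 "A4 @ bar h # C"] by simp
    next
      case 4
      then have "y = h" by simp
      then have "u = (D @ [h]) @ h # A2 @ bar h # C" using A(2) Cons by simp
      then show ?thesis using min[of "D @ [h]" h A2 C] Cons by simp
    next
      case 5
      then obtain C1 C2 where "C = C1 @ bar y # C2" by (metis split_list)
      then have "u = D @ h # [] @ y # A2 @ bar h # C1 @ bar y # C2" using A(2) Cons by simp
      then show ?thesis by blast
    qed
  qed
qed

text \<open>An interleaved pair whose gaps are cleared joins the prefix as one block. The recursion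
  stops when nothing remains or when it meets an untwisted edge with adjacent ends; for words with
  one face the latter is excluded by \<open>no_contractible_loop\<close>.\<close>

lemma extract_handle_blocks:
  assumes "valid (P @ u)" "closed P" "tws (P @ u) \<subseteq> set P"
  shows "\<exists>Q u'. P @ u \<leadsto> P @ Q @ u' \<and> handle_blocks Q \<and> (u' = [] \<or> (\<exists>X h Y. u' = X @ h # bar h # Y \<and> \<not> tw h))"
  using assms
proof (induction u arbitrary: P rule: length_induct)
  case (1 u)
  have cu: "closed u" by (rule valid_closed_rest[OF 1(2,3)])
  have nt: "\<not> tw h" if "h \<in> set u" for h using that 1(2,4) by (auto simp: valid_def)
  consider "u = []" | "\<exists>X h Y. u = X @ h # bar h # Y"
    | "\<exists>x y D A E F G. u = D @ x # A @ y # E @ bar x # F @ bar y # G"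
    using innermost_pair[OF cu] by blast
  then show ?case
  proof cases
    case 1
    then show ?thesis by (intro exI[of _ "[]"] exI[of _ u]) (auto intro: handle_blocks.intros)
  next
    case 2
    then obtain X h Y where u: "u = X @ h # bar h # Y" by blast
    then have "\<not> tw h" using nt by simp
    then show ?thesis using u by (intro exI[of _ "[]"] exI[of _ u]) (auto intro: handle_blocks.intros)
  next
    case 3
    then obtain x y D A E F G where u: "u = D @ x # A @ y # E @ bar x # F @ bar y # G" by blast
    have xy: "\<not> tw x" "\<not> tw y" using nt u by auto
    obtain A1 E1 F1 G1 where s1: "P @ u \<leadsto> P @ x # A1 @ y # E1 @ bar x # F1 @ bar y # G1"
      "tws (P @ x # A1 @ y # E1 @ bar x # F1 @ bar y # G1) \<subseteq> set P"
      using untwisted_clear_left[OF 1(2)[unfolded u] 1(3) 1(4)[unfolded u]] unfolding u by blast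
    note v1 = conjunct1[OF slide_conn_valid[OF s1(1) 1(2)]]
    obtain E2 F2 G2 where s2: "P @ x # A1 @ y # E1 @ bar x # F1 @ bar y # G1 \<leadsto> P @ x # y # E2 @ bar x # F2 @ bar y # G2"
      "tws (P @ x # y # E2 @ bar x # F2 @ bar y # G2) \<subseteq> set P"
      using untwisted_clear_first[OF v1 1(3) s1(2)] by blast
    note v2 = conjunct1[OF slide_conn_valid[OF s2(1) v1]]
    obtain F3 G3 where s3: "P @ x # y # E2 @ bar x # F2 @ bar y # G2 \<leadsto> P @ x # y # bar x # F3 @ bar y # G3"
      "tws (P @ x # y # bar x # F3 @ bar y # G3) \<subseteq> set P"
      using untwisted_clear_second[OF v2 1(3) s2(2)] by blast
    note v3 = conjunct1[OF slide_conn_valid[OF s3(1) v2]]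
    obtain G4 where s4: "P @ x # y # bar x # F3 @ bar y # G3 \<leadsto> P @ x # y # bar x # bar y # G4"
      "tws (P @ x # y # bar x # bar y # G4) \<subseteq> set P"
      using untwisted_clear_third[OF v3 1(3) s3(2)] by blast
    let ?P = "P @ [x, y, bar x, bar y]"
    have s: "P @ u \<leadsto> ?P @ G4"
      using rtranclp_trans[OF s1(1) rtranclp_trans[OF s2(1) rtranclp_trans[OF s3(1) s4(1)]]] by simp
    have v: "valid (?P @ G4)" "length (?P @ G4) = length (P @ u)" using slide_conn_valid[OF s 1(2)] by auto
    have c: "closed ?P" using 1(3) by (auto simp: closed_def)
    have "tws (?P @ G4) \<subseteq> set ?P" using s4(2) by auto
    moreover have "length G4 < length u" using v(2) by simp
    ultimately obtain Q u' where Q: "?P @ G4 \<leadsto> ?P @ Q @ u'" "handle_blocks Q"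
      "u' = [] \<or> (\<exists>X h Y. u' = X @ h # bar h # Y \<and> \<not> tw h)"
      using 1(1) v(1) c by blast
    have "P @ u \<leadsto> P @ (x # y # bar x # bar y # Q) @ u'" using rtranclp_trans[OF s Q(1)] by simp
    moreover have "handle_blocks (x # y # bar x # bar y # Q)" using xy Q(2) by (rule handle_blocks.intros)
    ultimately show ?thesis using Q(3) by blast
  qed
qed

section \<open>Trading handles for projective planes\<close>

lemma slide_right'_twisted:
  assumes "valid (X @ bar b # Y @ b # a # Z)" "tw b"
  shows "\<exists>a'. a' \<notin> set (X @ bar b # Y @ b # a # Z) \<and> bar a' \<notin> set (X @ bar b # Y @ b # a # Z) \<and>
    tw a' = (\<not> tw a) \<and>
    X @ bar b # Y @ b # a # Z \<leadsto> map (ren a a') X @ bar b # a' # map (ren a a') Y @ b # map (ren a a') Z"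
proof -
  have "valid (rev Z @ a # b # rev Y @ bar b # rev X)"
    using rev_invariants(1)[OF assms(1)] by simp
  then obtain a' where a': "a' \<notin> set (rev Z @ a # b # rev Y @ bar b # rev X)"
    "bar a' \<notin> set (rev Z @ a # b # rev Y @ bar b # rev X)" "tw a' = (\<not> tw a)"
    "rev Z @ a # b # rev Y @ bar b # rev X \<leadsto>
      map (ren a a') (rev Z) @ b # map (ren a a') (rev Y) @ a' # bar b # map (ren a a') (rev X)"
    using slide_left_twisted assms(2) by blast
  have "X @ bar b # Y @ b # a # Z \<leadsto> map (ren a a') X @ bar b # a' # map (ren a a') Y @ b # map (ren a a') Z"
    using slide_conn_rev[OF a'(4)] by (simp add: rev_map)
  then show ?thesis using a'(1-3) by (intro exI[of _ a']) auto
qed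

text \<open>The word form of Dyck's theorem: the connected sum of a projective plane and a torus is the
  connected sum of three projective planes.\<close>

lemma twisted_absorbs_handle:
  assumes v: "valid (P @ x # bar x # y # z # bar y # bar z # C)" and P: "closed P" and C: "closed C"
    and t: "tw x" "\<not> tw y" "\<not> tw z"
  shows "\<exists>p q r. tw p \<and> tw q \<and> tw r \<and>
    P @ x # bar x # y # z # bar y # bar z # C \<leadsto> P @ p # bar p # q # bar q # r # bar r # C"
proof -
  let ?wa = "P @ x # bar x # y # z # bar y # bar z # C"
  have d: "distinct ?wa" by (rule valid_distinct[OF v])
  \<comment> \<open>Sliding \<open>y\<close> over the twisted edge of \<open>x\<close> makes it
    twisted and places it between the ends of \<open>x\<close>.\<close>
  have v': "valid (P @ bar (bar x) # [] @ bar x # y # [z, bar y, bar z] @ C)" using v by simp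
  obtain y1 where y1: "tw y1" "P @ bar (bar x) # [] @ bar x # y # [z, bar y, bar z] @ C \<leadsto>
     map (ren y y1) P @ bar (bar x) # y1 # map (ren y y1) [] @ bar x # map (ren y y1) ([z, bar y, bar z] @ C)"
    using slide_right'_twisted[OF v'] t by auto
  have e: "y \<notin> set P" "y \<notin> set C" "z \<noteq> bar y" "bar z \<noteq> bar y" using d by auto
  let ?wb = "P @ x # y1 # bar x # z # bar y1 # bar z # C"
  have s1: "?wa \<leadsto> ?wb"
    using y1(2) e map_ren_closed[OF P e(1)] map_ren_closed[OF C e(2)] by (simp add: ren_def)
  note vb = conjunct1[OF slide_conn_valid[OF s1 v]]
  note db = valid_distinct[OF vb]
  \<comment> \<open>The block of \<open>y1\<close> is formed as in \<open>twisted_clear_left\<close>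
    and \<open>twisted_clear_inside\<close>: \<open>x\<close> is moved from before \<open>y1\<close>
    to the inside, and then the three letters inside leave to the right one by one.\<close>
  have "valid (P @ x # y1 # [bar x, z] @ bar y1 # bar z # C)" using vb by simp
  then obtain x1 where x1: "tw x1 = (\<not> tw x)" "P @ x # y1 # [bar x, z] @ bar y1 # bar z # C \<leadsto>
     map (ren x x1) P @ y1 # map (ren x x1) [bar x, z] @ x1 # bar y1 # map (ren x x1) (bar z # C)"
    using slide_left_twisted[OF _ y1(1)] by blast
  have e: "x \<notin> set P" "x \<notin> set C" "z \<noteq> bar x" "bar z \<noteq> bar x" using db by auto
  let ?wc = "P @ y1 # bar x1 # z # x1 # bar y1 # bar z # C"
  have s2: "?wb \<leadsto> ?wc"
    using x1(2) e map_ren_closed[OF P e(1)] map_ren_closed[OF C e(2)] by (simp add: ren_def)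
  note vc = conjunct1[OF slide_conn_valid[OF s2 vb]]
  note dc = valid_distinct[OF vc]
  have "valid (P @ y1 # bar x1 # [z, x1] @ bar y1 # bar z # C)" using vc by simp
  then obtain x2 where x2: "tw x2 = (\<not> tw (bar x1))" "P @ y1 # bar x1 # [z, x1] @ bar y1 # bar z # C \<leadsto>
     map (ren (bar x1) x2) P @ y1 # map (ren (bar x1) x2) [z, x1] @ bar y1 # x2 # map (ren (bar x1) x2) (bar z # C)"
    using slide_right_twisted[OF _ y1(1)] by blast
  have e: "bar x1 \<notin> set P" "bar x1 \<notin> set C" "z \<noteq> x1" "bar z \<noteq> x1" using dc by auto
  let ?wd = "P @ y1 # z # bar x2 # bar y1 # x2 # bar z # C"
  have s3: "?wc \<leadsto> ?wd"
    using x2(2) e map_ren_closed[OF P e(1)] map_ren_closed[OF C e(2)] by (simp add: ren_def)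
  note vd = conjunct1[OF slide_conn_valid[OF s3 vc]]
  note dd = valid_distinct[OF vd]
  have "valid (P @ y1 # z # [bar x2] @ bar y1 # [x2, bar z] @ C)" using vd by simp
  then obtain z1 where z1: "tw z1 = (\<not> tw z)" "P @ y1 # z # [bar x2] @ bar y1 # [x2, bar z] @ C \<leadsto>
     map (ren z z1) P @ y1 # map (ren z z1) [bar x2] @ bar y1 # z1 # map (ren z z1) ([x2, bar z] @ C)"
    using slide_right_twisted[OF _ y1(1)] by blast
  have e: "z \<notin> set P" "z \<notin> set C" "bar x2 \<noteq> bar z" "x2 \<noteq> bar z" using dd by auto
  let ?we = "P @ y1 # bar x2 # bar y1 # z1 # x2 # bar z1 # C"
  have s4: "?wd \<leadsto> ?we"
    using z1(2) e map_ren_closed[OF P e(1)] map_ren_closed[OF C e(2)] by (simp add: ren_def)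
  note ve = conjunct1[OF slide_conn_valid[OF s4 vd]]
  note de = valid_distinct[OF ve]
  have "valid (P @ y1 # bar x2 # [] @ bar y1 # [z1, x2, bar z1] @ C)" using ve by simp
  then obtain x3 where x3: "tw x3 = (\<not> tw (bar x2))" "P @ y1 # bar x2 # [] @ bar y1 # [z1, x2, bar z1] @ C \<leadsto>
     map (ren (bar x2) x3) P @ y1 # map (ren (bar x2) x3) [] @ bar y1 # x3 # map (ren (bar x2) x3) ([z1, x2, bar z1] @ C)"
    using slide_right_twisted[OF _ y1(1)] by blast
  have e: "bar x2 \<notin> set P" "bar x2 \<notin> set C" "z1 \<noteq> x2" "bar z1 \<noteq> x2" using de by auto
  let ?P = "P @ [y1, bar y1]"
  let ?wf = "?P @ x3 # z1 # bar x3 # bar z1 # C"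
  have s5: "?we \<leadsto> ?wf"
    using x3(2) e map_ren_closed[OF P e(1)] map_ren_closed[OF C e(2)] by (simp add: ren_def)
  note vf = conjunct1[OF slide_conn_valid[OF s5 ve]]
  note df = valid_distinct[OF vf]
  have P': "closed ?P" using P by (auto simp: closed_def)
  \<comment> \<open>Sliding over \<open>y1\<close> has made the edge of \<open>z\<close> twisted, so
    it forms the second block in the same way. The edge that started as \<open>x\<close> is what
    remains.\<close>
  have tz: "tw z1" using z1(1) t by simp
  have "valid (?P @ x3 # z1 # [bar x3] @ bar z1 # C)" using vf by simp
  then obtain x4 where x4: "tw x4 = (\<not> tw x3)" "?P @ x3 # z1 # [bar x3] @ bar z1 # C \<leadsto>
     map (ren x3 x4) ?P @ z1 # map (ren x3 x4) [bar x3] @ x4 # bar z1 # map (ren x3 x4) C"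
    using slide_left_twisted[OF _ tz] by blast
  have e: "x3 \<notin> set ?P" "x3 \<notin> set C" using df by auto
  let ?wg = "?P @ z1 # bar x4 # x4 # bar z1 # C"
  have s6: "?wf \<leadsto> ?wg"
    using x4(2) unfolding map_ren_closed[OF P' e(1)] map_ren_closed[OF C e(2)] by (simp add: ren_def)
  note vg = conjunct1[OF slide_conn_valid[OF s6 vf]]
  note dg = valid_distinct[OF vg]
  have "valid (?P @ z1 # bar x4 # [x4] @ bar z1 # C)" using vg by simp
  then obtain x5 where x5: "tw x5 = (\<not> tw (bar x4))" "?P @ z1 # bar x4 # [x4] @ bar z1 # C \<leadsto>
     map (ren (bar x4) x5) ?P @ z1 # map (ren (bar x4) x5) [x4] @ bar z1 # x5 # map (ren (bar x4) x5) C"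
    using slide_right_twisted[OF _ tz] by blast
  have e: "bar x4 \<notin> set ?P" "bar x4 \<notin> set C" using dg by auto
  let ?wh = "?P @ z1 # bar x5 # bar z1 # x5 # C"
  have s7: "?wg \<leadsto> ?wh"
    using x5(2) unfolding map_ren_closed[OF P' e(1)] map_ren_closed[OF C e(2)] by (simp add: ren_def)
  note vh = conjunct1[OF slide_conn_valid[OF s7 vg]]
  note dh = valid_distinct[OF vh]
  have "valid (?P @ z1 # bar x5 # [] @ bar z1 # x5 # C)" using vh by simp
  then obtain x6 where x6: "tw x6 = (\<not> tw (bar x5))" "?P @ z1 # bar x5 # [] @ bar z1 # x5 # C \<leadsto>
     map (ren (bar x5) x6) ?P @ z1 # map (ren (bar x5) x6) [] @ bar z1 # x6 # map (ren (bar x5) x6) (x5 # C)"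
    using slide_right_twisted[OF _ tz] by blast
  have e: "bar x5 \<notin> set ?P" "bar x5 \<notin> set C" using dh by auto
  let ?wi = "P @ y1 # bar y1 # z1 # bar z1 # x6 # bar x6 # C"
  have s8: "?wh \<leadsto> ?wi"
    using x6(2) unfolding map_ren_closed[OF P' e(1)] list.map map_ren_closed[OF C e(2)] by (simp add: ren_def)
  have "?wa \<leadsto> ?wi"
    using s1 s2 s3 s4 s5 s6 s7 s8 by (meson rtranclp_trans)
  \<comment> \<open>Each of the six slides of this edge over a twisted one reverses its twist, so it
    ends up twisted as it began.\<close>
  moreover have "tw x6" using x1(1) x2(1) x3(1) x4(1) x5(1) x6(1) t by simp
  ultimately show ?thesis using y1(1) tz by blast
qed

lemma twisted_blocks_append: "twisted_blocks Q \<Longrightarrow> twisted_blocks R \<Longrightarrow> twisted_blocks (Q @ R)"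
  by (induction rule: twisted_blocks.induct) (auto intro: twisted_blocks.intros)

lemma twisted_blocks_snoc:
  "twisted_blocks Q \<Longrightarrow> Q = [] \<or> (\<exists>P x. twisted_blocks P \<and> tw x \<and> Q = P @ [x, bar x])"
proof (induction rule: twisted_blocks.induct)
  case (2 x w)
  from 2(3) show ?case
  proof
    assume "w = []"
    then show ?thesis using 2(1) twisted_blocks.intros(1) by (intro disjI2 exI[of _ "[]"]) auto
  next
    assume "\<exists>P y. twisted_blocks P \<and> tw y \<and> w = P @ [y, bar y]"
    then obtain P y where "twisted_blocks P" "tw y" "w = P @ [y, bar y]" by blast
    then show ?thesis using twisted_blocks.intros(2)[OF 2(1), of P]
      by (intro disjI2 exI[of _ "x # bar x # P"]) auto
  qed
qed simp

text \<open>The last block of \<open>Q\<close> and the first handle of \<open>R\<close> become three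
  twisted blocks, so the prefix again ends in a twisted block and can absorb the next
  handle.\<close>

lemma twisted_absorbs_handles:
  assumes "handle_blocks R" "valid (Q @ R)" "twisted_blocks Q" "Q \<noteq> []"
  shows "\<exists>v. Q @ R \<leadsto> v \<and> twisted_blocks v"
  using assms
proof (induction arbitrary: Q rule: handle_blocks.induct)
  case 1
  then show ?case by auto
next
  case (2 y z R)
  obtain P x where P: "twisted_blocks P" "tw x" "Q = P @ [x, bar x]"
    using twisted_blocks_snoc[OF 2(6)] 2(7) by blast
  have v: "valid (P @ x # bar x # y # z # bar y # bar z # R)" using 2(5) P by simp
  obtain p q r where t: "tw p" "tw q" "tw r"
    and s: "P @ x # bar x # y # z # bar y # bar z # R \<leadsto> P @ p # bar p # q # bar q # r # bar r # R"
    using twisted_absorbs_handle[OF v twisted_blocks_closed[OF P(1)] handle_blocks_closed[OF 2(3)] P(2) 2(1,2)]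
    by blast
  let ?Q = "P @ [p, bar p, q, bar q, r, bar r]"
  have tQ: "twisted_blocks ?Q" using P(1) t by (intro twisted_blocks_append twisted_blocks.intros)
  have "valid (?Q @ R)" using slide_conn_valid[OF s v] by simp
  then obtain u where u: "?Q @ R \<leadsto> u" "twisted_blocks u" using 2(4)[of ?Q] tQ by auto
  have "Q @ y # z # bar y # bar z # R \<leadsto> ?Q @ R" using s P by simp
  then have "Q @ y # z # bar y # bar z # R \<leadsto> u" using u(1) by (rule rtranclp_trans)
  then show ?case using u(2) by blast
qed

section \<open>Words that agree up to the names of half-edges\<close>

definition relabels :: "(hedge \<Rightarrow> hedge) \<Rightarrow> hedge list \<Rightarrow> hedge list \<Rightarrow> bool" where
  "relabels \<rho> w v \<longleftrightarrow> v = map \<rho> w \<and> (\<forall>h\<in>set w. \<rho> (bar h) = bar (\<rho> h) \<and> tw (\<rho> h) = tw h)"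

lemma relabels_Cons_pair:
  assumes "relabels \<rho> w v" "x \<notin> set w" "bar x \<notin> set w" "closed w" "tw x = tw y"
  shows "\<exists>\<sigma>. relabels \<sigma> w v \<and> \<sigma> x = y \<and> \<sigma> (bar x) = bar y \<and> tw (\<sigma> x) = tw x \<and> (\<forall>z. z \<noteq> x \<longrightarrow> z \<noteq> bar x \<longrightarrow> \<sigma> z = \<rho> z)"
proof (intro exI conjI)
  let ?s = "\<rho>(x := y, bar x := bar y)"
  have 1: "?s h = \<rho> h" if "h \<in> set w" for h using that assms(2,3) by auto
  have 2: "bar h \<in> set w" if "h \<in> set w" for h using assms(4) that by (simp add: closed_def)
  have "map ?s w = map \<rho> w" using 1 by simp
  moreover have "?s (bar h) = bar (?s h) \<and> tw (?s h) = tw h" if h: "h \<in> set w" for h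
    using assms(1) h unfolding 1[OF h] 1[OF 2[OF h]] by (simp add: relabels_def)
  ultimately show "relabels ?s w v" using assms(1) unfolding relabels_def by simp
qed (use assms(5) in auto)

lemma twisted_blocks_relabel:
  assumes "twisted_blocks w" "twisted_blocks v" "length w = length v" "distinct w"
  shows "\<exists>\<rho>. relabels \<rho> w v"
  using assms
proof (induction arbitrary: v rule: twisted_blocks.induct)
  case 1
  then show ?case by (auto simp: relabels_def)
next
  case (2 x w)
  from 2(4) 2(5) obtain y v' where y: "tw y" "twisted_blocks v'" "v = y # bar y # v'"
    by (cases rule: twisted_blocks.cases) auto
  then obtain \<rho> where \<rho>: "relabels \<rho> w v'" using 2 by auto
  obtain \<sigma> where s: "relabels \<sigma> w v'" "\<sigma> x = y" "\<sigma> (bar x) = bar y"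
    using relabels_Cons_pair[OF \<rho>, of x y] 2(1,6) y(1) twisted_blocks_closed[OF 2(2)] by auto
  have "relabels \<sigma> (x # bar x # w) v"
    using s y 2(1) unfolding relabels_def by simp
  then show ?case by blast
qed

lemma handle_blocks_relabel:
  assumes "handle_blocks w" "handle_blocks v" "length w = length v" "distinct w"
  shows "\<exists>\<rho>. relabels \<rho> w v"
  using assms
proof (induction arbitrary: v rule: handle_blocks.induct)
  case 1
  then show ?case by (auto simp: relabels_def)
next
  case (2 x x' w)
  from 2(5) 2(6) obtain y y' v' where y: "\<not> tw y" "\<not> tw y'" "handle_blocks v'" "v = y # y' # bar y # bar y' # v'"
    by (cases rule: handle_blocks.cases) auto
  then obtain \<rho> where \<rho>: "relabels \<rho> w v'" using 2 by auto
  note c = handle_blocks_closed[OF 2(3)]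
  obtain \<sigma> where s: "relabels \<sigma> w v'" "\<sigma> x = y" "\<sigma> (bar x) = bar y"
    using relabels_Cons_pair[OF \<rho>, of x y] 2(1,7) y(1) c by auto
  obtain \<tau> where t: "relabels \<tau> w v'" "\<tau> x' = y'" "\<tau> (bar x') = bar y'" "\<And>z. z \<noteq> x' \<Longrightarrow> z \<noteq> bar x' \<Longrightarrow> \<tau> z = \<sigma> z"
    using relabels_Cons_pair[OF s(1), of x' y'] 2(2,7) y(2) c by auto
  have "x \<noteq> x'" "x \<noteq> bar x'" "bar x \<noteq> x'" "bar x \<noteq> bar x'" using 2(7) by auto
  then have "\<tau> x = y" "\<tau> (bar x) = bar y" using t(4) s(2,3) by metis+
  then have "relabels \<tau> (x # x' # bar x # bar x' # w) v"
    using t(1-3) y 2(1,2) unfolding relabels_def by simp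
  then show ?case by blast
qed

section \<open>Linking the cores\<close>

lemma relabels_map_iso:
  assumes W: "word_map \<kappa> w" and V: "word_map \<iota> v" and r: "relabels \<rho> w v"
  shows "map_iso (wmap \<kappa> w) (wmap \<iota> v)"
proof -
  interpret w: word_map \<kappa> w by fact
  interpret v: word_map \<iota> v by fact
  have v: "v = map \<rho> w" and bar: "\<And>h. h \<in> set w \<Longrightarrow> \<rho> (bar h) = bar (\<rho> h)" and tw: "\<And>h. h \<in> set w \<Longrightarrow> tw (\<rho> h) = tw h"
    using r by (auto simp: relabels_def)
  have injr: "inj_on \<rho> (set w)" using v.dist by (simp add: v distinct_map)
  let ?f = "map_prod \<rho> id"
  have f_in: "?f x \<in> sides v" if "x \<in> sides w" for x using that v by auto
  have injf: "inj_on ?f (sides w)" using injr by (auto simp: inj_on_def)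
  have im: "?f ` sides w = sides v"
  proof
    show "?f ` sides w \<subseteq> sides v" by (rule image_subsetI) (rule f_in)
    show "sides v \<subseteq> ?f ` sides w"
    proof
      fix y assume "y \<in> sides v"
      then obtain h s where "h \<in> set w" "y = (\<rho> h, s)" using v by auto
      then have "y = ?f (h, s)" "(h, s) \<in> sides w" by auto
      then show "y \<in> ?f ` sides w" by (rule image_eqI)
    qed
  qed
  have c0: "?f (wa0 x) = wa0 (?f x)" if "x \<in> sides w" for x
    using that bar tw by (cases x) auto
  have c1: "?f (wa1 w x) = wa1 v (?f x)" if x: "x \<in> sides w" for x
  proof -
    obtain h s where hs: "x = (h, s)" "h \<in> set w" using x by auto
    have "cycle_of_list v (\<rho> h) = \<rho> (cycle_of_list w h)"
      unfolding v by (rule cycle_of_list_map[OF w.dist injr hs(2)])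
    moreover have "cycle_of_list (rev v) (\<rho> h) = \<rho> (cycle_of_list (rev w) h)"
      using cycle_of_list_map[of "rev w" \<rho> h] w.dist injr hs(2) by (simp add: v rev_map)
    ultimately show ?thesis using hs by simp
  qed
  have c2: "?f (wa2 x) = wa2 (?f x)" for x by (cases x) auto
  define k where "k c = \<iota> (?f (inv_into (sides w) \<kappa> c))" for c
  have k: "k (\<kappa> x) = \<iota> (?f x)" if "x \<in> sides w" for x using that w.inj by (simp add: k_def)
  have "bij_betw (\<iota> \<circ> ?f \<circ> inv_into (sides w) \<kappa>) (\<kappa> ` sides w) (\<iota> ` sides v)"
    by (intro bij_betw_trans[OF bij_betw_inv_into[OF inj_on_imp_bij_betw[OF w.inj]]] bij_betw_trans[of ?f _ "sides v"])
       (use injf im v.inj in \<open>auto simp: bij_betw_def comp_assoc\<close>)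
  then have "bij_betw k (crosses (wmap \<kappa> w)) (crosses (wmap \<iota> v))"
    by (simp add: k_def[abs_def] comp_def)
  moreover have "k (alpha0 (wmap \<kappa> w) c) = alpha0 (wmap \<iota> v) (k c) \<and> k (alpha1 (wmap \<kappa> w) c) = alpha1 (wmap \<iota> v) (k c) \<and>
      k (alpha2 (wmap \<kappa> w) c) = alpha2 (wmap \<iota> v) (k c)" if c: "c \<in> crosses (wmap \<kappa> w)" for c
  proof -
    obtain x where x: "x \<in> sides w" "c = \<kappa> x" using c by auto
    note s = wa_sides[OF w.valid x(1)]
    show ?thesis using w.inj v.inj x s k f_in[OF x(1)] c0[OF x(1)] c1[OF x(1)] c2[of x] by simp
  qed
  ultimately show ?thesis unfolding map_iso_def by auto
qed

lemma inj_word_map: "inj \<iota> \<Longrightarrow> valid w \<Longrightarrow> word_map \<iota> w"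
  using inj_on_subset by (auto simp: word_map_def)

lemma wmap_in_cores:
  assumes "word_map \<iota> w" "nfaces w = 1" "signed_genus (wmap \<iota> w) = of_int g"
  shows "wmap \<iota> w \<in> cores g"
  using word_map.core_if_one_face[OF assms(1,2)] assms(3) by (simp add: cores_def)

lemma linked_relabel:
  assumes "word_map \<kappa> w" "word_map \<iota> v" "relabels \<rho> w v" "nfaces w = 1" "nfaces v = 1"
    "signed_genus (wmap \<kappa> w) = of_int g" "signed_genus (wmap \<iota> v) = of_int g"
  shows "(wmap \<kappa> w, wmap \<iota> v) \<in> linked g"
proof (rule linkedI)
  show "hom_exists (wmap \<kappa> w) (wmap \<iota> v) \<or> hom_exists (wmap \<iota> v) (wmap \<kappa> w)"
    using hom_exists_iso[OF _ _ _ relabels_map_iso[OF assms(1-3)]] word_map.is_map assms by metis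
qed (use wmap_in_cores assms in auto)

lemma signed_genus_wmap_cong:
  assumes "word_map \<kappa> w" "word_map \<iota> v" "weg v = weg w" "twisted v = twisted w"
  shows "signed_genus (wmap \<iota> v) = signed_genus (wmap \<kappa> w)"
  unfolding word_map.signed_genus[OF assms(1)] word_map.signed_genus[OF assms(2)] assms(3,4) ..

definition good :: "(hedge \<times> bool \<Rightarrow> 'a) \<Rightarrow> int \<Rightarrow> hedge list \<Rightarrow> bool" where
  "good \<iota> g w \<longleftrightarrow> valid w \<and> nfaces w = 1 \<and> signed_genus (wmap \<iota> w) = of_int g"

lemma slide_step_good:
  assumes \<iota>: "inj \<iota>" and s: "slide_step w v" and gw: "good \<iota> g w"
  shows "good \<iota> g v" "(wmap \<iota> w, wmap \<iota> v) \<in> linked g"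
proof -
  obtain A a b B a' where h: "handle_slide w A B a b a'" "v = concat (map (slide_out a b a') w)"
    using s by (auto simp: slide_step_def)
  interpret handle_slide w A B a b a' by (rule h(1))
  have v: "v = handle_slide.v w a b a'" unfolding h(2) v_def ..
  have W: "word_map \<iota> w" "word_map \<iota> v" using inj_word_map[OF \<iota>] valid valid_v v by auto
  have "weg v = weg w" "twisted v = twisted w" "nfaces v = nfaces w" "valid v"
    using invariants_m nfaces_m valid_v unfolding v by simp_all
  then show "good \<iota> g v"
    using gw signed_genus_wmap_cong[OF W] unfolding good_def by metis
  show "(wmap \<iota> w, wmap \<iota> v) \<in> linked g"
    unfolding v by (rule linked_slide[OF \<iota>]) (use gw in \<open>auto simp: good_def\<close>)
qed

lemma rev_good:
  assumes \<iota>: "inj \<iota>" and w: "good \<iota> g w"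
  shows "good \<iota> g (rev w)" "(wmap \<iota> w, wmap \<iota> (rev w)) \<in> linked g"
proof -
  have v: "valid w" using w by (simp add: good_def)
  note inv = rev_invariants[OF v]
  have W: "word_map \<iota> w" "word_map \<iota> (rev w)" using inj_word_map[OF \<iota>] v inv(1) by auto
  show r: "good \<iota> g (rev w)"
    using w inv signed_genus_wmap_cong[OF W inv(3,4)] unfolding good_def by metis
  show "(wmap \<iota> w, wmap \<iota> (rev w)) \<in> linked g"
  proof (rule linkedI)
    show "wmap \<iota> w \<in> cores g" "wmap \<iota> (rev w) \<in> cores g"
      using wmap_in_cores W w r by (auto simp: good_def)
    have "hom_exists (wmap \<iota> w) (wmap \<iota> (rev w))"
      by (rule hom_exists_iso) (use W word_map.is_map wmap_rev_iso w r in \<open>auto simp: good_def\<close>)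
    then show "hom_exists (wmap \<iota> w) (wmap \<iota> (rev w)) \<or> hom_exists (wmap \<iota> (rev w)) (wmap \<iota> w)" ..
  qed
qed

lemma slide_conn_good:
  assumes \<iota>: "inj \<iota>" and s: "w \<leadsto> v" and w: "good \<iota> g w"
  shows "good \<iota> g v \<and> (wmap \<iota> w, wmap \<iota> v) \<in> linked g"
  using s
proof (induction rule: rtranclp_induct)
  case base
  then show ?case using w linked_refl by blast
next
  case (step v u)
  then have v: "good \<iota> g v" "(wmap \<iota> w, wmap \<iota> v) \<in> linked g" by auto
  from step.hyps(2) have "good \<iota> g u \<and> (wmap \<iota> v, wmap \<iota> u) \<in> linked g"
  proof
    assume "slide_step v u"
    then show ?thesis using slide_step_good[OF \<iota> _ v(1)] by blast
  next
    \<comment> \<open>A mirrored slide is a detour through the maps of the reversed words, which are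
      isomorphic to the original ones.\<close>
    assume a: "slide_step (rev v) (rev u)"
    note r = rev_good[OF \<iota> v(1)]
    note s = slide_step_good[OF \<iota> a r(1)]
    note t = rev_good[OF \<iota> s(1)]
    have "(wmap \<iota> v, wmap \<iota> (rev (rev u))) \<in> linked g"
      by (rule linked_trans[OF r(2) linked_trans[OF s(2) t(2)]])
    then show ?thesis using t(1) by simp
  qed
  then show ?case using v(2) linked_trans by blast
qed

text \<open>An untwisted edge with adjacent ends bounds a face of degree one. As the only face it
  would contain all crosses, but it misses the other side of \<open>h\<close>.\<close>

lemma no_contractible_loop:
  assumes "valid w" "nfaces w = 1" "w = X @ h # bar h # Y"
  shows "tw h"
proof (rule ccontr)
  assume t: "\<not> tw h"
  have "distinct (X @ h # bar h # Y)" using assms by (simp add: valid_def)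
  note adj = wa1_adjacent[OF this, folded assms(3)]
  have h: "h \<in> set w" using assms(3) by simp
  have "gen_orbit {wa0, wa1 w} (h, True) \<subseteq> {(h, True), (bar h, False)}"
  proof (rule gen_orbit_least)
    fix x f assume "x \<in> {(h, True), (bar h, False)}" "f \<in> {wa0, wa1 w}"
    then show "f x \<in> {(h, True), (bar h, False)}" using adj t by (auto simp del: wa1.simps)
  qed simp
  then have "sides w \<subseteq> {(h, True), (bar h, False)}"
    using nfaces_one_orbit[OF assms(1,2), of "(h, True)"] h by simp
  moreover have "(h, False) \<in> sides w" using h by simp
  ultimately have "(h, False) \<in> {(h, True), (bar h, False)}" by (rule subsetD)
  then show False by simp
qed

text \<open>Twisted blocks are collected first, so that the rest is untwisted and splits into
  handles; a single twisted block suffices to absorb all of them.\<close>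

lemma normal_form:
  assumes \<iota>: "inj \<iota>" and w: "good \<iota> g w"
  shows "\<exists>v. w \<leadsto> v \<and> (twisted_blocks v \<or> handle_blocks v)"
proof -
  have v: "valid ([] @ w)" using w by (simp add: good_def)
  obtain Q u where Q: "w \<leadsto> Q @ u" "twisted_blocks Q" "\<forall>h\<in>set u. \<not> tw h"
    using extract_twisted_blocks[OF v] by (auto simp: closed_def)
  have vQ: "valid (Q @ u)" using slide_conn_valid[OF Q(1)] v by simp
  have "tws (Q @ u) \<subseteq> set Q" using Q(3) by auto
  then obtain R u' where R: "Q @ u \<leadsto> Q @ R @ u'" "handle_blocks R"
    "u' = [] \<or> (\<exists>X h Y. u' = X @ h # bar h # Y \<and> \<not> tw h)"
    using extract_handle_blocks[OF vQ twisted_blocks_closed[OF Q(2)]] by blast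
  have s: "w \<leadsto> Q @ R @ u'" using Q(1) R(1) by (rule rtranclp_trans)
  have g: "good \<iota> g (Q @ R @ u')" using slide_conn_good[OF \<iota> s w] by blast
  have "u' = []"
  proof (rule ccontr)
    assume "u' \<noteq> []"
    then obtain X h Y where u': "u' = X @ h # bar h # Y" "\<not> tw h" using R(3) by blast
    have "tw h"
      by (rule no_contractible_loop[of "Q @ R @ u'" "Q @ R @ X" h Y]) (use g u' in \<open>simp_all add: good_def\<close>)
    then show False using u'(2) by simp
  qed
  then have s: "w \<leadsto> Q @ R" using s by simp
  show ?thesis
  proof (cases "Q = []")
    case True
    then show ?thesis using s R(2) by auto
  next
    case False
    have "valid (Q @ R)" using slide_conn_valid[OF s] v by simp
    then obtain z where z: "Q @ R \<leadsto> z" "twisted_blocks z"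
      using twisted_absorbs_handles[OF R(2) _ Q(2) False] by blast
    have "w \<leadsto> z" using s z(1) by (rule rtranclp_trans)
    then show ?thesis using z(2) by blast
  qed
qed

lemma good_words_linked:
  assumes \<iota>: "inj \<iota>" and w: "good \<iota> g w" and v: "good \<iota> g v"
  shows "(wmap \<iota> w, wmap \<iota> v) \<in> linked g"
proof -
  \<comment> \<open>With one vertex and one face the Euler genus is the number of edges, hence
    positive. It equals \<open>- g\<close> for twisted words and \<open>2 * g\<close> for untwisted
    ones, so \<open>g\<close> determines the kind of blocks and the length, which is twice the
    number of edges.\<close>
  have signs: "(g < 0 \<longleftrightarrow> twisted_blocks z) \<and> (g > 0 \<longleftrightarrow> handle_blocks z) \<and>
      length z = (if g < 0 then 2 * nat (- g) else 4 * nat g)"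
    if z: "good \<iota> g z" "twisted_blocks z \<or> handle_blocks z" for z
  proof -
    have val: "valid z" "nfaces z = 1" using z by (auto simp: good_def)
    interpret word_map \<iota> z by (rule inj_word_map[OF \<iota> val(1)])
    have sg: "(if twisted z then - of_int (weg z) else of_int (weg z) / 2) = (of_int g :: rat)"
      using z(1) signed_genus by (simp add: good_def)
    have weg: "weg z = int (length z div 2)" using val by (simp add: weg_def)
    have "length z \<noteq> 0" using nonempty by simp
    then have pos: "weg z > 0" using length_num_edges weg by presburger
    have len: "int (length z) = 2 * weg z" using length_num_edges weg by simp
    have hb: "\<not> twisted z" if "handle_blocks z"
    proof -
      have "handle_blocks u \<Longrightarrow> \<forall>h\<in>set u. \<not> tw h" for u
        by (induction rule: handle_blocks.induct) auto
      then show ?thesis using that by (auto simp: twisted_def)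
    qed
    have tb: "twisted z" if "twisted_blocks z"
      using that nonempty by (cases rule: twisted_blocks.cases) (auto simp: twisted_def)
    show ?thesis
    proof (cases "twisted z")
      case True
      then have "of_int (- weg z) = (of_int g :: rat)" using sg by simp
      then have "g = - weg z" by (metis of_int_eq_iff)
      moreover have "twisted_blocks z" "\<not> handle_blocks z" using z(2) hb True by auto
      ultimately show ?thesis using pos len by auto
    next
      case False
      then have "(of_int (weg z) :: rat) = of_int (2 * g)" using sg by simp
      then have "weg z = 2 * g" by (metis of_int_eq_iff)
      moreover have "handle_blocks z" "\<not> twisted_blocks z" using z(2) tb False by auto
      ultimately show ?thesis using pos len by auto
    qed
  qed
  obtain w' where w': "w \<leadsto> w'" "twisted_blocks w' \<or> handle_blocks w'" using normal_form[OF \<iota> w] by blast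
  obtain v' where v': "v \<leadsto> v'" "twisted_blocks v' \<or> handle_blocks v'" using normal_form[OF \<iota> v] by blast
  have gw: "good \<iota> g w'" "(wmap \<iota> w, wmap \<iota> w') \<in> linked g" using slide_conn_good[OF \<iota> w'(1) w] by auto
  have gv: "good \<iota> g v'" "(wmap \<iota> v, wmap \<iota> v') \<in> linked g" using slide_conn_good[OF \<iota> v'(1) v] by auto
  note sw = signs[OF gw(1) w'(2)] and sv = signs[OF gv(1) v'(2)]
  have len: "length w' = length v'" using sw sv by simp
  have dist: "distinct w'" using gw(1) by (simp add: good_def valid_def)
  have "\<exists>\<rho>. relabels \<rho> w' v'"
  proof (cases "twisted_blocks w'")
    case True
    then show ?thesis using twisted_blocks_relabel[OF True _ len dist] sw sv by blast
  next
    case False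
    then have "handle_blocks w'" "handle_blocks v'" using w'(2) sw sv by auto
    then show ?thesis using handle_blocks_relabel len dist by blast
  qed
  then obtain \<rho> where \<rho>: "relabels \<rho> w' v'" by blast
  have "(wmap \<iota> w', wmap \<iota> v') \<in> linked g"
    by (rule linked_relabel[OF _ _ \<rho>]) (use gw gv inj_word_map[OF \<iota>] in \<open>auto simp: good_def\<close>)
  then show ?thesis using gw(2) linked_sym[OF gv(2)] linked_trans by blast
qed

lemma core_linked_to_word:
  fixes N :: "'a cmap" and \<iota> :: "hedge \<times> bool \<Rightarrow> 'a"
  assumes \<iota>: "inj \<iota>" and N: "N \<in> cores g" and g: "g \<noteq> 0"
  shows "\<exists>w. good \<iota> g w \<and> (N, wmap \<iota> w) \<in> linked g"
proof -
  have Nm: "is_map N" and sgN: "signed_genus N = of_int g" using N by (auto simp: cores_def is_core_def)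
  have ne: "crosses N \<noteq> {}"
  proof
    assume "crosses N = {}"
    then show False using signed_genus_no_crosses[of N] sgN g by simp
  qed
  obtain P where P: "gluing\<^sup>*\<^sup>* N P" "is_map P" "signed_genus P = signed_genus N" "isolated P = 0" "card (vertices P) = 1"
    using glue_to_one_vertex[OF Nm ne] by blast
  obtain \<kappa> :: "hedge \<times> bool \<Rightarrow> 'a" and u where u: "word_map \<kappa> u" "P = wmap \<kappa> u"
    using one_vertex_is_word_map[OF P(2,4,5)] by blast
  obtain t where t: "word_map \<kappa> t" "gluing\<^sup>*\<^sup>* (wmap \<kappa> u) (wmap \<kappa> t)" "weg t = weg u" "twisted t = twisted u"
    "is_core (wmap \<kappa> t)"
    using remove_duplicates[OF u(1)] by blast
  have sgt: "signed_genus (wmap \<kappa> t) = of_int g"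
    using signed_genus_wmap_cong[OF u(1) t(1,3,4)] u(2) P(3) sgN by metis
  have "gluing\<^sup>*\<^sup>* N (wmap \<kappa> t)" using P(1) t(2) u(2) by (metis rtranclp_trans)
  then have "hom_exists N (wmap \<kappa> t)"
    unfolding hom_exists_def
    using Nm word_map.is_map[OF t(1)] sgN sgt submap_refl map_iso_refl by metis
  then have l1: "(N, wmap \<kappa> t) \<in> linked g"
    using N t(5) sgt by (intro linkedI) (auto simp: cores_def)
  have vt: "valid t" using t(1) by (simp add: word_map_def)
  have "weg t \<noteq> 0"
  proof
    assume "weg t = 0"
    then have "signed_genus (wmap \<kappa> t) = 0" unfolding word_map.signed_genus[OF t(1)] by simp
    then show False using sgt g by simp
  qed
  then obtain H where H: "H \<subseteq> set t" "\<forall>h\<in>H. bar h \<in> H" "valid (filter (\<lambda>h. h \<notin> H) t)"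
    "nfaces (filter (\<lambda>h. h \<notin> H) t) = 1" "weg (filter (\<lambda>h. h \<notin> H) t) = weg t"
    "twisted (filter (\<lambda>h. h \<notin> H) t) = twisted t"
    using one_face_subword[OF vt] by blast
  let ?s = "filter (\<lambda>h. h \<notin> H) t"
  have W: "word_map \<kappa> ?s" by (rule word_map.word_map_sub[OF t(1) H(3)]) auto
  have sgs: "signed_genus (wmap \<kappa> ?s) = of_int g"
    using signed_genus_wmap_cong[OF t(1) W H(5,6)] sgt by metis
  have "submap (wmap \<kappa> ?s) (wmap \<kappa> t)"
    by (rule word_map.submap_filter[OF t(1)]) (use H in \<open>auto simp: valid_def\<close>)
  then have "hom_exists (wmap \<kappa> ?s) (wmap \<kappa> t)"
    by (intro hom_exists_submap) (use W t(1) word_map.is_map sgs sgt in auto)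
  then have l2: "(wmap \<kappa> t, wmap \<kappa> ?s) \<in> linked g"
    using wmap_in_cores[OF W H(4) sgs] t(5) sgt by (intro linkedI) (auto simp: cores_def)
  \<comment> \<open>The embedding \<open>\<kappa>\<close> obtained from the given map need only be
    injective on the sides of its word. The change to the global \<open>\<iota>\<close>, an
    isomorphism of maps, provides crosses for the fresh edges of later slides.\<close>
  have W': "word_map \<iota> ?s" by (rule inj_word_map[OF \<iota> H(3)])
  have sgs': "signed_genus (wmap \<iota> ?s) = of_int g"
    using signed_genus_wmap_cong[OF W W' refl refl] sgs by metis
  have "relabels id ?s ?s" by (simp add: relabels_def)
  then have l3: "(wmap \<kappa> ?s, wmap \<iota> ?s) \<in> linked g"
    by (rule linked_relabel[OF W W' _ H(4) H(4) sgs sgs'])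
  have "good \<iota> g ?s" using H sgs' by (simp add: good_def)
  then show ?thesis using linked_trans[OF l1 linked_trans[OF l2 l3]] by blast
qed

section \<open>Genus zero and conclusion\<close>

definition empty_map :: "'a cmap" where
  "empty_map = \<lparr>crosses = {}, alpha0 = id, alpha1 = id, alpha2 = id, isolated = 0\<rparr>"

lemma empty_map_core: "empty_map \<in> cores 0"
proof -
  have c: "crosses (empty_map :: 'a cmap) = {}" "isolated (empty_map :: 'a cmap) = 0" by (simp_all add: empty_map_def)
  have m: "is_map (empty_map :: 'a cmap)"
    by (simp add: is_map_def fpf_involution_on_def empty_map_def permutes_id)
  have "\<not> gluing (empty_map :: 'a cmap) X" for X
    using c by (auto simp: gluing_def duplicate_edges_def edges_def orbits_on_def
        elim!: vertex_gluing.cases duplicate_gluing.cases)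
  then have "is_core (empty_map :: 'a cmap)" using rigid_is_core[OF m] c by simp
  then show ?thesis using signed_genus_no_crosses[OF c(1)] by (simp add: cores_def)
qed

lemma empty_map_submap:
  fixes N :: "'a cmap"
  assumes N: "is_map N"
  shows "submap empty_map N"
proof -
  let ?D = "del_edges N (edges N)"
  have C: "crosses N - \<Union>(edges N) = {}" by (auto simp: edges_def orbits_on_def)
  have D: "?D = empty_map\<lparr>isolated := isolated ?D\<rparr>"
    unfolding del_edges_def Let_def C by (simp add: empty_map_def id_def)
  have "vertex_deletion\<^sup>*\<^sup>* (empty_map\<lparr>isolated := k\<rparr> :: 'a cmap) empty_map" for k
  proof (induction k)
    case 0
    then show ?case by (simp add: empty_map_def)
  next
    case (Suc k)
    have "vertex_deletion (empty_map\<lparr>isolated := Suc k\<rparr> :: 'a cmap) (remove_isolated (empty_map\<lparr>isolated := Suc k\<rparr>))"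
      by (rule vertex_deletion.intros(2)) simp
    also have "remove_isolated (empty_map\<lparr>isolated := Suc k\<rparr> :: 'a cmap) = empty_map\<lparr>isolated := k\<rparr>"
      by (simp add: remove_isolated_def)
    finally show ?case using Suc by (rule converse_rtranclp_into_rtranclp)
  qed
  then have "vertex_deletion\<^sup>*\<^sup>* ?D empty_map" using D by metis
  then show ?thesis unfolding submap_def by blast
qed

lemma cores_linked:
  fixes N N' :: "'a::infinite cmap"
  assumes N: "N \<in> cores g" "N' \<in> cores g"
  shows "(N, N') \<in> linked g"
proof (cases "g = 0")
  case True
  have "(M, empty_map) \<in> linked g" if M: "M \<in> cores g" for M :: "'a cmap"
  proof (rule linkedI)
    show "M \<in> cores g" "empty_map \<in> cores g" using M empty_map_core True by auto
    have "is_map M" "signed_genus M = 0" using M True by (auto simp: cores_def is_core_def)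
    moreover have "is_map (empty_map :: 'a cmap)" "signed_genus (empty_map :: 'a cmap) = 0"
      using empty_map_core by (auto simp: cores_def is_core_def)
    ultimately have "hom_exists (empty_map :: 'a cmap) M" using hom_exists_submap empty_map_submap by metis
    then show "hom_exists M (empty_map :: 'a cmap) \<or> hom_exists (empty_map :: 'a cmap) M" ..
  qed
  then show ?thesis using N linked_sym linked_trans by blast
next
  case False
  \<comment> \<open>An infinite type contains a copy of the natural numbers, and there are countably
    many half-edges, so every side of every half-edge can be given its own cross.\<close>
  obtain e :: "nat \<Rightarrow> 'a" where "inj e" using arb_countable_map[of "{}"] by blast
  then have \<iota>: "inj (e \<circ> (to_nat :: hedge \<times> bool \<Rightarrow> nat))" (is "inj ?i")
    by (rule inj_compose) simp
  obtain w where w: "good ?i g w" "(N, wmap ?i w) \<in> linked g" using core_linked_to_word[OF \<iota> N(1) False] by blast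
  obtain v where v: "good ?i g v" "(N', wmap ?i v) \<in> linked g" using core_linked_to_word[OF \<iota> N(2) False] by blast
  show ?thesis
    using good_words_linked[OF \<iota> w(1) v(1)] w(2) linked_sym[OF v(2)] linked_trans by blast
qed

theorem theorem4p20:
  fixes g :: int
  shows "(\<forall>N N' :: 'a::infinite cmap. N \<in> cores g \<longrightarrow> N' \<in> cores g \<longrightarrow>
            (\<exists>(k::nat) (Ns :: nat \<Rightarrow> 'a cmap).
               Ns 0 = N \<and> Ns k = N' \<and>
               (\<forall>i\<le>k. Ns i \<in> cores g) \<and>
               (\<forall>i<k. hom_exists (Ns i) (Ns (Suc i)) \<or> hom_exists (Ns (Suc i)) (Ns i))))
         \<and> order_connected (core_classes g :: 'a cmap set set) class_le"
proof
  show "\<forall>N N' :: 'a cmap. N \<in> cores g \<longrightarrow> N' \<in> cores g \<longrightarrow>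
            (\<exists>(k::nat) (Ns :: nat \<Rightarrow> 'a cmap).
               Ns 0 = N \<and> Ns k = N' \<and>
               (\<forall>i\<le>k. Ns i \<in> cores g) \<and>
               (\<forall>i<k. hom_exists (Ns i) (Ns (Suc i)) \<or> hom_exists (Ns (Suc i)) (Ns i)))"
  proof (intro allI impI)
    fix N N' :: "'a cmap"
    assume N: "N \<in> cores g" "N' \<in> cores g"
    let ?R = "{(M, N :: 'a cmap). M \<in> cores g \<and> N \<in> cores g \<and> (hom_exists M N \<or> hom_exists N M)}"
    obtain k where "(N, N') \<in> ?R ^^ k"
      using cores_linked[OF N] unfolding linked_def by (auto simp: rtrancl_power)
    then obtain f where f: "f 0 = N" "f k = N'" "\<forall>i<k. (f i, f (Suc i)) \<in> ?R"
      by (auto simp: relpow_fun_conv)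
    have "f i \<in> cores g" if "i \<le> k" for i
      using that f N(2) by (cases "i = k") auto
    then show "\<exists>(k::nat) (Ns :: nat \<Rightarrow> 'a cmap). Ns 0 = N \<and> Ns k = N' \<and> (\<forall>i\<le>k. Ns i \<in> cores g) \<and>
               (\<forall>i<k. hom_exists (Ns i) (Ns (Suc i)) \<or> hom_exists (Ns (Suc i)) (Ns i))"
      using f by (intro exI[of _ k] exI[of _ f]) auto
  qed
  show "order_connected (core_classes g :: 'a cmap set set) class_le"
    unfolding order_connected_def
  proof (intro ballI)
    let ?iso = "{(M :: 'a cmap, N :: 'a cmap). M \<in> cores g \<and> N \<in> cores g \<and> map_iso M N}"
    let ?S = "{(u, v). u \<in> core_classes g \<and> v \<in> core_classes g \<and> (class_le u v \<or> class_le v u)} :: ('a cmap set \<times> 'a cmap set) set"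
    have self: "M \<in> ?iso `` {M}" "?iso `` {M} \<in> core_classes g" if M: "M \<in> cores g" for M
    proof -
      show "M \<in> ?iso `` {M}" using M map_iso_refl by blast
      show "?iso `` {M} \<in> core_classes g" unfolding core_classes_def using M by (rule quotientI)
    qed
    fix X Y :: "'a cmap set"
    assume "X \<in> core_classes g" "Y \<in> core_classes g"
    then have XY: "X \<in> cores g // ?iso" "Y \<in> cores g // ?iso" by (simp_all add: core_classes_def)
    obtain N where N: "X = ?iso `` {N}" "N \<in> cores g" using XY(1) by (rule quotientE)
    obtain N' where N': "Y = ?iso `` {N'}" "N' \<in> cores g" using XY(2) by (rule quotientE)
    have "(N, N') \<in> linked g" using cores_linked N(2) N'(2) by blast
    then have "(?iso `` {N}, ?iso `` {N'}) \<in> ?S\<^sup>*"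
      unfolding linked_def
    proof (induction rule: rtrancl_induct)
      case (step M P)
      then have MP: "M \<in> cores g" "P \<in> cores g" "hom_exists M P \<or> hom_exists P M" by auto
      then have "class_le (?iso `` {M}) (?iso `` {P}) \<or> class_le (?iso `` {P}) (?iso `` {M})"
        using self(1)[OF MP(1)] self(1)[OF MP(2)] unfolding class_le_def by blast
      then have "(?iso `` {M}, ?iso `` {P}) \<in> ?S" using self(2) MP by blast
      with step.IH show ?case by (rule rtrancl_into_rtrancl)
    qed simp
    then show "(X, Y) \<in> ?S\<^sup>*" using N(1) N'(1) by simp
  qed
qed

end
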